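(* Let $Q\in\mathbb R^{p\times p}$ be symmetric, let $A\in\mathbb R^{q\times p}$ and $B\in\mathbb R^{r\times p}$ have full row rank, and suppose $\begin{bmatrix}A^T&B^T\end{bmatrix}$ has rank $q+r$. Consider the quadratic program $$\text{minimize}_{\eta}\ \eta^TQ\eta\quad\text{subject to}\quad A\eta=0_q,\ B\eta\ge 0_r ,$$ with feasible set $\mathcal S=\{\eta\in\mathbb R^p:A\eta=0,\ B\eta\ge0\}$. Then there exists a method that determines which of (T1), (T2), (T3) holds in $O(p^3+r^32^r)$ time.
   Context: Vector inequalities are entrywise. The three mutually exclusive conditions are: (T1) $\eta^TQ\eta>0$ whenever $\eta\in\mathcal S$, $\eta\ne0$; (T2) $\eta^TQ\eta\ge0$ whenever $\eta\in\mathcal S$, but there exists $\eta\in\mathcal S$, $\eta\neq0$ with $\eta^TQ\eta=0$; (T3) there exists $\eta\in\mathcal S$ with $\eta^TQ\eta<0$. Time is counted in real arithmetic operations, with the computation of the eigensystem of an $n\times n$ symmetric matrix counted as $O(n^3)$ time. *)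

theory Defs
  imports "Jordan_Normal_Form.DL_Rank" "Jordan_Normal_Form.Char_Poly"
    "HOL-Library.Landau_Symbols"
begin

section \<open>The quadratic program and the three cases\<close>

definition feasible_set :: "real mat \<Rightarrow> real mat \<Rightarrow> real vec set" where
  "feasible_set A B =
     {\<eta> \<in> carrier_vec (dim_col A).
        A *\<^sub>v \<eta> = 0\<^sub>v (dim_row A) \<and> B *\<^sub>v \<eta> \<ge> 0\<^sub>v (dim_row B)}"

definition T1 :: "real mat \<Rightarrow> real vec set \<Rightarrow> bool" where
  "T1 Q S \<longleftrightarrow> (\<forall>\<eta>\<in>S. \<eta> \<noteq> 0\<^sub>v (dim_row Q) \<longrightarrow> \<eta> \<bullet> (Q *\<^sub>v \<eta>) > 0)"

definition T2 :: "real mat \<Rightarrow> real vec set \<Rightarrow> bool" where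
  "T2 Q S \<longleftrightarrow> (\<forall>\<eta>\<in>S. \<eta> \<bullet> (Q *\<^sub>v \<eta>) \<ge> 0) \<and>
     (\<exists>\<eta>\<in>S. \<eta> \<noteq> 0\<^sub>v (dim_row Q) \<and> \<eta> \<bullet> (Q *\<^sub>v \<eta>) = 0)"

definition T3 :: "real mat \<Rightarrow> real vec set \<Rightarrow> bool" where
  "T3 Q S \<longleftrightarrow> (\<exists>\<eta>\<in>S. \<eta> \<bullet> (Q *\<^sub>v \<eta>) < 0)"


section \<open>Eigensystems\<close>

definition eigensystem :: "real mat \<Rightarrow> real vec \<Rightarrow> real mat \<Rightarrow> bool" where
  "eigensystem M l U \<longleftrightarrow>
     l \<in> carrier_vec (dim_row M) \<and> U \<in> carrier_mat (dim_row M) (dim_row M) \<and>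
     transpose_mat U * U = 1\<^sub>m (dim_row M) \<and>
     (\<forall>j<dim_row M. eigenvector M (col U j) (l $ j))"

text \<open>Eigensystems are not unique. An eigensolver may return any of them, and nothing is known
  about its answer on a matrix that is not symmetric.\<close>

definition eigensolver :: "(real mat \<Rightarrow> real vec \<times> real mat) \<Rightarrow> bool" where
  "eigensolver eig \<longleftrightarrow>
     (\<forall>n. \<forall>M \<in> carrier_mat n n. transpose_mat M = M \<longrightarrow>
        eigensystem M (fst (eig M)) (snd (eig M)))"


section \<open>A real random access machine\<close>

text \<open>A method is a single finite program, used for all dimensions and all data. Its memory
  consists of registers holding natural numbers, used for control and for indexing, and of
  two-dimensional arrays of reals. To exclude hidden computations, reals influence the control
  flow only through comparisons, the only real literals are integers, and registers
  are combined by addition and truncated subtraction only (matrix entries have two indices, so no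
  multiplication of indices is needed).\<close>

datatype nexp =
    Lit nat
  | Reg nat
  | NAdd nexp nexp
  | NSub nexp nexp

datatype rexp =
    Const int
  | Entry nat nexp nexp  \<comment> \<open>array name, row, column\<close>
  | RAdd rexp rexp
  | RSub rexp rexp
  | RMul rexp rexp
  | RDiv rexp rexp

datatype bexp =
    NLess nexp nexp
  | RLess rexp rexp
  | Neg bexp
  | Conj bexp bexp

datatype com =
    Skip
  | SetReg nat nexp
  | SetEntry nat nexp nexp rexp
  | Seq com com
  | If bexp com com
  | While bexp com
  | Eig nexp nat nat nat
      \<comment> \<open>order, array of the matrix, array for the eigenvalues (in row 0),
        array for the eigenvectors (as columns)\<close>

record memory =
  reg :: "nat \<Rightarrow> nat"
  arr :: "nat \<Rightarrow> nat \<Rightarrow> nat \<Rightarrow> real"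

primrec nval :: "memory \<Rightarrow> nexp \<Rightarrow> nat" where
  "nval s (Lit k) = k"
| "nval s (Reg x) = reg s x"
| "nval s (NAdd a b) = nval s a + nval s b"
| "nval s (NSub a b) = nval s a - nval s b"

text \<open>Division by zero yields zero, as everywhere in HOL; a program can test the divisor.\<close>

primrec rval :: "memory \<Rightarrow> rexp \<Rightarrow> real" where
  "rval s (Const k) = of_int k"
| "rval s (Entry a i j) = arr s a (nval s i) (nval s j)"
| "rval s (RAdd a b) = rval s a + rval s b"
| "rval s (RSub a b) = rval s a - rval s b"
| "rval s (RMul a b) = rval s a * rval s b"
| "rval s (RDiv a b) = rval s a / rval s b"

primrec bval :: "memory \<Rightarrow> bexp \<Rightarrow> bool" where
  "bval s (NLess a b) \<longleftrightarrow> nval s a < nval s b"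
| "bval s (RLess a b) \<longleftrightarrow> rval s a < rval s b"
| "bval s (Neg b) \<longleftrightarrow> \<not> bval s b"
| "bval s (Conj a b) \<longleftrightarrow> bval s a \<and> bval s b"

text \<open>The time charges every elementary operation, including memory access, comparisons, and
  operations on indices. In particular it bounds the number of real arithmetic operations.\<close>

primrec ntime :: "nexp \<Rightarrow> nat" where
  "ntime (Lit k) = 1"
| "ntime (Reg x) = 1"
| "ntime (NAdd a b) = 1 + ntime a + ntime b"
| "ntime (NSub a b) = 1 + ntime a + ntime b"

primrec rtime :: "rexp \<Rightarrow> nat" where
  "rtime (Const k) = 1"
| "rtime (Entry a i j) = 1 + ntime i + ntime j"
| "rtime (RAdd a b) = 1 + rtime a + rtime b"
| "rtime (RSub a b) = 1 + rtime a + rtime b"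
| "rtime (RMul a b) = 1 + rtime a + rtime b"
| "rtime (RDiv a b) = 1 + rtime a + rtime b"

primrec btime :: "bexp \<Rightarrow> nat" where
  "btime (NLess a b) = 1 + ntime a + ntime b"
| "btime (RLess a b) = 1 + rtime a + rtime b"
| "btime (Neg b) = 1 + btime b"
| "btime (Conj a b) = 1 + btime a + btime b"

definition set_reg :: "nat \<Rightarrow> nat \<Rightarrow> memory \<Rightarrow> memory" where
  "set_reg x k s = s\<lparr>reg := (reg s)(x := k)\<rparr>"

definition set_entry :: "nat \<Rightarrow> nat \<Rightarrow> nat \<Rightarrow> real \<Rightarrow> memory \<Rightarrow> memory" where
  "set_entry a i j v s = s\<lparr>arr := (arr s)(a := (arr s a)(i := (arr s a i)(j := v)))\<rparr>"

definition store_mat :: "nat \<Rightarrow> real mat \<Rightarrow> memory \<Rightarrow> memory" where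
  "store_mat a M s = s\<lparr>arr := (arr s)(a := (\<lambda>i j.
     if i < dim_row M \<and> j < dim_col M then M $$ (i, j) else arr s a i j))\<rparr>"

definition load_mat :: "nat \<Rightarrow> nat \<Rightarrow> memory \<Rightarrow> real mat" where
  "load_mat a n s = mat n n (\<lambda>(i, j). arr s a i j)"

text \<open>\<open>run eig ec c s t s'\<close>: started in \<open>s\<close>, the program \<open>c\<close> terminates in
  \<open>s'\<close> after time \<open>t\<close>, where \<open>eig\<close> computes the eigensystems and \<open>ec n\<close> is the time charged
  for the eigensystem of a matrix of order \<open>n\<close>.\<close>

inductive run ::
  "(real mat \<Rightarrow> real vec \<times> real mat) \<Rightarrow> (nat \<Rightarrow> nat) \<Rightarrow> com \<Rightarrow> memory \<Rightarrow> nat \<Rightarrow> memory \<Rightarrow> bool"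
  for eig :: "real mat \<Rightarrow> real vec \<times> real mat" and ec :: "nat \<Rightarrow> nat"
where
  Skip: "run eig ec Skip s 1 s"
| SetReg: "run eig ec (SetReg x e) s (1 + ntime e) (set_reg x (nval s e) s)"
| SetEntry: "run eig ec (SetEntry a i j e) s (1 + ntime i + ntime j + rtime e)
    (set_entry a (nval s i) (nval s j) (rval s e) s)"
| Seq: "run eig ec c s t s' \<Longrightarrow> run eig ec d s' t' s'' \<Longrightarrow>
    run eig ec (Seq c d) s (1 + t + t') s''"
| IfTrue: "bval s b \<Longrightarrow> run eig ec c s t s' \<Longrightarrow>
    run eig ec (If b c d) s (1 + btime b + t) s'"
| IfFalse: "\<not> bval s b \<Longrightarrow> run eig ec d s t s' \<Longrightarrow>
    run eig ec (If b c d) s (1 + btime b + t) s'"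
| WhileFalse: "\<not> bval s b \<Longrightarrow> run eig ec (While b c) s (1 + btime b) s"
| WhileTrue: "bval s b \<Longrightarrow> run eig ec c s t s' \<Longrightarrow> run eig ec (While b c) s' t' s'' \<Longrightarrow>
    run eig ec (While b c) s (1 + btime b + t + t') s''"
| Eig: "nval s e = n \<Longrightarrow> eig (load_mat a n s) = (l, U) \<Longrightarrow>
    run eig ec (Eig e a b c) s (1 + ntime e + ec n)
      (store_mat c (mat n n (\<lambda>(i, j). U $$ (i, j)))
        (store_mat b (mat 1 n (\<lambda>(i, j). l $ j)) s))"

inductive_cases run_SkipE: "run eig ec Skip s t s'"
inductive_cases run_SetRegE: "run eig ec (SetReg x e) s t s'"
inductive_cases run_SetEntryE: "run eig ec (SetEntry a i j e) s t s'"
inductive_cases run_SeqE: "run eig ec (Seq c d) s t s'"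
inductive_cases run_IfE: "run eig ec (If b c d) s t s'"
inductive_cases run_WhileE: "run eig ec (While b c) s t s'"
inductive_cases run_EigE: "run eig ec (Eig e a b c) s t s'"

lemma run_deterministic:
  "run eig ec c s t s' \<Longrightarrow> run eig ec c s u s'' \<Longrightarrow> u = t \<and> s'' = s'"
proof (induction arbitrary: u s'' rule: run.induct)
  case (Skip s) then show ?case by (auto elim!: run_SkipE)
next
  case (SetReg x e s) then show ?case by (auto elim!: run_SetRegE)
next
  case (SetEntry a i j e s) then show ?case by (auto elim!: run_SetEntryE)
next
  case (Seq c s t s' d t' s1)
  from Seq.prems obtain v m v' where
    "run eig ec c s v m" and "run eig ec d m v' s''" and "u = 1 + v + v'"
    by (elim run_SeqE) simp
  with Seq.IH show ?case by metis
next
  case (IfTrue s b c t s' d)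
  from IfTrue.prems IfTrue.hyps obtain v where "run eig ec c s v s''" "u = 1 + btime b + v"
    by (elim run_IfE) simp_all
  with IfTrue.IH show ?case by metis
next
  case (IfFalse s b d t s' c)
  from IfFalse.prems IfFalse.hyps obtain v where "run eig ec d s v s''" "u = 1 + btime b + v"
    by (elim run_IfE) simp_all
  with IfFalse.IH show ?case by metis
next
  case (WhileFalse s b c)
  from WhileFalse.prems show ?case by (rule run_WhileE) (use WhileFalse.hyps in simp_all)
next
  case (WhileTrue s b c t s' t' s1)
  from WhileTrue.hyps WhileTrue.prems obtain v m v' where
    "run eig ec c s v m" and "run eig ec (While b c) m v' s''" and "u = 1 + btime b + v + v'"
    by - (erule run_WhileE, simp_all)
  with WhileTrue.IH show ?case by metis
next
  case (Eig s e n a l U b c)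
  from Eig.prems Eig.hyps show ?case by (elim run_EigE) simp
qed

text \<open>Inputs: the dimensions \<open>p\<close>, \<open>q\<close>, \<open>r\<close> are in registers 0, 1, 2 and the matrices
  \<open>Q\<close>, \<open>A\<close>, \<open>B\<close> in arrays 0, 1, 2; everything else is zero. The output is register 0.\<close>

definition initial :: "real mat \<Rightarrow> real mat \<Rightarrow> real mat \<Rightarrow> memory" where
  "initial Q A B =
     store_mat 0 Q (store_mat 1 A (store_mat 2 B
       \<lparr>reg = (\<lambda>_. 0)(0 := dim_row Q, 1 := dim_row A, 2 := dim_row B),
        arr = (\<lambda>_ _ _. 0)\<rparr>))"

end

theory Submission
  imports Defs "HOL-Analysis.Function_Topology"
begin

text \<open>Since \<open>[A\<^sup>T B\<^sup>T]\<close> has full rank, column operations turn the constraints into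
  \<open>\<eta>\<^sub>i = 0\<close> for \<open>q\<close> coordinates and \<open>\<eta>\<^sub>i \<ge> 0\<close> for \<open>r\<close> others, and the remaining coordinates are free.
  A free coordinate with a positive diagonal entry is minimised out by a Schur complement; one with
  a negative diagonal entry, or with a zero diagonal entry and a nonzero row, yields (T3); one with
  a zero row excludes (T1). There remains a symmetric \<open>r \<times> r\<close> matrix \<open>P\<close> on the nonnegative
  orthant. A minimiser on the simplex of \<open>x\<^sup>T P x\<close> with minimal support \<open>I\<close> has a nonsingular KKT
  matrix, hence is found by solving one linear system for each of the \<open>2\<^sup>r\<close> sets \<open>I\<close>. Candidates
  coming from singular systems are harmless because every candidate is checked directly. No
  eigensystem is needed.\<close>


section \<open>Time-bounded total correctness\<close>

text \<open>The factor \<open>r^3\<close> allows one dense elimination of order \<open>r + 1\<close>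
  per face and nothing adaptive. A mere minimiser would not do: it may sit in a continuum of
  minimisers on its face, and then the linear system of that face does not determine it. One
  elimination routine serves twice. It works by column operations on a matrix placed above an
  identity block, and the block records the operations: below the constraints it becomes the change
  of variables, below a KKT matrix it becomes the inverse, whose last column is the candidate. The
  routine has a time bound for every input but a meaningful result only for independent rows. On a
  singular matrix it pivots on arbitrary entries, divides, possibly by zero, and still halts. So no
  singularity test is needed, and each specification separates an unconditional part (time,
  soundness of the flags) from a conditional one (completeness). Registers cannot be halved, so the
  subsets are decoded from their numbers by doubling, leading binary digit first. The numerical
  constants are generous counts of machine steps.\<close>

definition computes ::
  "(real mat \<Rightarrow> real vec \<times> real mat) \<Rightarrow> (nat \<Rightarrow> nat) \<Rightarrow> com \<Rightarrow> memory \<Rightarrow> nat \<Rightarrow>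
    (memory \<Rightarrow> bool) \<Rightarrow> bool" where
  "computes eig ec c s T \<Phi> \<longleftrightarrow> (\<exists>t s'. run eig ec c s t s' \<and> t \<le> T \<and> \<Phi> s')"

primrec reg_writes :: "com \<Rightarrow> nat set" where
  "reg_writes Skip = {}"
| "reg_writes (SetReg x e) = {x}"
| "reg_writes (SetEntry a i j e) = {}"
| "reg_writes (Seq c d) = reg_writes c \<union> reg_writes d"
| "reg_writes (If b c d) = reg_writes c \<union> reg_writes d"
| "reg_writes (While b c) = reg_writes c"
| "reg_writes (Eig e a b c) = {}"

primrec arr_writes :: "com \<Rightarrow> nat set" where
  "arr_writes Skip = {}"
| "arr_writes (SetReg x e) = {}"
| "arr_writes (SetEntry a i j e) = {a}"
| "arr_writes (Seq c d) = arr_writes c \<union> arr_writes d"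
| "arr_writes (If b c d) = arr_writes c \<union> arr_writes d"
| "arr_writes (While b c) = arr_writes c"
| "arr_writes (Eig e a b c) = {b, c}"

text \<open>This is the frame condition. The names that may be written are read off the syntax, so a
  specification mentions only what changes; the rules for consequence, sequencing and loops supply
  the rest.\<close>

definition agree :: "nat set \<Rightarrow> nat set \<Rightarrow> memory \<Rightarrow> memory \<Rightarrow> bool" where
  "agree X Y s s' \<longleftrightarrow> (\<forall>x. x \<notin> X \<longrightarrow> reg s' x = reg s x) \<and> (\<forall>a. a \<notin> Y \<longrightarrow> arr s' a = arr s a)"

lemma agree_refl [simp]: "agree X Y s s"
  by (simp add: agree_def)

lemma agree_trans: "agree X Y s s' \<Longrightarrow> agree X Y s' s'' \<Longrightarrow> agree X Y s s''"
  by (simp add: agree_def)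

lemma agree_mono: "agree X Y s s' \<Longrightarrow> X \<subseteq> X' \<Longrightarrow> Y \<subseteq> Y' \<Longrightarrow> agree X' Y' s s'"
  unfolding agree_def by blast

lemma agree_regD: "agree X Y s s' \<Longrightarrow> x \<notin> X \<Longrightarrow> reg s' x = reg s x"
  by (simp add: agree_def)

lemma agree_arrD: "agree X Y s s' \<Longrightarrow> a \<notin> Y \<Longrightarrow> arr s' a = arr s a"
  by (simp add: agree_def)

lemma reg_set_reg [simp]: "reg (set_reg x k s) y = (if y = x then k else reg s y)"
  by (simp add: set_reg_def)

lemma arr_set_reg [simp]: "arr (set_reg x k s) = arr s"
  by (simp add: set_reg_def)

lemma reg_set_entry [simp]: "reg (set_entry a i j v s) = reg s"
  by (simp add: set_entry_def)

lemma arr_set_entry [simp]: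
  "arr (set_entry a i j v s) = (arr s)(a := (arr s a)(i := (arr s a i)(j := v)))"
  by (simp add: set_entry_def)

lemma agree_set_reg: "x \<in> X \<Longrightarrow> agree X Y s (set_reg x k s)"
  by (auto simp: agree_def)

lemma run_agree: "run eig ec c s t s' \<Longrightarrow> agree (reg_writes c) (arr_writes c) s s'"
proof (induction rule: run.induct)
  case (Seq c s t s' d t' s'')
  then show ?case by (auto simp: agree_def)
next
  case (WhileTrue s b c t s' t' s'')
  then show ?case by (auto simp: agree_def)
qed (auto simp: agree_def store_mat_def)

lemma computes_mono:
  assumes "computes eig ec c s T \<Phi>" "T \<le> T'"
    and "\<And>s'. \<Phi> s' \<Longrightarrow> agree (reg_writes c) (arr_writes c) s s' \<Longrightarrow> \<Psi> s'"
  shows "computes eig ec c s T' \<Psi>"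
  using assms run_agree unfolding computes_def by (metis le_trans)

lemma computes_Seq:
  assumes "computes eig ec c s T \<Phi>"
    and "\<And>s'. \<Phi> s' \<Longrightarrow> agree (reg_writes c) (arr_writes c) s s' \<Longrightarrow> computes eig ec d s' T' \<Psi>"
  shows "computes eig ec (Seq c d) s (1 + T + T') \<Psi>"
proof -
  obtain t s' where 1: "run eig ec c s t s'" "t \<le> T" "\<Phi> s'"
    using assms(1) by (auto simp: computes_def)
  obtain u s'' where 2: "run eig ec d s' u s''" "u \<le> T'" "\<Psi> s''"
    using assms(2)[OF 1(3) run_agree[OF 1(1)]] by (auto simp: computes_def)
  have "1 + t + u \<le> 1 + T + T'"
    using 1 2 by simp
  then show ?thesis
    using run.Seq[OF 1(1) 2(1)] 2(3) unfolding computes_def by blast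
qed

lemma computes_If:
  assumes "bval s b \<Longrightarrow> computes eig ec c s T \<Phi>"
    and "\<not> bval s b \<Longrightarrow> computes eig ec d s T \<Phi>"
  shows "computes eig ec (If b c d) s (1 + btime b + T) \<Phi>"
proof (cases "bval s b")
  case True
  then obtain t s' where "run eig ec c s t s'" "t \<le> T" "\<Phi> s'"
    using assms(1) by (auto simp: computes_def)
  then show ?thesis
    using run.IfTrue[OF True] unfolding computes_def by (meson add_le_mono1 nat_add_left_cancel_le)
next
  case False
  then obtain t s' where "run eig ec d s t s'" "t \<le> T" "\<Phi> s'"
    using assms(2) by (auto simp: computes_def)
  then show ?thesis
    using run.IfFalse[OF False] unfolding computes_def by (meson add_le_mono1 nat_add_left_cancel_le)
qed

section \<open>Loop-free commands as functions on memories\<close>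

primrec loopfree :: "com \<Rightarrow> bool" where
  "loopfree Skip \<longleftrightarrow> True"
| "loopfree (SetReg x e) \<longleftrightarrow> True"
| "loopfree (SetEntry a i j e) \<longleftrightarrow> True"
| "loopfree (Seq c d) \<longleftrightarrow> loopfree c \<and> loopfree d"
| "loopfree (If b c d) \<longleftrightarrow> loopfree c \<and> loopfree d"
| "loopfree (While b c) \<longleftrightarrow> False"
| "loopfree (Eig e a b c) \<longleftrightarrow> False"

text \<open>Straight-line code is run by the simplifier instead of by derivations of
  \<open>run\<close>. The clauses for \<open>While\<close> and \<open>Eig\<close> are placeholders
  that \<open>loopfree\<close> excludes.\<close>

primrec exec :: "com \<Rightarrow> memory \<Rightarrow> memory" where
  "exec Skip s = s"
| "exec (SetReg x e) s = set_reg x (nval s e) s"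
| "exec (SetEntry a i j e) s = set_entry a (nval s i) (nval s j) (rval s e) s"
| "exec (Seq c d) s = exec d (exec c s)"
| "exec (If b c d) s = (if bval s b then exec c s else exec d s)"
| "exec (While b c) s = s"
| "exec (Eig e a b c) s = s"

text \<open>The branches of \<open>If\<close> are added rather than maximised, a coarse bound that
  is still a constant for concrete code.\<close>

primrec ctime :: "com \<Rightarrow> nat" where
  "ctime Skip = 1"
| "ctime (SetReg x e) = 1 + ntime e"
| "ctime (SetEntry a i j e) = 1 + ntime i + ntime j + rtime e"
| "ctime (Seq c d) = 1 + ctime c + ctime d"
| "ctime (If b c d) = 1 + btime b + ctime c + ctime d"
| "ctime (While b c) = 0"
| "ctime (Eig e a b c) = 0"

lemma computes_loopfree:
  assumes "loopfree c" "ctime c \<le> T" "\<Phi> (exec c s)"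
  shows "computes eig ec c s T \<Phi>"
proof -
  have "\<exists>t. run eig ec c s t (exec c s) \<and> t \<le> ctime c"
    using assms(1)
  proof (induction c arbitrary: s)
    case Skip
    then show ?case using run.Skip by fastforce
  next
    case (SetReg x e)
    then show ?case using run.SetReg by fastforce
  next
    case (SetEntry a i j e)
    then show ?case using run.SetEntry by fastforce
  next
    case (Seq c d)
    then obtain t u where "run eig ec c s t (exec c s)" "t \<le> ctime c"
      "run eig ec d (exec c s) u (exec d (exec c s))" "u \<le> ctime d"
      by fastforce
    then show ?case
      using run.Seq by (intro exI[of _ "1 + t + u"]) auto
  next
    case (If b c d)
    then obtain t u where "run eig ec c s t (exec c s)" "t \<le> ctime c"
      "run eig ec d s u (exec d s)" "u \<le> ctime d"
      by fastforce
    then show ?case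
      using run.IfTrue[of s b eig ec c t] run.IfFalse[of s b eig ec d u]
      by (cases "bval s b") (force intro: exI[of _ "1 + btime b + t"] exI[of _ "1 + btime b + u"])+
  qed auto
  then show ?thesis
    using assms(2,3) unfolding computes_def by (meson le_trans)
qed

section \<open>Counting loops\<close>

definition For :: "nat \<Rightarrow> nat \<Rightarrow> com \<Rightarrow> com" where
  "For x y c = Seq (SetReg x (Lit 0))
     (While (NLess (Reg x) (Reg y)) (Seq c (SetReg x (NAdd (Reg x) (Lit 1)))))"

lemma reg_writes_For [simp]: "reg_writes (For x y c) = insert x (reg_writes c)"
  by (simp add: For_def)

lemma arr_writes_For [simp]: "arr_writes (For x y c) = arr_writes c"
  by (simp add: For_def)

text \<open>\<open>I k\<close> holds when round \<open>k\<close> begins, and the body establishes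
  \<open>I (Suc k)\<close> before the counter moves; \<open>I_reg\<close> therefore asks that the
  invariant survive changes of the counter. Beyond its body a round costs 9: 4 for loop and guard, 1
  for sequencing, 4 for the increment. Initialisation and the failing last test cost 7 and are
  covered by the extra round in \<open>N + 1\<close>.\<close>

lemma computes_For:
  assumes x: "x \<notin> reg_writes c" and y: "y \<notin> insert x (reg_writes c)"
    and N: "reg s0 y = N"
    and I0: "I 0 s0"
    and I_reg: "\<And>k v s. I k s \<Longrightarrow> I k (set_reg x v s)"
    and step: "\<And>k s. k < N \<Longrightarrow> I k s \<Longrightarrow> reg s x = k \<Longrightarrow>
        agree (insert x (reg_writes c)) (arr_writes c) s0 s \<Longrightarrow> computes eig ec c s T (I (Suc k))"
  shows "computes eig ec (For x y c) s0 ((N + 1) * (T + 9)) (I N)"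
proof -
  let ?A = "agree (insert x (reg_writes c)) (arr_writes c) s0"
  let ?W = "While (NLess (Reg x) (Reg y)) (Seq c (SetReg x (NAdd (Reg x) (Lit 1))))"
  have loop: "computes eig ec ?W s ((N - k) * (T + 9) + 4) (I N)"
    if "k \<le> N" "I k s" "reg s x = k" "?A s" for k s
    using that
  proof (induction "N - k" arbitrary: k s)
    case 0
    then have "\<not> bval s (NLess (Reg x) (Reg y))"
      using agree_regD[OF 0(5) y] N by simp
    from run.WhileFalse[OF this] 0 show ?case
      unfolding computes_def by fastforce
  next
    case (Suc d)
    then have k: "k < N" by simp
    obtain t s' where r: "run eig ec c s t s'" "t \<le> T" "I (Suc k) s'"
      using step[OF k Suc(4-6)] by (auto simp: computes_def)
    let ?s = "set_reg x (Suc k) s'"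
    have ag: "agree (reg_writes c) (arr_writes c) s s'"
      by (rule run_agree[OF r(1)])
    have x': "reg s' x = k"
      using agree_regD[OF ag x] Suc by simp
    have "?A s'"
      using agree_trans[OF Suc(6) agree_mono[OF ag]] by blast
    then have A: "?A ?s"
      by (rule agree_trans) (simp add: agree_set_reg)
    have "computes eig ec ?W ?s ((N - Suc k) * (T + 9) + 4) (I N)"
      by (rule Suc(1)) (use Suc k r A I_reg in auto)
    then obtain u s'' where u: "run eig ec ?W ?s u s''"
      "u \<le> (N - Suc k) * (T + 9) + 4" "I N s''"
      by (auto simp: computes_def)
    have "bval s (NLess (Reg x) (Reg y))"
      using agree_regD[OF Suc(6) y] N k Suc by simp
    moreover have "run eig ec (Seq c (SetReg x (NAdd (Reg x) (Lit 1)))) s (1 + t + 4) ?s"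
      using run.Seq[OF r(1) run.SetReg[of eig ec x "NAdd (Reg x) (Lit 1)" s']] x'
      by (simp add: eval_nat_numeral)
    ultimately have "run eig ec ?W s (1 + 3 + (1 + t + 4) + u) s''"
      using run.WhileTrue u(1) by fastforce
    moreover have "N - k = Suc (N - Suc k)"
      using k by simp
    then have "1 + 3 + (1 + t + 4) + u \<le> (N - k) * (T + 9) + 4"
      using u(2) r(2) by simp
    ultimately show ?case
      using u(3) unfolding computes_def by blast
  qed
  have "computes eig ec (For x y c) s0 (1 + 2 + (N * (T + 9) + 4)) (I N)"
    unfolding For_def
  proof (rule computes_Seq)
    show "computes eig ec (SetReg x (Lit 0)) s0 2 (\<lambda>s. s = set_reg x 0 s0)"
      by (rule computes_loopfree) auto
  next
    fix s assume "s = set_reg x 0 s0"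
    then show "computes eig ec ?W s (N * (T + 9) + 4) (I N)"
      using loop[of 0 s] I0 I_reg by (simp add: agree_set_reg)
  qed
  then show ?thesis
    by (rule computes_mono) auto
qed

text \<open>The command \<open>c\<close> may read \<open>X\<close> itself, so it is executed in a state in which exactly the
  entries before \<open>(i, j)\<close> in lexicographic order have been replaced.\<close>

lemma computes_fill:
  fixes f :: "nat \<Rightarrow> nat \<Rightarrow> real"
  assumes w: "i \<notin> reg_writes c" "j \<notin> reg_writes c" "y \<notin> reg_writes c" "z \<notin> reg_writes c"
    "i \<noteq> j" "y \<noteq> i" "y \<noteq> j" "z \<noteq> i" "z \<noteq> j"
    and N: "reg s0 y = N" "reg s0 z = M"
    and step: "\<And>a b s. a < N \<Longrightarrow> b < M \<Longrightarrow> reg s i = a \<Longrightarrow> reg s j = b \<Longrightarrow>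
        agree ({i, j} \<union> reg_writes c) (arr_writes c) s0 s \<Longrightarrow>
        arr s X = (\<lambda>u v. if u < a \<and> v < M \<or> u = a \<and> v < b then f u v else arr s0 X u v) \<Longrightarrow>
        computes eig ec c s T (\<lambda>s'. arr s' X = (arr s X)(a := (arr s X a)(b := f a b)))"
  shows "computes eig ec (For i y (For j z c)) s0 ((N + 1) * ((M + 1) * (T + 9) + 9))
    (\<lambda>s'. arr s' X = (\<lambda>u v. if u < N \<and> v < M then f u v else arr s0 X u v))"
proof (rule computes_For[where I = "\<lambda>a s'. arr s' X = (\<lambda>u v. if u < a \<and> v < M then f u v else arr s0 X u v)"])
  fix a s
  assume a: "a < N" and s: "arr s X = (\<lambda>u v. if u < a \<and> v < M then f u v else arr s0 X u v)"
    and i: "reg s i = a"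
    and ag: "agree (insert i (reg_writes (For j z c))) (arr_writes (For j z c)) s0 s"
  let ?I = "\<lambda>b s'. arr s' X =
    (\<lambda>u v. if u < a \<and> v < M \<or> u = a \<and> v < b then f u v else arr s0 X u v)"
  have "computes eig ec (For j z c) s ((M + 1) * (T + 9)) (?I M)"
  proof (rule computes_For[where I = ?I])
    show "?I 0 s" using s by (auto simp: fun_eq_iff)
    show "reg s z = M" using agree_regD[OF ag, of z] w N by simp
    fix b s'
    assume b: "b < M" and s': "?I b s'" and j: "reg s' j = b"
      and ag': "agree (insert j (reg_writes c)) (arr_writes c) s s'"
    have "agree ({i, j} \<union> reg_writes c) (arr_writes c) s0 s"
      by (rule agree_mono[OF ag]) auto
    moreover have "agree ({i, j} \<union> reg_writes c) (arr_writes c) s s'"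
      by (rule agree_mono[OF ag']) auto
    ultimately have "agree ({i, j} \<union> reg_writes c) (arr_writes c) s0 s'"
      by (rule agree_trans)
    moreover have "reg s' i = a"
      using agree_regD[OF ag', of i] w i by simp
    ultimately have "computes eig ec c s' T (\<lambda>s''. arr s'' X = (arr s' X)(a := (arr s' X a)(b := f a b)))"
      using step[OF a b _ j _ s'] by blast
    then show "computes eig ec c s' T (?I (Suc b))"
      by (rule computes_mono) (use s' in \<open>auto simp: fun_eq_iff less_Suc_eq\<close>)
  qed (use w in auto)
  then show "computes eig ec (For j z c) s ((M + 1) * (T + 9))
     (\<lambda>s'. arr s' X = (\<lambda>u v. if u < Suc a \<and> v < M then f u v else arr s0 X u v))"
    by (rule computes_mono) (auto simp: fun_eq_iff less_Suc_eq)
qed (use w N in auto)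

lemma computes_SeqI:
  assumes "computes eig ec c s T \<Phi>"
    and "\<And>s'. \<Phi> s' \<Longrightarrow> agree (reg_writes c) (arr_writes c) s s' \<Longrightarrow> computes eig ec d s' T' \<Psi>"
    and "1 + T + T' \<le> U"
  shows "computes eig ec (Seq c d) s U \<Psi>"
  using computes_mono[OF computes_Seq[OF assms(1,2)] assms(3)] by blast

lemma computes_IfI:
  assumes "bval s b \<Longrightarrow> computes eig ec c s T \<Phi>"
    and "\<not> bval s b \<Longrightarrow> computes eig ec d s T \<Phi>"
    and "1 + btime b + T \<le> U"
  shows "computes eig ec (If b c d) s U \<Phi>"
  using computes_mono[OF computes_If[OF assms(1,2)] assms(3)] by blast

text \<open>The loop-free prefix is kept as the equation \<open>s' = exec c s\<close>, so that later
  goals are simplified in an explicit memory instead of under an invented postcondition.\<close>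

lemma computes_step:
  assumes "loopfree c" "\<And>s'. s' = exec c s \<Longrightarrow> computes eig ec d s' T \<Phi>" "1 + ctime c + T \<le> U"
  shows "computes eig ec (Seq c d) s U \<Phi>"
  by (rule computes_SeqI[OF computes_loopfree[OF assms(1) order_refl, where \<Phi> = "\<lambda>s'. s' = exec c s"]])
    (use assms in auto)


section \<open>Column reduction\<close>

text \<open>From here on vectors and matrices are functions on all naturals, like the arrays of the
  machine. Entries beyond the dimension are carried along but never inspected.\<close>

definition lin :: "nat \<Rightarrow> (nat \<Rightarrow> real) \<Rightarrow> (nat \<Rightarrow> real) \<Rightarrow> real" where
  "lin n a z = (\<Sum>j<n. a j * z j)"

lemma lin_upd: "c < n \<Longrightarrow> lin n a (z(c := v)) = lin n a z + a c * (v - z c)"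
proof -
  assume c: "c < n"
  have "lin n a (z(c := v)) - lin n a z = (\<Sum>j<n. if j = c then a c * (v - z c) else 0)"
    unfolding lin_def sum_subtractf[symmetric] by (rule sum.cong) (auto simp: algebra_simps)
  then show ?thesis using c by simp
qed

lemma lin_cong: "(\<And>j. j < n \<Longrightarrow> a j = b j) \<Longrightarrow> (\<And>j. j < n \<Longrightarrow> z j = w j) \<Longrightarrow> lin n a z = lin n b w"
  unfolding lin_def by (rule sum.cong) auto

lemma lin_unit: "i < n \<Longrightarrow> (\<And>j. j < n \<Longrightarrow> a j = (if i = j then 1 else 0)) \<Longrightarrow> lin n a z = z i"
proof -
  assume i: "i < n" and a: "\<And>j. j < n \<Longrightarrow> a j = (if i = j then 1 else 0)"
  have "lin n a z = (\<Sum>j<n. if j = i then z i else 0)"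
    unfolding lin_def by (rule sum.cong) (auto simp: a)
  then show ?thesis using i by simp
qed

lemma lin_unit_right: "i < n \<Longrightarrow> lin n a (\<lambda>j. if j = i then 1 else 0) = a i"
proof -
  assume i: "i < n"
  have "lin n a (\<lambda>j. if j = i then 1 else 0) = (\<Sum>j<n. if j = i then a i else 0)"
    unfolding lin_def by (rule sum.cong) auto
  then show ?thesis using i by simp
qed

text \<open>This stands for \<open>H = G T\<close> with \<open>T\<close> invertible, expressed by
  the action \<phi> of \<open>T\<close> on the variables. Surjectivity and the condition on zeros
  are what carries statements "some (nonzero) vector satisfies ..." from one side to the
  other.\<close>

definition column_equiv ::
  "nat \<Rightarrow> nat \<Rightarrow> (nat \<Rightarrow> nat \<Rightarrow> real) \<Rightarrow> (nat \<Rightarrow> nat \<Rightarrow> real) \<Rightarrow> bool" where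
  "column_equiv R n G H \<longleftrightarrow> (\<exists>\<phi>. surj \<phi> \<and>
     (\<forall>z. (\<forall>i<n. \<phi> z i = 0) \<longleftrightarrow> (\<forall>i<n. z i = 0)) \<and>
     (\<forall>z. \<forall>i<R. lin n (H i) z = lin n (G i) (\<phi> z)))"

lemma column_equivE:
  assumes "column_equiv R n G H"
  obtains \<phi> where "surj \<phi>" "\<And>z. (\<forall>i<n. \<phi> z i = 0) \<longleftrightarrow> (\<forall>i<n. z i = 0)"
    "\<And>z i. i < R \<Longrightarrow> lin n (H i) z = lin n (G i) (\<phi> z)"
proof -
  from assms obtain \<phi> where \<phi>: "surj \<phi> \<and> (\<forall>z. (\<forall>i<n. \<phi> z i = 0) \<longleftrightarrow> (\<forall>i<n. z i = 0)) \<and>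
     (\<forall>z. \<forall>i<R. lin n (H i) z = lin n (G i) (\<phi> z))"
    unfolding column_equiv_def by (elim exE)
  show thesis
    by (rule that[OF conjunct1[OF \<phi>] spec[OF conjunct1[OF conjunct2[OF \<phi>]]]
      mp[OF spec[OF spec[OF conjunct2[OF conjunct2[OF \<phi>]]]]]])
qed

lemma column_equiv_refl: "column_equiv R n G G"
  unfolding column_equiv_def by (rule exI[of _ id]) auto

lemma column_equiv_trans:
  assumes "column_equiv R n G H" "column_equiv R n H K"
  shows "column_equiv R n G K"
proof -
  obtain \<phi> where \<phi>: "surj \<phi>" "\<And>z. (\<forall>i<n. \<phi> z i = 0) \<longleftrightarrow> (\<forall>i<n. z i = 0)"
    "\<And>z i. i < R \<Longrightarrow> lin n (H i) z = lin n (G i) (\<phi> z)"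
    by (rule column_equivE[OF assms(1)]) (rule that, assumption+)
  obtain \<psi> where \<psi>: "surj \<psi>" "\<And>z. (\<forall>i<n. \<psi> z i = 0) \<longleftrightarrow> (\<forall>i<n. z i = 0)"
    "\<And>z i. i < R \<Longrightarrow> lin n (K i) z = lin n (H i) (\<psi> z)"
    by (rule column_equivE[OF assms(2)]) (rule that, assumption+)
  show ?thesis
    unfolding column_equiv_def
  proof (intro exI conjI allI impI)
    show "surj (\<phi> \<circ> \<psi>)" using \<phi>(1) \<psi>(1) by (rule comp_surj[rotated])
    show "(\<forall>i<n. (\<phi> \<circ> \<psi>) z i = 0) \<longleftrightarrow> (\<forall>i<n. z i = 0)" for z
      unfolding o_apply \<phi>(2) by (rule \<psi>(2))
    show "lin n (K i) z = lin n (G i) ((\<phi> \<circ> \<psi>) z)" if "i < R" for i z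
      unfolding o_apply \<psi>(3)[OF that] by (rule \<phi>(3)[OF that])
  qed
qed

definition add_column :: "nat \<Rightarrow> nat \<Rightarrow> nat \<Rightarrow> real \<Rightarrow> (nat \<Rightarrow> nat \<Rightarrow> real) \<Rightarrow> nat \<Rightarrow> nat \<Rightarrow> real" where
  "add_column R d c \<alpha> G = (\<lambda>i j. if i < R \<and> j = d then G i d + \<alpha> * G i c else G i j)"

text \<open>Column operations act dually on variables: if column \<open>d\<close> gains \<alpha>
  times column \<open>c\<close>, then coordinate \<open>c\<close> gains \<alpha> times coordinate
  \<open>d\<close>. For \<open>c = d\<close> this is a scaling by \<open>1 + \<alpha>\<close>, which
  must not vanish.\<close>

lemma column_equiv_add_column:
  assumes d: "d < n" and c: "c < n" and \<alpha>: "c \<noteq> d \<or> 1 + \<alpha> \<noteq> 0"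
  shows "column_equiv R n G (add_column R d c \<alpha> G)"
proof -
  define \<phi> where "\<phi> z = z(c := z c + \<alpha> * z d)" for z :: "nat \<Rightarrow> real"
  have "surj \<phi>"
  proof (rule surjI)
    fix w
    show "\<phi> (w(c := if c = d then w c / (1 + \<alpha>) else w c - \<alpha> * w d)) = w"
    proof (cases "c = d")
      case True
      then have "w d / (1 + \<alpha>) + \<alpha> * (w d / (1 + \<alpha>)) = (1 + \<alpha>) * (w d / (1 + \<alpha>))"
        by (simp only: distrib_right mult_1_left)
      also have "\<dots> = w d" using \<alpha> True by simp
      finally show ?thesis using True by (simp add: \<phi>_def fun_eq_iff)
    qed (auto simp: \<phi>_def fun_eq_iff)
  qed
  moreover have "(\<forall>i<n. \<phi> z i = 0) \<longleftrightarrow> (\<forall>i<n. z i = 0)" for z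
  proof
    assume z: "\<forall>i<n. \<phi> z i = 0"
    have "z i = 0" if "i < n" for i
    proof (cases "i = c")
      case False
      then show ?thesis using z that unfolding \<phi>_def by (metis fun_upd_apply)
    next
      case True
      have e: "z c + \<alpha> * z d = 0"
        using z c by (auto simp: \<phi>_def)
      show ?thesis
      proof (cases "c = d")
        case True
        then have "(1 + \<alpha>) * z c = 0" using e by (simp add: algebra_simps)
        then show ?thesis using \<alpha> True \<open>i = c\<close> by simp
      next
        case False
        then have "z d = 0" using z d unfolding \<phi>_def by (metis fun_upd_apply)
        then show ?thesis using e \<open>i = c\<close> by simp
      qed
    qed
    then show "\<forall>i<n. z i = 0" by blast
  qed (use c d in \<open>auto simp: \<phi>_def\<close>)
  moreover have "lin n (add_column R d c \<alpha> G i) z = lin n (G i) (\<phi> z)" if "i < R" for z i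
  proof -
    have "lin n (add_column R d c \<alpha> G i) z = lin n z ((G i)(d := G i d + \<alpha> * G i c))"
      unfolding lin_def by (rule sum.cong) (use that in \<open>auto simp: add_column_def\<close>)
    also have "\<dots> = lin n (G i) z + z d * \<alpha> * G i c"
      unfolding lin_upd[OF d] by (simp add: lin_def mult.commute)
    also have "\<dots> = lin n (G i) (\<phi> z)"
      unfolding \<phi>_def lin_upd[OF c] by simp
    finally show ?thesis .
  qed
  ultimately show ?thesis
    unfolding column_equiv_def by blast
qed

definition clear_row :: "nat \<Rightarrow> nat \<Rightarrow> nat \<Rightarrow> (nat \<Rightarrow> nat \<Rightarrow> real) \<Rightarrow> nat \<Rightarrow> nat \<Rightarrow> real" where
  "clear_row R n k G = (\<lambda>i j. if i < R \<and> j < n \<and> j \<noteq> k then G i j - G k j * G i k else G i j)"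

text \<open>All these column additions together subtract from \<open>z k\<close> the sum
  \<open>S z\<close>. Since \<open>S\<close> does not involve \<open>z k\<close>, adding it back
  inverts the map.\<close>

lemma column_equiv_clear_row:
  assumes k: "k < n"
  shows "column_equiv R n G (clear_row R n k G)"
proof -
  define S where "S z = (\<Sum>j\<in>{..<n} - {k}. G k j * z j)" for z :: "nat \<Rightarrow> real"
  define \<phi> where "\<phi> z = z(k := z k - S z)" for z :: "nat \<Rightarrow> real"
  have S: "S (z(k := v)) = S z" for z v
    unfolding S_def by (rule sum.cong) auto
  have "surj \<phi>"
    by (rule surjI[of _ "\<lambda>w. w(k := w k + S w)"]) (auto simp: \<phi>_def S fun_eq_iff)
  moreover have "(\<forall>i<n. \<phi> z i = 0) \<longleftrightarrow> (\<forall>i<n. z i = 0)" for z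
  proof
    assume z: "\<forall>i<n. \<phi> z i = 0"
    have 1: "z i = 0" if "i < n" "i \<noteq> k" for i
      using z that unfolding \<phi>_def by (metis fun_upd_apply)
    then have "S z = 0" by (simp add: S_def)
    then have "z k = 0" using z k by (auto simp: \<phi>_def)
    then show "\<forall>i<n. z i = 0" using 1 by metis
  next
    assume z: "\<forall>i<n. z i = 0"
    then have "S z = 0" by (simp add: S_def)
    then show "\<forall>i<n. \<phi> z i = 0" using z by (simp add: \<phi>_def)
  qed
  moreover have "lin n (clear_row R n k G i) z = lin n (G i) (\<phi> z)" if "i < R" for z i
  proof -
    have "lin n (clear_row R n k G i) z - lin n (G i) z
        = (\<Sum>j<n. if j = k then 0 else - (G i k * (G k j * z j)))"
      unfolding lin_def sum_subtractf[symmetric]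
      by (rule sum.cong) (use that in \<open>auto simp: clear_row_def algebra_simps\<close>)
    also have "\<dots> = - (G i k * S z)"
      unfolding S_def sum_distrib_left sum_negf[symmetric]
      by (rule sum.mono_neutral_cong_right) auto
    finally show ?thesis
      unfolding \<phi>_def lin_upd[OF k] by simp
  qed
  ultimately show ?thesis
    unfolding column_equiv_def by blast
qed

text \<open>Independence of the rows as functionals, arranged in the order in which elimination
  meets them: at row \<open>k\<close> only dependence on the rows above matters.\<close>

definition independent_rows :: "nat \<Rightarrow> nat \<Rightarrow> (nat \<Rightarrow> nat \<Rightarrow> real) \<Rightarrow> bool" where
  "independent_rows m n G \<longleftrightarrow>
     (\<forall>k<m. \<forall>a. \<exists>w. lin n (G k) w \<noteq> (\<Sum>i<k. a i * lin n (G i) w))"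

text \<open>If row \<open>k\<close> of \<open>H\<close> vanished from column \<open>k\<close> on, it
  would be the combination of the unit rows above it with its own entries as coefficients. The same
  relation would then hold between the rows of \<open>G\<close>, because \<phi> is
  surjective.\<close>

lemma pivot_exists:
  assumes eq: "column_equiv R n G H" and ind: "independent_rows m n G"
    and k: "k < m" "m \<le> R"
    and unit: "\<And>i j. i < k \<Longrightarrow> j < n \<Longrightarrow> H i j = (if i = j then 1 else 0)"
  shows "\<exists>c. k \<le> c \<and> c < n \<and> H k c \<noteq> 0"
proof (rule ccontr)
  assume "\<not> ?thesis"
  then have 0: "H k j = 0" if "k \<le> j" "j < n" for j
    using that by blast
  obtain \<phi> where \<phi>: "surj \<phi>" "\<And>z i. i < R \<Longrightarrow> lin n (H i) z = lin n (G i) (\<phi> z)"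
    by (rule column_equivE[OF eq]) (rule that, assumption+)
  obtain w where w: "lin n (G k) w \<noteq> (\<Sum>i<k. H k i * lin n (G i) w)"
    using ind k(1) unfolding independent_rows_def by blast
  obtain z where z: "w = \<phi> z"
    using \<phi>(1) by (metis surjD)
  have row: "H k j = (\<Sum>i<k. H k i * H i j)" if "j < n" for j
  proof -
    have "(\<Sum>i<k. H k i * H i j) = (\<Sum>i<k. if i = j then H k j else 0)"
      by (rule sum.cong) (use unit that in auto)
    then show ?thesis using 0[of j] that by auto
  qed
  have "lin n (H k) z = (\<Sum>j<n. (\<Sum>i<k. H k i * H i j) * z j)"
    unfolding lin_def by (rule sum.cong[OF refl]) (metis row lessThan_iff)
  also have "\<dots> = (\<Sum>i<k. H k i * lin n (H i) z)"
    unfolding lin_def sum_distrib_left sum_distrib_right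
    by (subst sum.swap) (simp add: mult.assoc)
  finally show False
    using w k by (simp add: \<phi>(2) z)
qed

text \<open>The choice of \<open>\<alpha>\<close> makes the pivot equal to 1 also for \<open>c = k\<close>, where \<open>add_column\<close> scales
  column \<open>k\<close>. Thus no column exchanges are needed.\<close>

lemma pivot_step:
  assumes eq: "column_equiv R n G H" and k: "k \<le> c" "c < n" "k < R" and piv: "H k c \<noteq> 0"
    and unit: "\<And>i j. i < k \<Longrightarrow> j < n \<Longrightarrow> H i j = (if i = j then 1 else 0)"
  defines "H' \<equiv> clear_row R n k (add_column R k c ((1 - H k k) / H k c) H)"
  shows "column_equiv R n G H'"
    and "i \<le> k \<Longrightarrow> j < n \<Longrightarrow> H' i j = (if i = j then 1 else 0)"
proof -
  let ?\<alpha> = "(1 - H k k) / H k c"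
  have "c \<noteq> k \<or> 1 + ?\<alpha> \<noteq> 0"
    using piv by (auto simp: field_simps)
  then have "column_equiv R n H (add_column R k c ?\<alpha> H)"
    using column_equiv_add_column[of k n c ?\<alpha>] k by simp
  moreover have "column_equiv R n (add_column R k c ?\<alpha> H) H'"
    unfolding H'_def using column_equiv_clear_row k by simp
  ultimately show "column_equiv R n G H'"
    using eq column_equiv_trans by blast
  show "H' i j = (if i = j then 1 else 0)" if "i \<le> k" "j < n"
    using that k piv unit unfolding H'_def clear_row_def add_column_def
    by (cases "i = k") (auto simp: unit)
qed

text \<open>The lower block starts as the identity and undergoes the same operations, so it ends as
  \<open>T\<close>, while the upper block ends as \<open>G T = 1\<close>. Column \<open>r\<close> of
  the lower block is the image under \<phi> of the unit vector and hence solves the system with that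
  unit vector as right-hand side.\<close>

lemma column_equiv_inverse:
  assumes eq: "column_equiv (m + n) n G H"
    and id: "\<And>i j. i < n \<Longrightarrow> j < n \<Longrightarrow> G (m + i) j = (if i = j then 1 else 0)"
    and unit: "\<And>i j. i < m \<Longrightarrow> j < n \<Longrightarrow> H i j = (if i = j then 1 else 0)"
    and r: "r < n"
  shows "i < m \<Longrightarrow> lin n (G i) (\<lambda>j. H (m + j) r) = (if i = r then 1 else 0)"
proof -
  obtain \<phi> where \<phi>: "\<And>z i. i < m + n \<Longrightarrow> lin n (H i) z = lin n (G i) (\<phi> z)"
    by (rule column_equivE[OF eq]) (rule that, assumption+)
  let ?e = "\<lambda>j. if j = r then 1 else 0 :: real"
  have e: "\<phi> ?e j = H (m + j) r" if "j < n" for j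
    using \<phi>[of "m + j" ?e] that lin_unit[OF that, of "G (m + j)"] id[OF that]
    by (simp add: lin_unit_right[OF r])
  assume i: "i < m"
  have "lin n (G i) (\<lambda>j. H (m + j) r) = lin n (G i) (\<phi> ?e)"
    by (rule lin_cong) (use e in auto)
  also have "\<dots> = H i r"
    using \<phi>[of i ?e] i by (simp add: lin_unit_right[OF r])
  finally show "lin n (G i) (\<lambda>j. H (m + j) r) = (if i = r then 1 else 0)"
    using unit i r by simp
qed

section \<open>Nonsingular symmetric matrices\<close>

definition nonsingular :: "nat \<Rightarrow> (nat \<Rightarrow> nat \<Rightarrow> real) \<Rightarrow> bool" where
  "nonsingular n K \<longleftrightarrow> (\<forall>u. (\<forall>i<n. lin n (K i) u = 0) \<longrightarrow> (\<forall>i<n. u i = 0))"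

text \<open>The coefficients of a relation between the rows form, by symmetry, a vector in the
  kernel whose entry at \<open>k\<close> is 1.\<close>

lemma nonsingular_independent:
  assumes K: "nonsingular n K" and sym: "\<And>i j. i < n \<Longrightarrow> j < n \<Longrightarrow> K i j = K j i"
  shows "independent_rows n n K"
  unfolding independent_rows_def
proof (intro allI impI, rule ccontr)
  fix k a
  assume k: "k < n" and "\<nexists>w. lin n (K k) w \<noteq> (\<Sum>i<k. a i * lin n (K i) w)"
  then have eq: "lin n (K k) w = (\<Sum>i<k. a i * lin n (K i) w)" for w
    by blast
  define u where "u i = (if i < k then - a i else if i = k then 1 else 0)" for i
  have "lin n (K j) u = 0" if j: "j < n" for j
  proof -
    have split: "{..<n} = {..<k} \<union> {k} \<union> {Suc k..<n}"
      using k by auto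
    have "lin n (K j) u = (\<Sum>i<k. K j i * - a i) + K j k"
      unfolding lin_def split
      by (subst sum.union_disjoint, simp, simp, force)+ (simp add: u_def)
    also have "(\<Sum>i<k. K j i * - a i) = - (\<Sum>i<k. a i * K i j)"
      unfolding sum_negf[symmetric] by (rule sum.cong) (use k j sym in auto)
    also have "(\<Sum>i<k. a i * K i j) = K k j"
      using eq[of "\<lambda>i. if i = j then 1 else 0"] by (simp add: lin_unit_right[OF j])
    finally show ?thesis using sym[OF k j] by simp
  qed
  then have "u k = 0"
    using K k unfolding nonsingular_def by blast
  then show False by (simp add: u_def)
qed


section \<open>Quadratic forms on cones\<close>

definition qform :: "nat \<Rightarrow> (nat \<Rightarrow> nat \<Rightarrow> real) \<Rightarrow> (nat \<Rightarrow> real) \<Rightarrow> real" where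
  "qform n P x = (\<Sum>i<n. \<Sum>j<n. x i * P i j * x j)"

text \<open>The cone has its first \<open>r\<close> coordinates nonnegative and the others free.
  \<open>takes_neg\<close> is the counterpart of (T3), the failure of \<open>takes_nonpos\<close>
  that of (T1), and (T2) is what remains.\<close>

definition takes_neg :: "nat \<Rightarrow> nat \<Rightarrow> (nat \<Rightarrow> nat \<Rightarrow> real) \<Rightarrow> bool" where
  "takes_neg r n P \<longleftrightarrow> (\<exists>x. (\<forall>i<r. 0 \<le> x i) \<and> qform n P x < 0)"

definition takes_nonpos :: "nat \<Rightarrow> nat \<Rightarrow> (nat \<Rightarrow> nat \<Rightarrow> real) \<Rightarrow> bool" where
  "takes_nonpos r n P \<longleftrightarrow> (\<exists>x. (\<forall>i<r. 0 \<le> x i) \<and> (\<exists>i<n. x i \<noteq> 0) \<and> qform n P x \<le> 0)"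

definition symmetric :: "nat \<Rightarrow> (nat \<Rightarrow> nat \<Rightarrow> real) \<Rightarrow> bool" where
  "symmetric n P \<longleftrightarrow> (\<forall>i<n. \<forall>j<n. P i j = P j i)"

lemma symmetricD: "symmetric n P \<Longrightarrow> i < n \<Longrightarrow> j < n \<Longrightarrow> P i j = P j i"
  unfolding symmetric_def by blast

lemma qform_cong:
  "(\<And>i j. i < n \<Longrightarrow> j < n \<Longrightarrow> P i j = P' i j) \<Longrightarrow> (\<And>i. i < n \<Longrightarrow> x i = y i) \<Longrightarrow>
    qform n P x = qform n P' y"
  unfolding qform_def by (intro sum.cong) auto

lemma takes_neg_imp_nonpos: "takes_neg r n P \<Longrightarrow> takes_nonpos r n P"
proof -
  assume "takes_neg r n P"
  then obtain x where x: "\<forall>i<r. 0 \<le> x i" "qform n P x < 0"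
    unfolding takes_neg_def by blast
  have "\<exists>i<n. x i \<noteq> 0"
  proof (rule ccontr)
    assume "\<not> ?thesis"
    then have "qform n P x = 0" by (simp add: qform_def)
    then show False using x by simp
  qed
  then show ?thesis using x less_imp_le unfolding takes_nonpos_def by blast
qed

section \<open>Eliminating the last coordinate while it is free\<close>

lemma qform_Suc:
  assumes "symmetric (Suc k) P"
  shows "qform (Suc k) P x = qform k P x + 2 * x k * lin k (P k) x + P k k * (x k)\<^sup>2"
proof -
  have s: "P i k = P k i" if "i < k" for i
    using symmetricD[OF assms, of i k] that by simp
  have "(\<Sum>i<k. x i * P i k * x k) = x k * lin k (P k) x"
    unfolding lin_def sum_distrib_left
    by (rule sum.cong) (simp_all add: s)
  moreover have "(\<Sum>j<k. x k * P k j * x j) = x k * lin k (P k) x"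
    unfolding lin_def sum_distrib_left by (rule sum.cong) auto
  ultimately show ?thesis
    by (simp add: qform_def sum.distrib power2_eq_square algebra_simps)
qed

lemma takes_neg_negative_diagonal:
  assumes "symmetric (Suc k) P" "r \<le> k" "P k k < 0"
  shows "takes_neg r (Suc k) P"
  unfolding takes_neg_def
proof (intro exI conjI)
  let ?x = "\<lambda>i. if i = k then 1 else 0 :: real"
  show "\<forall>i<r. 0 \<le> ?x i" by simp
  have "qform k P ?x = 0" "lin k (P k) ?x = 0"
    by (auto simp: qform_def lin_def)
  then show "qform (Suc k) P ?x < 0"
    using assms(3) by (simp add: qform_Suc[OF assms(1)])
qed

lemma takes_neg_zero_diagonal:
  assumes sym: "symmetric (Suc k) P" and "r \<le> k" "P k k = 0" and j: "j < k" "P k j \<noteq> 0"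
  shows "takes_neg r (Suc k) P"
  unfolding takes_neg_def
proof (intro exI conjI)
  \<comment> \<open>With \<open>x j = 1\<close> and \<open>x k = t\<close> the value is
    \<open>P j j + 2 * t * P k j\<close>; this \<open>t\<close> makes it -1. The value 1 at
    \<open>j\<close> is admissible even if coordinate \<open>j\<close> is constrained, and
    \<open>t\<close> may have any sign because \<open>k\<close> is free.\<close>
  let ?x = "\<lambda>i. if i = k then - (P j j + 1) / (2 * P k j) else if i = j then 1 else 0 :: real"
  show "\<forall>i<r. 0 \<le> ?x i" using assms by simp
  have "lin k (P k) ?x = lin k (P k) (\<lambda>i. if i = j then 1 else 0)"
    by (rule lin_cong) auto
  then have 1: "lin k (P k) ?x = P k j"
    using lin_unit_right[OF j(1)] by simp
  have "qform k P ?x = (\<Sum>i<k. if i = j then lin k (P j) ?x else 0)"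
    unfolding qform_def lin_def by (rule sum.cong) (auto intro: sum.cong)
  also have "\<dots> = lin k (P j) ?x" using j by simp
  also have "\<dots> = lin k (P j) (\<lambda>i. if i = j then 1 else 0)"
    by (rule lin_cong) auto
  finally have "qform k P ?x = P j j"
    using lin_unit_right[OF j(1)] by simp
  then have "qform (Suc k) P ?x = - 1"
    using j assms(3) by (simp add: qform_Suc[OF sym] 1 field_simps)
  then show "qform (Suc k) P ?x < 0" by simp
qed

text \<open>The form ignores coordinate \<open>k\<close>, so its negative values are unaffected, and
  the unit vector at \<open>k\<close> is a nonzero point with value 0.\<close>

lemma zero_row:
  assumes sym: "symmetric (Suc k) P" and "r \<le> k" "P k k = 0" and 0: "\<And>j. j < k \<Longrightarrow> P k j = 0"
  shows "takes_neg r (Suc k) P \<longleftrightarrow> takes_neg r k P" and "takes_nonpos r (Suc k) P"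
proof -
  have "lin k (P k) x = 0" for x
    using 0 by (simp add: lin_def)
  then have eq: "qform (Suc k) P x = qform k P x" for x
    using qform_Suc[OF sym] assms(3) by simp
  then show "takes_neg r (Suc k) P \<longleftrightarrow> takes_neg r k P"
    by (simp add: takes_neg_def)
  show "takes_nonpos r (Suc k) P"
    unfolding takes_nonpos_def
    by (rule exI[of _ "\<lambda>i. if i = k then 1 else 0"])
      (use assms(2,3) in \<open>auto simp: qform_def\<close>)
qed

text \<open>Entries outside the leading block are kept, which is exactly what the program leaves in
  its array.\<close>

definition schur :: "nat \<Rightarrow> (nat \<Rightarrow> nat \<Rightarrow> real) \<Rightarrow> nat \<Rightarrow> nat \<Rightarrow> real" where
  "schur k P = (\<lambda>i j. if i < k \<and> j < k then P i j - P i k * P k j / P k k else P i j)"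

lemma schur_symmetric:
  assumes "symmetric (Suc k) P"
  shows "symmetric k (schur k P)"
  unfolding symmetric_def
proof (intro allI impI)
  fix i j assume "i < k" "j < k"
  then show "schur k P i j = schur k P j i"
    using symmetricD[OF assms, of i j] symmetricD[OF assms, of i k] symmetricD[OF assms, of j k]
    by (simp add: schur_def)
qed

text \<open>Completing the square in \<open>x k\<close>.\<close>

lemma qform_schur:
  assumes sym: "symmetric (Suc k) P" and d: "P k k > 0"
  shows "qform (Suc k) P x = qform k (schur k P) x + P k k * (x k + lin k (P k) x / P k k)\<^sup>2"
proof -
  have s: "P i k = P k i" if "i < k" for i
    using symmetricD[OF sym, of i k] that by simp
  have "qform k P x - qform k (schur k P) x = (\<Sum>i<k. \<Sum>j<k. (P k i * x i) * (P k j * x j)) / P k k"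
    unfolding qform_def sum_subtractf[symmetric] sum_divide_distrib
    by (intro sum.cong) (simp_all add: schur_def s algebra_simps)
  also have "(\<Sum>i<k. \<Sum>j<k. (P k i * x i) * (P k j * x j)) = (lin k (P k) x)\<^sup>2"
    by (simp add: lin_def sum_product power2_eq_square)
  finally show ?thesis
    using d by (simp add: qform_Suc[OF sym] power2_eq_square field_simps)
qed

text \<open>The free coordinate can be chosen, as in \<open>y\<close>, so that the square vanishes;
  the Schur complement is the minimum over it. Nonzeroness survives dropping \<open>x k\<close>,
  because a nonzero vector supported at \<open>k\<close> alone has a positive value.\<close>

lemma takes_schur:
  assumes sym: "symmetric (Suc k) P" and r: "r \<le> k" and d: "P k k > 0"
  shows "takes_neg r (Suc k) P \<longleftrightarrow> takes_neg r k (schur k P)"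
    and "takes_nonpos r (Suc k) P \<longleftrightarrow> takes_nonpos r k (schur k P)"
proof -
  define y where "y x = x(k := - (lin k (P k) x / P k k))" for x :: "nat \<Rightarrow> real"
  have le: "qform k (schur k P) x \<le> qform (Suc k) P x" for x
    using d by (simp add: qform_schur[OF sym d])
  have ylin: "lin k (P k) (y x) = lin k (P k) x" for x
    by (rule lin_cong) (auto simp: y_def)
  have yq: "qform k (schur k P) (y x) = qform k (schur k P) x" for x
    by (rule qform_cong) (auto simp: y_def)
  have y: "qform (Suc k) P (y x) = qform k (schur k P) x" for x
    unfolding qform_schur[OF sym d] ylin yq by (simp add: y_def)
  have ynn: "\<forall>i<r. 0 \<le> y x i" if "\<forall>i<r. 0 \<le> x i" for x
    using that r by (auto simp: y_def)
  show "takes_neg r (Suc k) P \<longleftrightarrow> takes_neg r k (schur k P)"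
    unfolding takes_neg_def using le y ynn by (metis le_less_trans)
  show "takes_nonpos r (Suc k) P \<longleftrightarrow> takes_nonpos r k (schur k P)"
  proof
    assume "takes_nonpos r (Suc k) P"
    then obtain x where x: "\<forall>i<r. 0 \<le> x i" "\<exists>i<Suc k. x i \<noteq> 0" "qform (Suc k) P x \<le> 0"
      unfolding takes_nonpos_def by blast
    have "\<exists>i<k. x i \<noteq> 0"
    proof (rule ccontr)
      assume "\<not> ?thesis"
      then have 0: "\<forall>i<k. x i = 0" by blast
      then have "x k \<noteq> 0" using x(2) less_Suc_eq by auto
      moreover have "qform (Suc k) P x = P k k * (x k)\<^sup>2"
        using 0 by (simp add: qform_Suc[OF sym] qform_def lin_def power2_eq_square)
      ultimately have "qform (Suc k) P x > 0" using d by simp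
      then show False using x by simp
    qed
    then show "takes_nonpos r k (schur k P)"
      using x le order_trans unfolding takes_nonpos_def by blast
  next
    assume "takes_nonpos r k (schur k P)"
    then obtain x where x: "\<forall>i<r. 0 \<le> x i" "\<exists>i<k. x i \<noteq> 0" "qform k (schur k P) x \<le> 0"
      unfolding takes_nonpos_def by blast
    obtain i where "i < k" "x i \<noteq> 0" using x(2) by blast
    then have "y x i \<noteq> 0" "i < Suc k" by (auto simp: y_def)
    then show "takes_nonpos r (Suc k) P"
      using x y ynn unfolding takes_nonpos_def by metis
  qed
qed

text \<open>Write \<eta> as \<open>T z\<close>, where \<open>T\<close> is the lower block of
  \<open>H\<close>. The upper block says that the constraints on \<eta> read \<open>z i = 0\<close>
  for the first \<open>q\<close> coordinates and \<open>z i \<ge> 0\<close> for the next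
  \<open>r\<close>. Deleting the first \<open>q\<close> coordinates leaves the form with matrix
  \<open>P\<close>, the corresponding block of the congruence of \<open>Q\<close> by
  \<open>T\<close>.\<close>

lemma qform_column_reduction:
  assumes eq: "column_equiv (m + p) p G H" and m: "m = q + r" "m \<le> p"
    and id: "\<And>i j. i < p \<Longrightarrow> j < p \<Longrightarrow> G (m + i) j = (if i = j then 1 else 0)"
    and unit: "\<And>i j. i < m \<Longrightarrow> j < p \<Longrightarrow> H i j = (if i = j then 1 else 0)"
    and P: "\<And>i j. i < p - q \<Longrightarrow> j < p - q \<Longrightarrow>
      P i j = (\<Sum>a<p. H (m + a) (q + i) * (\<Sum>b<p. Q a b * H (m + b) (q + j)))"
  defines "S \<equiv> {\<eta>. (\<forall>i<q. lin p (G i) \<eta> = 0) \<and> (\<forall>i<r. 0 \<le> lin p (G (q + i)) \<eta>)}"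
  shows "takes_neg r (p - q) P \<longleftrightarrow> (\<exists>\<eta>\<in>S. qform p Q \<eta> < 0)"
    and "takes_nonpos r (p - q) P \<longleftrightarrow> (\<exists>\<eta>\<in>S. (\<exists>i<p. \<eta> i \<noteq> 0) \<and> qform p Q \<eta> \<le> 0)"
proof -
  obtain \<phi> where \<phi>: "surj \<phi>" "\<And>z. (\<forall>i<p. \<phi> z i = 0) \<longleftrightarrow> (\<forall>i<p. z i = 0)"
    "\<And>z i. i < m + p \<Longrightarrow> lin p (H i) z = lin p (G i) (\<phi> z)"
    by (rule column_equivE[OF eq]) (rule that, assumption+)
  have row: "lin p (G i) (\<phi> z) = z i" if "i < m" for i z
    using \<phi>(3)[of i z] that m lin_unit[of i p "H i"] unit[of i] by simp
  have S: "\<phi> z \<in> S \<longleftrightarrow> (\<forall>i<q. z i = 0) \<and> (\<forall>i<r. 0 \<le> z (q + i))" for z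
    by (auto simp: S_def row m)
  have val: "qform p Q (\<phi> z) = qform (p - q) P (\<lambda>j. z (q + j))" if z: "\<forall>i<q. z i = 0" for z
  proof -
    let ?T = "\<lambda>a i. H (m + a) (q + i)" and ?x = "\<lambda>j. z (q + j)" and ?n = "p - q"
    have \<eta>: "\<phi> z a = (\<Sum>i<?n. ?T a i * ?x i)" if a: "a < p" for a
    proof -
      have "\<phi> z a = lin p (H (m + a)) z"
        using \<phi>(3)[of "m + a" z] a lin_unit[OF a, of "G (m + a)"] id[OF a] by simp
      also have "\<dots> = (\<Sum>j\<in>{q..<p}. H (m + a) j * z j)"
        unfolding lin_def by (rule sum.mono_neutral_right) (use z in auto)
      also have "\<dots> = (\<Sum>i<?n. ?T a i * ?x i)"
        by (rule sum.reindex_bij_witness[of _ "\<lambda>i. q + i" "\<lambda>j. j - q"]) auto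
      finally show ?thesis .
    qed
    have "qform p Q (\<phi> z) = (\<Sum>a<p. \<Sum>b<p. \<Sum>i<?n. \<Sum>j<?n.
        ?x i * (?T a i * (Q a b * ?T b j)) * ?x j)"
      unfolding qform_def
    proof (intro sum.cong refl)
      fix a b assume "a \<in> {..<p}" "b \<in> {..<p}"
      then have "\<phi> z a * Q a b * \<phi> z b = (\<Sum>i<?n. ?T a i * ?x i) * Q a b * (\<Sum>j<?n. ?T b j * ?x j)"
        using \<eta> by simp
      also have "\<dots> = (\<Sum>i<?n. \<Sum>j<?n. ?x i * (?T a i * (Q a b * ?T b j)) * ?x j)"
        unfolding sum_distrib_left sum_distrib_right
        by (subst sum.swap) (auto intro!: sum.cong)
      finally show "\<phi> z a * Q a b * \<phi> z b = (\<Sum>i<?n. \<Sum>j<?n. ?x i * (?T a i * (Q a b * ?T b j)) * ?x j)" .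
    qed
    also have "\<dots> = (\<Sum>i<?n. \<Sum>j<?n. \<Sum>a<p. \<Sum>b<p. ?x i * (?T a i * (Q a b * ?T b j)) * ?x j)"
    proof -
      let ?f = "\<lambda>a b i j. ?x i * (?T a i * (Q a b * ?T b j)) * ?x j"
      have "(\<Sum>a<p. \<Sum>b<p. \<Sum>i<?n. \<Sum>j<?n. ?f a b i j) = (\<Sum>a<p. \<Sum>i<?n. \<Sum>b<p. \<Sum>j<?n. ?f a b i j)"
        by (intro sum.cong refl sum.swap)
      also have "\<dots> = (\<Sum>i<?n. \<Sum>a<p. \<Sum>b<p. \<Sum>j<?n. ?f a b i j)"
        by (rule sum.swap)
      also have "\<dots> = (\<Sum>i<?n. \<Sum>a<p. \<Sum>j<?n. \<Sum>b<p. ?f a b i j)"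
        by (intro sum.cong refl sum.swap)
      also have "\<dots> = (\<Sum>i<?n. \<Sum>j<?n. \<Sum>a<p. \<Sum>b<p. ?f a b i j)"
        by (intro sum.cong refl sum.swap)
      finally show ?thesis .
    qed
    also have "\<dots> = qform ?n P ?x"
      unfolding qform_def using P
      by (intro sum.cong refl) (simp add: sum_distrib_left sum_distrib_right)
    finally show ?thesis .
  qed
  \<comment> \<open>Vectors of the reduced problem are the same as vectors \<open>z\<close> that
    vanish below \<open>q\<close>, shifted by \<open>q\<close>.\<close>
  have lift: "(\<exists>x. A x) \<longleftrightarrow> (\<exists>z. (\<forall>i<q. z i = 0) \<and> A (\<lambda>j. z (q + j)))" for A :: "(nat \<Rightarrow> real) \<Rightarrow> bool"
  proof
    assume "\<exists>x. A x"
    then obtain x where "A x" by blast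
    then show "\<exists>z. (\<forall>i<q. z i = 0) \<and> A (\<lambda>j. z (q + j))"
      by (intro exI[of _ "\<lambda>j. if j < q then 0 else x (j - q)"]) simp
  qed blast
  have nz: "(\<exists>i<p. \<phi> z i \<noteq> 0) \<longleftrightarrow> (\<exists>j<p - q. z (q + j) \<noteq> 0)" if "\<forall>i<q. z i = 0" for z
  proof -
    have "(\<exists>i<p. z i \<noteq> 0) \<longleftrightarrow> (\<exists>j<p - q. z (q + j) \<noteq> 0)"
    proof
      assume "\<exists>i<p. z i \<noteq> 0"
      then obtain i where "i < p" "z i \<noteq> 0" by blast
      then show "\<exists>j<p - q. z (q + j) \<noteq> 0"
        using that by (intro exI[of _ "i - q"]) (metis add_diff_inverse_nat diff_less_mono not_less)
    next
      assume "\<exists>j<p - q. z (q + j) \<noteq> 0"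
      then show "\<exists>i<p. z i \<noteq> 0"
        by (metis add.commute less_diff_conv)
    qed
    then show ?thesis using \<phi>(2)[of z] by blast
  qed
  have ex: "(\<exists>\<eta>\<in>S. A \<eta>) \<longleftrightarrow> (\<exists>z. (\<forall>i<q. z i = 0) \<and> (\<forall>i<r. 0 \<le> z (q + i)) \<and> A (\<phi> z))" for A
  proof
    assume "\<exists>\<eta>\<in>S. A \<eta>"
    then obtain z where "\<phi> z \<in> S" "A (\<phi> z)" using \<phi>(1) by (metis surjD)
    then show "\<exists>z. (\<forall>i<q. z i = 0) \<and> (\<forall>i<r. 0 \<le> z (q + i)) \<and> A (\<phi> z)" using S by blast
  next
    assume "\<exists>z. (\<forall>i<q. z i = 0) \<and> (\<forall>i<r. 0 \<le> z (q + i)) \<and> A (\<phi> z)"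
    then show "\<exists>\<eta>\<in>S. A \<eta>" using S by blast
  qed
  show "takes_neg r (p - q) P \<longleftrightarrow> (\<exists>\<eta>\<in>S. qform p Q \<eta> < 0)"
    unfolding ex takes_neg_def lift[of "\<lambda>x. (\<forall>i<r. 0 \<le> x i) \<and> qform (p - q) P x < 0"]
    by (rule ex_cong1, rule conj_cong, rule refl, simp only: val)
  show "takes_nonpos r (p - q) P \<longleftrightarrow> (\<exists>\<eta>\<in>S. (\<exists>i<p. \<eta> i \<noteq> 0) \<and> qform p Q \<eta> \<le> 0)"
    unfolding ex takes_nonpos_def
      lift[of "\<lambda>x. (\<forall>i<r. 0 \<le> x i) \<and> (\<exists>i<p - q. x i \<noteq> 0) \<and> qform (p - q) P x \<le> 0"]
    by (rule ex_cong1, rule conj_cong, rule refl, simp only: val nz)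
qed


section \<open>Minimisers of a quadratic form on the simplex\<close>

definition simplex :: "nat \<Rightarrow> (nat \<Rightarrow> real) set" where
  "simplex r = {x. (\<forall>i<r. 0 \<le> x i) \<and> sum x {..<r} = 1}"

lemma continuous_qform: "continuous_on UNIV (qform n P)"
  unfolding qform_def
  by (intro continuous_intros continuous_on_product_coordinates)

lemma simplex_minimiser:
  assumes r: "r > 0"
  shows "\<exists>y\<in>simplex r. \<forall>x\<in>simplex r. qform r P y \<le> qform r P x"
proof -
  define S where "S = (\<lambda>i. if i < r then {0..1} else {0 :: real})"
  define K where "K = PiE UNIV S \<inter> {x. sum x {..<r} = 1}"
  have "compactin (product_topology (\<lambda>i. euclidean) UNIV) (PiE UNIV S)"
    unfolding compactin_PiE by (auto simp: S_def)
  then have "compact (PiE UNIV S)"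
    by (simp add: euclidean_product_topology)
  moreover have "closed {x :: nat \<Rightarrow> real. sum x {..<r} = 1}"
    by (intro closed_Collect_eq continuous_intros continuous_on_product_coordinates)
  ultimately have K: "compact K"
    unfolding K_def by (rule compact_Int_closed)
  have "(\<lambda>i. if i = 0 then 1 else 0) \<in> K"
    using r by (auto simp: K_def S_def)
  then have "K \<noteq> {}" by blast
  then obtain y where y: "y \<in> K" "\<And>x. x \<in> K \<Longrightarrow> qform r P y \<le> qform r P x"
    using continuous_attains_inf[OF K _ continuous_on_subset[OF continuous_qform]] by blast
  have "y \<in> simplex r"
    using y(1) by (auto simp: K_def S_def simplex_def PiE_def Pi_def split: if_splits)
  moreover have "qform r P y \<le> qform r P x" if x: "x \<in> simplex r" for x
  proof -
    let ?x = "\<lambda>i. if i < r then x i else 0"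
    have "x i \<le> 1" if "i < r" for i
      using member_le_sum[of i "{..<r}" x] that x by (auto simp: simplex_def)
    moreover have "sum ?x {..<r} = sum x {..<r}"
      by (rule sum.cong) auto
    ultimately have "?x \<in> K"
      using x by (auto simp: K_def S_def simplex_def)
    then have "qform r P y \<le> qform r P ?x" by (rule y(2))
    also have "\<dots> = qform r P x" by (rule qform_cong) auto
    finally show ?thesis .
  qed
  ultimately show ?thesis by blast
qed

lemma qform_line:
  assumes "symmetric r P"
  shows "qform r P (\<lambda>i. y i + t * d i) =
    qform r P y + 2 * t * (\<Sum>i<r. d i * lin r (P i) y) + t\<^sup>2 * qform r P d"
proof -
  have "(\<Sum>i<r. \<Sum>j<r. y i * P i j * d j) = (\<Sum>j<r. \<Sum>i<r. y i * P i j * d j)"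
    by (rule sum.swap)
  also have "\<dots> = (\<Sum>j<r. \<Sum>i<r. d j * (P j i * y i))"
  proof (intro sum.cong refl)
    fix j i assume "j \<in> {..<r}" "i \<in> {..<r}"
    then show "y i * P i j * d j = d j * (P j i * y i)"
      using symmetricD[OF assms, of i j] by simp
  qed
  finally have "(\<Sum>i<r. \<Sum>j<r. y i * P i j * d j) = (\<Sum>i<r. d i * lin r (P i) y)"
    by (simp add: lin_def sum_distrib_left)
  moreover have "(\<Sum>i<r. \<Sum>j<r. d i * P i j * y j) = (\<Sum>i<r. d i * lin r (P i) y)"
    by (simp add: lin_def sum_distrib_left mult.assoc)
  moreover have "qform r P (\<lambda>i. y i + t * d i) = qform r P y
      + t * (\<Sum>i<r. \<Sum>j<r. y i * P i j * d j) + t * (\<Sum>i<r. \<Sum>j<r. d i * P i j * y j)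
      + t\<^sup>2 * qform r P d"
    unfolding qform_def sum_distrib_left sum.distrib[symmetric]
    by (intro sum.cong refl) (simp add: algebra_simps power2_eq_square)
  ultimately show ?thesis by simp
qed

text \<open>Near 0 the linear term dominates. The step \<open>u\<close> satisfies
  \<open>u * (\<bar>D\<bar> + 1) \<le> \<bar>L\<bar>\<close>, so moving by \<open>u\<close> against
  the sign of \<open>L\<close> would give a negative value.\<close>

lemma quadratic_min_at_0:
  fixes L D :: real
  assumes \<epsilon>: "\<epsilon> > 0" and min: "\<And>t. \<bar>t\<bar> \<le> \<epsilon> \<Longrightarrow> 0 \<le> 2 * t * L + t\<^sup>2 * D"
  shows "L = 0"
proof (rule ccontr)
  assume L: "L \<noteq> 0"
  define u where "u = min \<epsilon> (\<bar>L\<bar> / (\<bar>D\<bar> + 1))"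
  have u: "u > 0" "u \<le> \<epsilon>"
    using \<epsilon> L by (auto simp: u_def)
  have "u * (\<bar>D\<bar> + 1) \<le> \<bar>L\<bar>"
    by (subst pos_le_divide_eq[symmetric]) (auto simp: u_def)
  then have "u * \<bar>D\<bar> + u \<le> \<bar>L\<bar>"
    by (simp add: distrib_left)
  moreover have "u * D \<le> u * \<bar>D\<bar>"
    by (rule mult_left_mono) (use u in auto)
  ultimately have "u * D < 2 * \<bar>L\<bar>"
    using u L by linarith
  then have "u * (u * D) < u * (2 * \<bar>L\<bar>)"
    using u by simp
  moreover have "0 \<le> 2 * (- sgn L * u) * L + (- sgn L * u)\<^sup>2 * D"
    by (rule min) (use u L in \<open>simp add: abs_mult abs_sgn_eq\<close>)
  then have "0 \<le> - (2 * u * \<bar>L\<bar>) + u * (u * D)"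
    using L by (auto simp: sgn_if power2_eq_square split: if_splits)
  ultimately show False by simp
qed

text \<open>A direction \<open>d\<close> with sum 0 that is supported in the support of
  \<open>y\<close> can be followed both ways for a short while, so the linear coefficient of the
  form along it vanishes.\<close>

lemma simplex_first_order:
  assumes sym: "symmetric r P" and y: "y \<in> simplex r"
    and min: "\<And>x. x \<in> simplex r \<Longrightarrow> qform r P y \<le> qform r P x"
    and d: "sum d {..<r} = 0" "\<And>i. i < r \<Longrightarrow> y i = 0 \<Longrightarrow> d i = 0"
  shows "(\<Sum>i<r. d i * lin r (P i) y) = 0"
proof -
  \<comment> \<open>The ratios bound how far each coordinate may move without becoming negative; the
    element 1 keeps the set nonempty if \<open>d\<close> is zero on the simplex coordinates.\<close>
  define E where "E = insert 1 ((\<lambda>i. y i / \<bar>d i\<bar>) ` {i. i < r \<and> d i \<noteq> 0})"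
  have E: "finite E" "E \<noteq> {}"
    by (auto simp: E_def)
  have pos: "y i > 0" if "i < r" "d i \<noteq> 0" for i
    using y d(2)[OF that(1)] that by (auto simp: simplex_def order_less_le)
  have "Min E > 0"
    using pos by (subst Min_gr_iff[OF E]) (auto simp: E_def)
  moreover have "0 \<le> 2 * t * (\<Sum>i<r. d i * lin r (P i) y) + t\<^sup>2 * qform r P d"
    if t: "\<bar>t\<bar> \<le> Min E" for t
  proof -
    have "0 \<le> y i + t * d i" if i: "i < r" for i
    proof (cases "d i = 0")
      case True
      then show ?thesis using y i by (simp add: simplex_def)
    next
      case False
      then have "Min E \<le> y i / \<bar>d i\<bar>"
        using E i by (intro Min_le) (auto simp: E_def)
      then have "\<bar>t\<bar> * \<bar>d i\<bar> \<le> y i"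
        using t False pos_le_divide_eq[of "\<bar>d i\<bar>" "\<bar>t\<bar>" "y i"] by simp
      then show ?thesis
        by (simp add: abs_mult[symmetric])
    qed
    then have "(\<lambda>i. y i + t * d i) \<in> simplex r"
      using y d by (simp add: simplex_def sum.distrib sum_distrib_left[symmetric])
    from min[OF this] show ?thesis
      unfolding qform_line[OF sym] by simp
  qed
  ultimately show ?thesis
    by (rule quadratic_min_at_0)
qed

text \<open>The KKT matrix of the face \<open>I\<close>, with the rows and columns of the other indices replaced by
  those of the identity; the last index belongs to the multiplier.\<close>

definition kkt :: "nat \<Rightarrow> (nat \<Rightarrow> nat \<Rightarrow> real) \<Rightarrow> nat set \<Rightarrow> nat \<Rightarrow> nat \<Rightarrow> real" where
  "kkt r P I i j =
     (if i < r \<and> j < r then (if i \<in> I \<and> j \<in> I then P i j else if i = j then 1 else 0)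
      else if i < r then (if i \<in> I then 1 else 0)
      else if j < r then (if j \<in> I then 1 else 0)
      else 0)"

lemma kkt_sym:
  assumes "symmetric r P"
  shows "kkt r P I i j = kkt r P I j i"
  using symmetricD[OF assms, of i j] by (auto simp: kkt_def)

lemma lin_Suc: "lin (Suc n) a u = lin n a u + a n * u n"
  by (simp add: lin_def)

lemma lin_kkt_in:
  assumes "I \<subseteq> {..<r}" "i \<in> I"
  shows "lin (Suc r) (kkt r P I i) u = (\<Sum>j\<in>I. P i j * u j) + u r"
proof -
  have i: "i < r" using assms by auto
  have "lin r (kkt r P I i) u = (\<Sum>j\<in>I. P i j * u j)"
    unfolding lin_def
    by (rule sum.mono_neutral_cong_right) (use assms i in \<open>auto simp: kkt_def\<close>)
  then show ?thesis using assms i by (simp add: lin_Suc kkt_def)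
qed

lemma lin_kkt_out:
  assumes "i < r" "i \<notin> I"
  shows "lin (Suc r) (kkt r P I i) u = u i"
proof -
  have "lin r (kkt r P I i) u = u i"
    by (rule lin_unit) (use assms in \<open>auto simp: kkt_def\<close>)
  then show ?thesis using assms by (simp add: lin_Suc kkt_def)
qed

lemma lin_kkt_last:
  assumes "I \<subseteq> {..<r}"
  shows "lin (Suc r) (kkt r P I r) u = sum u I"
proof -
  have "lin r (kkt r P I r) u = sum u I"
    unfolding lin_def
    by (rule sum.mono_neutral_cong_right) (use assms in \<open>auto simp: kkt_def\<close>)
  then show ?thesis by (simp add: lin_Suc kkt_def)
qed

text \<open>If the KKT matrix of its support were singular, a minimiser could be moved within the set of
  minimisers until it has a smaller support.\<close>

lemma minimal_support_nonsingular:
  assumes sym: "symmetric r P" and y: "y \<in> simplex r"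
    and min: "\<And>x. x \<in> simplex r \<Longrightarrow> qform r P y \<le> qform r P x"
    and small: "\<And>x. x \<in> simplex r \<Longrightarrow> qform r P x \<le> qform r P y \<Longrightarrow>
      card {i. i < r \<and> y i \<noteq> 0} \<le> card {i. i < r \<and> x i \<noteq> 0}"
  shows "nonsingular (Suc r) (kkt r P {i. i < r \<and> y i \<noteq> 0})"
  unfolding nonsingular_def
proof (intro allI impI)
  define I where "I = {i. i < r \<and> y i \<noteq> 0}"
  fix u l assume u: "\<forall>i<Suc r. lin (Suc r) (kkt r P {i. i < r \<and> y i \<noteq> 0} i) u = 0" and l: "l < Suc r"
  have I: "I \<subseteq> {..<r}" by (auto simp: I_def)
  have out: "u i = 0" if "i < r" "y i = 0" for i
    using u[rule_format, of i] lin_kkt_out[of i r I P u] that by (simp add: I_def)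
  have inn: "(\<Sum>j\<in>I. P i j * u j) = - u r" if "i \<in> I" for i
    using u[rule_format, of i] lin_kkt_in[OF I that, of P u] that by (simp add: I_def)
  have "sum u I = 0"
    using u[rule_format, of r] lin_kkt_last[OF I, of P u] by (simp add: I_def)
  then have sum0: "sum u {..<r} = 0"
    using sum.mono_neutral_right[OF finite_lessThan I, of u] out by (auto simp: I_def)
  \<comment> \<open>A kernel vector is itself an admissible direction: its entries off the support
    vanish and the last KKT row makes its sum 0.\<close>
  have L: "(\<Sum>i<r. u i * lin r (P i) y) = 0"
    by (rule simplex_first_order[OF sym y min sum0 out])
  have "lin r (P i) u = - u r" if "i \<in> I" for i
    unfolding inn[OF that, symmetric] lin_def
    by (rule sum.mono_neutral_right) (use I out in \<open>auto simp: I_def\<close>)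
  then have "u i * lin r (P i) u = - u r * u i" if "i < r" for i
    using out that by (cases "y i = 0") (auto simp: I_def)
  then have "(\<Sum>i<r. u i * lin r (P i) u) = (\<Sum>i<r. - u r * u i)"
    by (intro sum.cong) auto
  also have "\<dots> = 0"
    using sum0 by (simp add: sum_distrib_left[symmetric] sum_negf)
  \<comment> \<open>On the support \<open>P u\<close> is the constant \<open>- u r\<close>, so the
    quadratic coefficient is that constant times the sum of \<open>u\<close>. With \<open>L\<close>
    also 0, the form is constant along the line through \<open>y\<close> in direction
    \<open>u\<close>.\<close>
  finally have D: "qform r P u = 0"
    by (simp add: qform_def lin_def sum_distrib_left mult.assoc)
  have zero: "u i = 0" if "i < r" for i
  proof (rule ccontr)
    assume nz: "u i \<noteq> 0"
    define N where "N = {j. j < r \<and> u j < 0}"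
    have "N \<noteq> {}"
    proof
      assume "N = {}"
      then have "\<forall>j\<in>{..<r}. 0 \<le> u j" by (force simp: N_def)
      then have "u i = 0"
        using sum_nonneg_eq_0_iff[of "{..<r}" u] sum0 \<open>i < r\<close> by auto
      then show False using nz by simp
    qed
    moreover have fin: "finite N" by (simp add: N_def)
    \<comment> \<open>This is a ratio test: \<open>t\<close> is the largest step before a coordinate
      would become negative. It is attained at some \<open>k\<close>, which thereby leaves the
      support, while no index enters it.\<close>
    define t where "t = Min ((\<lambda>j. y j / - u j) ` N)"
    have "t \<in> (\<lambda>j. y j / - u j) ` N"
      unfolding t_def using fin \<open>N \<noteq> {}\<close> by (intro Min_in) auto
    then obtain k where k: "k < r" "u k < 0" "t = y k / - u k"
      by (auto simp: N_def)
    have ynn: "0 \<le> y j" if "j < r" for j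
      using y that by (simp add: simplex_def)
    have t0: "0 \<le> t"
      unfolding k(3) using k ynn by (intro divide_nonneg_pos) auto
    let ?x = "\<lambda>j. y j + t * u j"
    have xnn: "0 \<le> ?x j" if j: "j < r" for j
    proof (cases "u j < 0")
      case True
      then have "t \<le> y j / - u j"
        unfolding t_def using fin j by (intro Min_le) (auto simp: N_def)
      then show ?thesis using True by (simp add: field_simps)
    qed (use t0 ynn[OF j] in simp)
    have x: "?x \<in> simplex r"
      using y sum0 xnn by (simp add: simplex_def sum.distrib sum_distrib_left[symmetric])
    have "qform r P ?x \<le> qform r P y"
      by (simp add: qform_line[OF sym] L D)
    then have "card I \<le> card {i. i < r \<and> ?x i \<noteq> 0}"
      unfolding I_def by (rule small[OF x])
    moreover have "{i. i < r \<and> ?x i \<noteq> 0} \<subset> I"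
    proof
      show "{i. i < r \<and> ?x i \<noteq> 0} \<subseteq> I"
        using out by (auto simp: I_def)
      have "y k \<noteq> 0"
        using k(1,2) out[of k] by force
      moreover have "?x k = 0"
        unfolding k(3) using k(2) by simp
      ultimately have "k \<in> I" "k \<notin> {i. i < r \<and> ?x i \<noteq> 0}"
        using k(1) by (simp_all add: I_def)
      then show "{i. i < r \<and> ?x i \<noteq> 0} \<noteq> I" by blast
    qed
    then have "card {i. i < r \<and> ?x i \<noteq> 0} < card I"
      by (rule psubset_card_mono[OF finite_subset[OF I finite_lessThan]])
    ultimately show False by simp
  qed
  have "I \<noteq> {}"
  proof
    assume "I = {}"
    then have "sum y {..<r} = 0" by (auto simp: I_def)
    then show False using y by (simp add: simplex_def)
  qed
  \<comment> \<open>Only the multiplier entry \<open>u r\<close> is left, and any row in the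
    support, with \<open>u\<close> zero elsewhere, says that it vanishes.\<close>
  then obtain i where "i \<in> I" by blast
  then have "u r = 0"
    using inn[of i] zero I by (auto simp: sum.neutral subset_iff)
  then show "u l = 0"
    using zero l less_Suc_eq by metis
qed

section \<open>Minimisers as solutions of KKT systems\<close>

lemma qform_scale: "qform n P (\<lambda>i. c * x i) = c\<^sup>2 * qform n P x"
  unfolding qform_def sum_distrib_left power2_eq_square by (intro sum.cong refl) (simp add: algebra_simps)

lemma normalised:
  assumes "\<forall>i<r. 0 \<le> x i" "\<exists>i<r. x i \<noteq> 0"
  obtains c where "c > 0" "(\<lambda>i. c * x i) \<in> simplex r"
proof -
  have "sum x {..<r} \<noteq> 0" "sum x {..<r} \<ge> 0"
    using assms sum_nonneg_eq_0_iff[of "{..<r}" x] by (auto intro: sum_nonneg)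
  then show thesis
    using assms(1) by (intro that[of "1 / sum x {..<r}"])
      (auto simp: simplex_def sum_divide_distrib[symmetric])
qed

text \<open>Among all minimisers on the simplex one with smallest support is taken; nonsingularity
  belongs to its support. Homogeneity lets any nonzero witness be scaled into the simplex, so the
  minimum is nonpositive, and negative whenever the form takes a negative value on the cone.\<close>

lemma kkt_candidate_exists:
  assumes sym: "symmetric r P" and np: "takes_nonpos r r P"
  shows "\<exists>I w. I \<subseteq> {..<r} \<and> nonsingular (Suc r) (kkt r P I) \<and>
    (\<forall>i<Suc r. lin (Suc r) (kkt r P I i) w = (if i = r then 1 else 0)) \<and>
    w \<in> simplex r \<and> qform r P w \<le> 0 \<and> (takes_neg r r P \<longrightarrow> qform r P w < 0)"
proof -
  have "r > 0"
    using np unfolding takes_nonpos_def by auto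
  then obtain y0 where y0: "y0 \<in> simplex r" "\<And>x. x \<in> simplex r \<Longrightarrow> qform r P y0 \<le> qform r P x"
    using simplex_minimiser by blast
  define M where "M y \<longleftrightarrow> y \<in> simplex r \<and> (\<forall>x\<in>simplex r. qform r P y \<le> qform r P x)" for y
  have "M y0" using y0 by (simp add: M_def)
  from ex_has_least_nat[of M, OF this, of "\<lambda>y. card {i. i < r \<and> y i \<noteq> 0}"]
  obtain y where y: "M y" and
    least: "\<And>x. M x \<Longrightarrow> card {i. i < r \<and> y i \<noteq> 0} \<le> card {i. i < r \<and> x i \<noteq> 0}"
    by blast
  define I where "I = {i. i < r \<and> y i \<noteq> 0}"
  have I: "I \<subseteq> {..<r}" by (auto simp: I_def)
  have ys: "y \<in> simplex r" and ymin: "\<And>x. x \<in> simplex r \<Longrightarrow> qform r P y \<le> qform r P x"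
    using y by (auto simp: M_def)
  have ns: "nonsingular (Suc r) (kkt r P I)"
    unfolding I_def
  proof (rule minimal_support_nonsingular[OF sym ys ymin])
    fix x assume x: "x \<in> simplex r" "qform r P x \<le> qform r P y"
    have "M x"
      unfolding M_def using x(1) order_trans[OF x(2) ymin] by blast
    then show "card {i. i < r \<and> y i \<noteq> 0} \<le> card {i. i < r \<and> x i \<noteq> 0}"
      by (rule least)
  qed
  have "sum y {..<r} = 1"
    using ys by (simp add: simplex_def)
  then have sumI: "sum y I = 1"
    using sum.mono_neutral_right[OF finite_lessThan I, of y] by (auto simp: I_def)
  then obtain l where l: "l \<in> I" by fastforce
  have stat: "lin r (P i) y = lin r (P l) y" if i: "i \<in> I" for i
  proof (cases "i = l")
    case False
    \<comment> \<open>Shifting mass between two support indices shows that the gradient takes equal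
      values at both.\<close>
    define d where "d = (\<lambda>k. if k = i then 1 else if k = l then - 1 else 0 :: real)"
    have il: "i < r" "l < r" using i l I by auto
    have dsum: "(\<Sum>k<r. d k * f k) = f i - f l" for f
    proof -
      have "(\<Sum>k<r. d k * f k) = (\<Sum>k<r. (if k = i then f i else 0) - (if k = l then f l else 0))"
        by (rule sum.cong) (use False in \<open>auto simp: d_def\<close>)
      then show ?thesis using il by (simp add: sum_subtractf)
    qed
    have "(\<Sum>k<r. d k * lin r (P k) y) = 0"
      by (rule simplex_first_order[OF sym ys ymin])
        (use dsum[of "\<lambda>_. 1"] i l in \<open>auto simp: d_def I_def split: if_splits\<close>)
    then show ?thesis by (simp add: dsum)
  qed simp
  \<comment> \<open>Index \<open>r\<close> carries the multiplier, minus the common value of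
    \<open>P y\<close> on the support.\<close>
  define w where "w = y(r := - lin r (P l) y)"
  have linI: "(\<Sum>j\<in>I. P i j * w j) = lin r (P i) y" for i
    unfolding lin_def by (rule sum.mono_neutral_cong_left) (auto simp: I_def w_def)
  have "lin (Suc r) (kkt r P I i) w = (if i = r then 1 else 0)" if i: "i < Suc r" for i
  proof (cases "i \<in> I")
    case True
    then show ?thesis
      using lin_kkt_in[OF I True, of P w] linI stat[OF True] I by (auto simp: w_def)
  next
    case False
    show ?thesis
    proof (cases "i = r")
      case True
      have "sum w I = sum y I"
        by (rule sum.cong) (auto simp: I_def w_def)
      then show ?thesis using lin_kkt_last[OF I, of P w] True sumI by simp
    next
      assume "i \<noteq> r"
      then have "i < r" using i by simp
      then show ?thesis
        using lin_kkt_out[OF _ False, of r P w] False by (simp add: I_def w_def)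
    qed
  qed
  moreover have wq: "qform r P w = qform r P y"
    by (rule qform_cong) (auto simp: w_def)
  moreover have "w \<in> simplex r"
    using ys by (simp add: simplex_def w_def)
  moreover have "qform r P y \<le> 0"
  proof -
    obtain x where x: "\<forall>i<r. 0 \<le> x i" "\<exists>i<r. x i \<noteq> 0" "qform r P x \<le> 0"
      using np unfolding takes_nonpos_def by blast
    obtain c where c: "c > 0" "(\<lambda>i. c * x i) \<in> simplex r"
      using normalised[OF x(1,2)] .
    have "qform r P y \<le> c\<^sup>2 * qform r P x"
      using ymin[OF c(2)] by (simp add: qform_scale)
    also have "\<dots> \<le> 0" using x(3) by (simp add: mult_le_0_iff)
    finally show ?thesis .
  qed
  moreover have "qform r P y < 0" if neg: "takes_neg r r P"
  proof -
    obtain x where x: "\<forall>i<r. 0 \<le> x i" "qform r P x < 0"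
      using neg unfolding takes_neg_def by blast
    have "\<exists>i<r. x i \<noteq> 0"
    proof (rule ccontr)
      assume "\<not> ?thesis"
      then have "qform r P x = 0" by (simp add: qform_def)
      then show False using x by simp
    qed
    then obtain c where c: "c > 0" "(\<lambda>i. c * x i) \<in> simplex r"
      using normalised[OF x(1)] by blast
    have "qform r P y \<le> c\<^sup>2 * qform r P x"
      using ymin[OF c(2)] by (simp add: qform_scale)
    also have "\<dots> < 0" using x(2) c by (simp add: mult_less_0_iff)
    finally show ?thesis .
  qed
  ultimately show ?thesis using I ns by metis
qed

lemma nonsingular_unique:
  assumes K: "nonsingular n K" and eq: "\<And>i. i < n \<Longrightarrow> lin n (K i) x = lin n (K i) w"
    and i: "i < n"
  shows "x i = w i"
proof -
  have "lin n (K i) (\<lambda>j. x j - w j) = 0" if "i < n" for i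
    using eq[OF that] by (simp add: lin_def right_diff_distrib sum_subtractf)
  then have "\<forall>i<n. x i - w i = 0"
    using K unfolding nonsingular_def by blast
  then show ?thesis using i by simp
qed


section \<open>The program for column reduction\<close>

abbreviation NEq :: "nexp \<Rightarrow> nexp \<Rightarrow> bexp" where
  "NEq a b \<equiv> Conj (Neg (NLess a b)) (Neg (NLess b a))"

abbreviation RZero :: "rexp \<Rightarrow> bexp" where
  "RZero e \<equiv> Conj (Neg (RLess e (Const 0))) (Neg (RLess (Const 0) e))"

text \<open>Registers 3, 4, 5 hold the number of rows to be reduced, the number of all rows, and the number
  of columns of array 3; registers 6 to 9, 11, 16, 19 and 20 are counters. Register 10 holds \<open>p - q\<close>,
  register 12 the number of free coordinates, and register 15 the number of faces. Array 5 holds the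
  current quadratic form, row 0 of array 6 the indicator of the current face, and row 0 of array 7
  scalars.\<close>

definition add_column_prog :: "nat \<Rightarrow> nat \<Rightarrow> com" where
  "add_column_prog d c = For 9 4 (SetEntry 3 (Reg 9) (Reg d)
     (RAdd (Entry 3 (Reg 9) (Reg d))
       (RMul (Entry 7 (Lit 0) (Lit 0)) (Entry 3 (Reg 9) (Reg c)))))"

text \<open>Without a pivot the scan runs past the last column. The subsequent steps then use
  meaningless entries, which affects neither termination nor time.\<close>

definition scan_prog :: com where
  "scan_prog = While (Conj (NLess (Reg 7) (Reg 5)) (RZero (Entry 3 (Reg 6) (Reg 7))))
     (SetReg 7 (NAdd (Reg 7) (Lit 1)))"

definition clear_row_prog :: com where
  "clear_row_prog = For 8 5 (If (NEq (Reg 8) (Reg 6)) Skip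
     (Seq (SetEntry 7 (Lit 0) (Lit 0) (RSub (Const 0) (Entry 3 (Reg 6) (Reg 8))))
       (add_column_prog 8 6)))"

definition reduce_prog :: com where
  "reduce_prog = For 6 3 (Seq (SetReg 7 (Reg 6)) (Seq scan_prog
     (Seq (SetEntry 7 (Lit 0) (Lit 0)
         (RDiv (RSub (Const 1) (Entry 3 (Reg 6) (Reg 6))) (Entry 3 (Reg 6) (Reg 7))))
       (Seq (add_column_prog 6 7) clear_row_prog))))"

lemma writes_reduce [simp]:
  "reg_writes (add_column_prog d c) = {9}" "arr_writes (add_column_prog d c) = {3}"
  "reg_writes scan_prog = {7}" "arr_writes scan_prog = {}"
  "reg_writes clear_row_prog = {8, 9}" "arr_writes clear_row_prog = {3, 7}"
  "reg_writes reduce_prog = {6, 7, 8, 9}" "arr_writes reduce_prog = {3, 7}"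
  by (auto simp: add_column_prog_def scan_prog_def clear_row_prog_def reduce_prog_def)

lemma computes_add_column:
  assumes "d \<noteq> 9" "c \<noteq> 9" "reg s 4 = R"
  shows "computes eig ec (add_column_prog d c) s ((R + 1) * 23)
    (\<lambda>s'. arr s' 3 = add_column R (reg s d) (reg s c) (arr s 7 0 0) (arr s 3))"
proof -
  \<comment> \<open>The row bound of \<open>add_column\<close> counts the finished rounds. Each
    round reads its row before writing it, so \<open>c = d\<close> causes no conflict.\<close>
  let ?I = "\<lambda>k s'. arr s' 3 = add_column k (reg s d) (reg s c) (arr s 7 0 0) (arr s 3)"
  let ?c = "SetEntry 3 (Reg 9) (Reg d)
     (RAdd (Entry 3 (Reg 9) (Reg d)) (RMul (Entry 7 (Lit 0) (Lit 0)) (Entry 3 (Reg 9) (Reg c))))"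
  have "computes eig ec (For 9 4 ?c) s ((R + 1) * (14 + 9)) (?I R)"
  proof (rule computes_For[where I = ?I])
    show "?I 0 s" by (simp add: add_column_def)
    fix k s'
    assume I: "?I k s'" and k: "reg s' 9 = k" and ag: "agree (insert 9 (reg_writes ?c)) (arr_writes ?c) s s'"
    have "reg s' d = reg s d" "reg s' c = reg s c" "arr s' 7 = arr s 7"
      using assms by (auto intro: agree_regD[OF ag] agree_arrD[OF ag])
    then show "computes eig ec ?c s' 14 (?I (Suc k))"
      using I k by (intro computes_loopfree) (auto simp: add_column_def fun_eq_iff less_Suc_eq)
  qed (use assms in auto)
  then show ?thesis by (simp add: add_column_prog_def)
qed

lemma computes_scan:
  assumes "reg s 5 = n" "reg s 6 = k"
  shows "computes eig ec scan_prog s ((n + 1) * 22) (\<lambda>s'.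
    (\<exists>c. reg s 7 \<le> c \<and> c < n \<and> arr s 3 k c \<noteq> 0) \<longrightarrow>
      reg s 7 \<le> reg s' 7 \<and> reg s' 7 < n \<and> arr s 3 k (reg s' 7) \<noteq> 0)"
proof -
  let ?b = "Conj (NLess (Reg 7) (Reg 5)) (RZero (Entry 3 (Reg 6) (Reg 7)))"
  \<comment> \<open>A failing test costs 18, a full round 22: the guard with its loop and the
    increment by 4.\<close>
  have "computes eig ec scan_prog s ((n - reg s 7) * 22 + 18) (\<lambda>s'.
    (\<exists>c. reg s 7 \<le> c \<and> c < n \<and> arr s 3 k c \<noteq> 0) \<longrightarrow>
      reg s 7 \<le> reg s' 7 \<and> reg s' 7 < n \<and> arr s 3 k (reg s' 7) \<noteq> 0)"
    using assms
  proof (induction "n - reg s 7" arbitrary: s)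
    case 0
    then have "\<not> bval s ?b" by auto
    from run.WhileFalse[OF this] 0 show ?case
      unfolding computes_def scan_prog_def by fastforce
  next
    case (Suc d)
    show ?case
    proof (cases "arr s 3 k (reg s 7) = 0")
      case False
      then have "\<not> bval s ?b" using Suc by auto
      moreover have "1 + btime ?b = 18" by simp
      ultimately have "run eig ec scan_prog s 18 s"
        unfolding scan_prog_def by (metis run.WhileFalse)
      then show ?thesis
        unfolding computes_def using Suc False by (intro exI[of _ 18] exI[of _ s]) auto
    next
      case True
      let ?s = "set_reg 7 (Suc (reg s 7)) s"
      have b: "bval s ?b" using True Suc by auto
      have "computes eig ec scan_prog ?s ((n - reg ?s 7) * 22 + 18) (\<lambda>s'.
        (\<exists>c. reg ?s 7 \<le> c \<and> c < n \<and> arr ?s 3 k c \<noteq> 0) \<longrightarrow>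
          reg ?s 7 \<le> reg s' 7 \<and> reg s' 7 < n \<and> arr ?s 3 k (reg s' 7) \<noteq> 0)"
        by (rule Suc(1)) (use Suc in auto)
      then obtain t s' where t: "run eig ec scan_prog ?s t s'" "t \<le> (n - Suc (reg s 7)) * 22 + 18"
        "(\<exists>c. Suc (reg s 7) \<le> c \<and> c < n \<and> arr s 3 k c \<noteq> 0) \<longrightarrow>
          Suc (reg s 7) \<le> reg s' 7 \<and> reg s' 7 < n \<and> arr s 3 k (reg s' 7) \<noteq> 0"
        by (auto simp: computes_def)
      have "run eig ec (SetReg 7 (NAdd (Reg 7) (Lit 1))) s 4 ?s"
        using run.SetReg[of eig ec 7 "NAdd (Reg 7) (Lit 1)" s] by (simp add: eval_nat_numeral)
      from run.WhileTrue[OF b this] t(1) have "run eig ec scan_prog s (1 + 17 + 4 + t) s'"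
        by (simp add: scan_prog_def)
      moreover have "n - reg s 7 = Suc (n - Suc (reg s 7))"
        using Suc by simp
      then have "1 + 17 + 4 + t \<le> (n - reg s 7) * 22 + 18"
        using t(2) by simp
      moreover have "(\<exists>c. reg s 7 \<le> c \<and> c < n \<and> arr s 3 k c \<noteq> 0) \<longrightarrow>
          reg s 7 \<le> reg s' 7 \<and> reg s' 7 < n \<and> arr s 3 k (reg s' 7) \<noteq> 0"
      proof
        assume "\<exists>c. reg s 7 \<le> c \<and> c < n \<and> arr s 3 k c \<noteq> 0"
        then obtain c where c: "reg s 7 \<le> c" "c < n" "arr s 3 k c \<noteq> 0" by blast
        then have "c \<noteq> reg s 7" using True by auto
        then have "Suc (reg s 7) \<le> c" using c by simp
        then have "Suc (reg s 7) \<le> reg s' 7 \<and> reg s' 7 < n \<and> arr s 3 k (reg s' 7) \<noteq> 0"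
          using c mp[OF t(3)] by blast
        then show "reg s 7 \<le> reg s' 7 \<and> reg s' 7 < n \<and> arr s 3 k (reg s' 7) \<noteq> 0"
          by simp
      qed
      ultimately show ?thesis
        unfolding computes_def by blast
    qed
  qed
  moreover have "(n - reg s 7) * 22 + 18 \<le> (n + 1) * 22"
    by arith
  ultimately show ?thesis
    by (rule computes_mono)
qed

lemma computes_clear_row:
  assumes "reg s 4 = R" "reg s 5 = n" "reg s 6 = k"
  shows "computes eig ec clear_row_prog s ((n + 1) * ((R + 1) * 23 + 29))
    (\<lambda>s'. arr s' 3 = clear_row R n k (arr s 3))"
proof -
  \<comment> \<open>The column bound of \<open>clear_row\<close> counts the finished rounds. Column
    \<open>k\<close> is skipped, and row \<open>k\<close> is changed at position \<open>j\<close>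
    only in round \<open>j\<close>, so every multiplier is read from the original row.\<close>
  let ?I = "\<lambda>j s'. arr s' 3 = clear_row R j k (arr s 3)"
  let ?d = "Seq (SetEntry 7 (Lit 0) (Lit 0) (RSub (Const 0) (Entry 3 (Reg 6) (Reg 8)))) (add_column_prog 8 6)"
  let ?c = "If (NEq (Reg 8) (Reg 6)) Skip ?d"
  have "computes eig ec (For 8 5 ?c) s ((n + 1) * ((R + 1) * 23 + 20 + 9)) (?I n)"
  proof (rule computes_For[where I = ?I])
    show "?I 0 s" by (simp add: clear_row_def)
    fix j s'
    assume I: "?I j s'" and j: "reg s' 8 = j" and ag: "agree (insert 8 (reg_writes ?c)) (arr_writes ?c) s s'"
    have k: "reg s' 6 = k" "reg s' 4 = R"
      using assms agree_regD[OF ag] by auto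
    show "computes eig ec ?c s' ((R + 1) * 23 + 20) (?I (Suc j))"
    proof (rule computes_IfI)
      assume "bval s' (NEq (Reg 8) (Reg 6))"
      then have "j = k" using j k by simp
      then show "computes eig ec Skip s' ((R + 1) * 23 + 10) (?I (Suc j))"
        using I by (intro computes_loopfree) (auto simp: clear_row_def fun_eq_iff less_Suc_eq)
    next
      assume "\<not> bval s' (NEq (Reg 8) (Reg 6))"
      then have jk: "j \<noteq> k" using j k by auto
      show "computes eig ec ?d s' ((R + 1) * 23 + 10) (?I (Suc j))"
      proof (rule computes_step)
        fix s1 assume s1: "s1 = exec (SetEntry 7 (Lit 0) (Lit 0) (RSub (Const 0) (Entry 3 (Reg 6) (Reg 8)))) s'"
        have "computes eig ec (add_column_prog 8 6) s1 ((R + 1) * 23)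
          (\<lambda>s'. arr s' 3 = add_column R (reg s1 8) (reg s1 6) (arr s1 7 0 0) (arr s1 3))"
          by (rule computes_add_column) (use s1 k in auto)
        then show "computes eig ec (add_column_prog 8 6) s1 ((R + 1) * 23) (?I (Suc j))"
          by (rule computes_mono)
            (use jk I in \<open>auto simp: s1 j k add_column_def clear_row_def fun_eq_iff less_Suc_eq\<close>)
      qed auto
    qed auto
  qed (use assms in \<open>auto simp: add_column_prog_def\<close>)
  then show ?thesis by (simp add: clear_row_prog_def algebra_simps)
qed

text \<open>Independence is a premise of the result but not of the time bound; the routine may
  therefore be applied blindly to the KKT matrix of every face.\<close>

lemma computes_reduce:
  assumes "reg s 3 = m" "reg s 4 = R" "reg s 5 = n" "m \<le> R"
  shows "computes eig ec reduce_prog s ((m + 1) * ((n + 1) * (R + 1) * 130)) (\<lambda>s'.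
    independent_rows m n (arr s 3) \<longrightarrow> column_equiv R n (arr s 3) (arr s' 3) \<and>
      (\<forall>i<m. \<forall>j<n. arr s' 3 i j = (if i = j then 1 else 0)))"
proof -
  let ?I = "\<lambda>k s'. independent_rows m n (arr s 3) \<longrightarrow> column_equiv R n (arr s 3) (arr s' 3) \<and>
      (\<forall>i<k. \<forall>j<n. arr s' 3 i j = (if i = j then 1 else 0))"
  let ?\<alpha> = "SetEntry 7 (Lit 0) (Lit 0)
         (RDiv (RSub (Const 1) (Entry 3 (Reg 6) (Reg 6))) (Entry 3 (Reg 6) (Reg 7)))"
  let ?c3 = "Seq (add_column_prog 6 7) clear_row_prog"
  let ?c2 = "Seq ?\<alpha> ?c3"
  let ?c1 = "Seq scan_prog ?c2"
  let ?c = "Seq (SetReg 7 (Reg 6)) ?c1"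
  let ?T3 = "1 + (R + 1) * 23 + (n + 1) * ((R + 1) * 23 + 29)"
  let ?T2 = "1 + 14 + ?T3"
  let ?T1 = "1 + (n + 1) * 22 + ?T2"
  have "computes eig ec (For 6 3 ?c) s ((m + 1) * (1 + 2 + ?T1 + 9)) (?I m)"
  proof (rule computes_For[where I = ?I])
    show "?I 0 s" by (simp add: column_equiv_refl)
    fix k s0
    assume km: "k < m" and I: "?I k s0" and k: "reg s0 6 = k"
      and ag: "agree (insert 6 (reg_writes ?c)) (arr_writes ?c) s s0"
    have R: "reg s0 4 = R" "reg s0 5 = n"
      using assms agree_regD[OF ag] by auto
    show "computes eig ec ?c s0 (1 + 2 + ?T1) (?I (Suc k))"
    proof (rule computes_step)
      fix s1 assume s1: "s1 = exec (SetReg 7 (Reg 6)) s0"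
      have "computes eig ec scan_prog s1 ((n + 1) * 22) (\<lambda>s'.
          (\<exists>c. reg s1 7 \<le> c \<and> c < n \<and> arr s1 3 k c \<noteq> 0) \<longrightarrow>
            reg s1 7 \<le> reg s' 7 \<and> reg s' 7 < n \<and> arr s1 3 k (reg s' 7) \<noteq> 0)"
        by (rule computes_scan) (use s1 R k in auto)
      then show "computes eig ec ?c1 s1 ?T1 (?I (Suc k))"
      proof (rule computes_SeqI)
        fix s2 assume scan: "(\<exists>c. reg s1 7 \<le> c \<and> c < n \<and> arr s1 3 k c \<noteq> 0) \<longrightarrow>
            reg s1 7 \<le> reg s2 7 \<and> reg s2 7 < n \<and> arr s1 3 k (reg s2 7) \<noteq> 0"
          and ag2: "agree (reg_writes scan_prog) (arr_writes scan_prog) s1 s2"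
        define H where "H = arr s0 3"
        define c where "c = reg s2 7"
        have s2: "reg s2 4 = R" "reg s2 5 = n" "reg s2 6 = k" "arr s2 3 = H"
          using agree_regD[OF ag2] agree_arrD[OF ag2] s1 R k by (auto simp: H_def)
        show "computes eig ec ?c2 s2 ?T2 (?I (Suc k))"
        proof (rule computes_step)
          fix s3 assume s3: "s3 = exec ?\<alpha> s2"
          have "computes eig ec (add_column_prog 6 7) s3 ((R + 1) * 23)
            (\<lambda>s'. arr s' 3 = add_column R (reg s3 6) (reg s3 7) (arr s3 7 0 0) (arr s3 3))"
            by (rule computes_add_column) (use s2 s3 in auto)
          then show "computes eig ec ?c3 s3 ?T3 (?I (Suc k))"
          proof (rule computes_SeqI)
            fix s4 assume "arr s4 3 = add_column R (reg s3 6) (reg s3 7) (arr s3 7 0 0) (arr s3 3)"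
              and ag4: "agree (reg_writes (add_column_prog 6 7)) (arr_writes (add_column_prog 6 7)) s3 s4"
            then have s4: "arr s4 3 = add_column R k c ((1 - H k k) / H k c) H"
              using s2 s3 by (simp add: c_def)
            have "computes eig ec clear_row_prog s4 ((n + 1) * ((R + 1) * 23 + 29))
              (\<lambda>s'. arr s' 3 = clear_row R n k (arr s4 3))"
              by (rule computes_clear_row) (use agree_regD[OF ag4] s2 s3 in auto)
            then show "computes eig ec clear_row_prog s4 ((n + 1) * ((R + 1) * 23 + 29)) (?I (Suc k))"
            proof (rule computes_mono)
              fix s5 assume "arr s5 3 = clear_row R n k (arr s4 3)"
              then have s5: "arr s5 3 = clear_row R n k (add_column R k c ((1 - H k k) / H k c) H)"
                by (simp add: s4)
              show "?I (Suc k) s5"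
              proof
                assume ind: "independent_rows m n (arr s 3)"
                then have eq: "column_equiv R n (arr s 3) H"
                  and unit: "\<And>i j. i < k \<Longrightarrow> j < n \<Longrightarrow> H i j = (if i = j then 1 else 0)"
                  using I by (auto simp: H_def)
                have "\<exists>c. k \<le> c \<and> c < n \<and> H k c \<noteq> 0"
                  using pivot_exists[OF eq ind km assms(4)] unit by blast
                moreover have "reg s1 7 = k" "arr s1 3 = H"
                  using s1 k by (simp_all add: H_def)
                ultimately have c: "k \<le> c" "c < n" "H k c \<noteq> 0"
                  using scan by (auto simp: c_def)
                have "k < R" using km assms by simp
                note piv = pivot_step[OF eq c(1,2) this c(3) unit, folded s5]
                show "column_equiv R n (arr s 3) (arr s5 3) \<and>
                  (\<forall>i<Suc k. \<forall>j<n. arr s5 3 i j = (if i = j then 1 else 0))"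
                  using piv by (simp add: less_Suc_eq_le)
              qed
            qed auto
          qed auto
        qed auto
      qed auto
    qed auto
  qed (use assms in auto)
  then have "computes eig ec reduce_prog s ((m + 1) * (1 + 2 + ?T1 + 9)) (?I m)"
    by (simp add: reduce_prog_def)
  then show ?thesis
  proof (rule computes_mono)
    show "(m + 1) * (1 + 2 + ?T1 + 9) \<le> (m + 1) * ((n + 1) * (R + 1) * 130)"
      by (rule mult_le_mono2) (simp add: algebra_simps)
  qed auto
qed


section \<open>The program for the reduction to a small copositivity problem\<close>

text \<open>The rows \<open>A\<close>, \<open>B\<close> and an identity below them. The identity
  block is there to record the column operations.\<close>

definition stack_prog :: com where
  "stack_prog = For 9 4 (For 8 5
     (If (NLess (Reg 9) (Reg 1)) (SetEntry 3 (Reg 9) (Reg 8) (Entry 1 (Reg 9) (Reg 8)))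
     (If (NLess (Reg 9) (Reg 3)) (SetEntry 3 (Reg 9) (Reg 8) (Entry 2 (NSub (Reg 9) (Reg 1)) (Reg 8)))
     (If (NEq (Reg 9) (NAdd (Reg 3) (Reg 8))) (SetEntry 3 (Reg 9) (Reg 8) (Const 1))
       (SetEntry 3 (Reg 9) (Reg 8) (Const 0))))))"

text \<open>The expression \<open>e\<close> is the summand, with row, column and summation index in
  registers 9, 8 and 20. The sum always has length \<open>p\<close>, found in register 0.\<close>

definition dot_prog :: "nat \<Rightarrow> nat \<Rightarrow> nat \<Rightarrow> rexp \<Rightarrow> com" where
  "dot_prog X y z e = For 9 y (For 8 z
     (Seq (SetEntry X (Reg 9) (Reg 8) (Const 0))
       (For 20 0 (SetEntry X (Reg 9) (Reg 8) (RAdd (Entry X (Reg 9) (Reg 8)) e)))))"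

definition schur_prog :: com where
  "schur_prog = For 9 19 (For 8 19 (SetEntry 5 (Reg 9) (Reg 8)
     (RSub (Entry 5 (Reg 9) (Reg 8))
       (RDiv (RMul (Entry 5 (Reg 9) (Reg 19)) (Entry 5 (Reg 19) (Reg 8))) (Entry 5 (Reg 19) (Reg 19))))))"

definition row_test_prog :: com where
  "row_test_prog = For 9 19 (If (RZero (Entry 5 (Reg 19) (Reg 9))) Skip (SetReg 13 (Lit 1)))"

definition pivot_prog :: com where
  "pivot_prog = If (RLess (Entry 5 (Reg 19) (Reg 19)) (Const 0)) (SetReg 13 (Lit 1))
     (If (RLess (Const 0) (Entry 5 (Reg 19) (Reg 19))) schur_prog
       (Seq (SetReg 14 (Lit 1)) row_test_prog))"

text \<open>Loops count upwards while free coordinates are removed from the last one down, so that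
  the constrained ones keep the indices below \<open>r\<close>; register 19 translates. Further
  rounds after register 13 has been set do no harm, as \<open>eliminated\<close> then makes no claim
  about the array.\<close>

definition eliminate_prog :: com where
  "eliminate_prog = For 11 12
     (Seq (SetReg 19 (NSub (NSub (Reg 10) (Lit 1)) (Reg 11))) pivot_prog)"

lemma writes_stage [simp]:
  "reg_writes stack_prog = {8, 9}" "arr_writes stack_prog = {3}"
  "reg_writes (dot_prog X y z e) = {8, 9, 20}" "arr_writes (dot_prog X y z e) = {X}"
  "reg_writes schur_prog = {8, 9}" "arr_writes schur_prog = {5}"
  "reg_writes row_test_prog = {9, 13}" "arr_writes row_test_prog = {}"
  "reg_writes pivot_prog = {8, 9, 13, 14}" "arr_writes pivot_prog = {5}"
  "reg_writes eliminate_prog = {8, 9, 11, 13, 14, 19}" "arr_writes eliminate_prog = {5}"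
  by (auto simp: stack_prog_def dot_prog_def schur_prog_def row_test_prog_def pivot_prog_def
    eliminate_prog_def)

lemma computes_stack:
  assumes "reg s 1 = q" "reg s 3 = m" "reg s 4 = R" "reg s 5 = n"
  shows "computes eig ec stack_prog s ((R + 1) * ((n + 1) * 80)) (\<lambda>s'. arr s' 3 = (\<lambda>i j.
    if i < R \<and> j < n then (if i < q then arr s 1 i j else if i < m then arr s 2 (i - q) j
      else if i = m + j then 1 else 0) else arr s 3 i j))"
proof -
  let ?f = "\<lambda>i j. if i < q then arr s 1 i j else if i < m then arr s 2 (i - q) j
      else if i = m + j then 1 else 0"
  have "computes eig ec stack_prog s ((R + 1) * ((n + 1) * (60 + 9) + 9))
    (\<lambda>s'. arr s' 3 = (\<lambda>i j. if i < R \<and> j < n then ?f i j else arr s 3 i j))"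
    unfolding stack_prog_def
  proof (rule computes_fill)
    fix a b s'
    let ?c = "If (NLess (Reg 9) (Reg 1)) (SetEntry 3 (Reg 9) (Reg 8) (Entry 1 (Reg 9) (Reg 8)))
     (If (NLess (Reg 9) (Reg 3)) (SetEntry 3 (Reg 9) (Reg 8) (Entry 2 (NSub (Reg 9) (Reg 1)) (Reg 8)))
     (If (NEq (Reg 9) (NAdd (Reg 3) (Reg 8))) (SetEntry 3 (Reg 9) (Reg 8) (Const 1))
       (SetEntry 3 (Reg 9) (Reg 8) (Const 0))))"
    assume r: "reg s' 9 = a" "reg s' 8 = b"
      and ag: "agree ({9, 8} \<union> reg_writes ?c) (arr_writes ?c) s s'"
    have "reg s' 1 = q" "reg s' 3 = m" "arr s' 1 = arr s 1" "arr s' 2 = arr s 2"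
      using assms agree_regD[OF ag] agree_arrD[OF ag] by auto
    then show "computes eig ec ?c s' 60 (\<lambda>s''. arr s'' 3 = (arr s' 3)(a := (arr s' 3 a)(b := ?f a b)))"
      by (intro computes_loopfree) (auto simp: r)
  qed (use assms in auto)
  then show ?thesis
    by (rule computes_mono) (simp_all add: algebra_simps)
qed

lemma computes_dot:
  assumes yz: "y \<notin> {8, 9, 20}" "z \<notin> {8, 9, 20}"
    and N: "reg s0 y = N" "reg s0 z = M" "reg s0 0 = K" and T0: "rtime e \<le> T0"
    and e: "\<And>a b l s. a < N \<Longrightarrow> b < M \<Longrightarrow> l < K \<Longrightarrow> reg s 9 = a \<Longrightarrow> reg s 8 = b \<Longrightarrow> reg s 20 = l \<Longrightarrow>
      agree {8, 9, 20} {X} s0 s \<Longrightarrow> rval s e = g a b l"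
  shows "computes eig ec (dot_prog X y z e) s0 ((N + 1) * ((M + 1) * ((K + 1) * (T0 + 40))))
    (\<lambda>s'. arr s' X = (\<lambda>a b. if a < N \<and> b < M then \<Sum>l<K. g a b l else arr s0 X a b))"
proof -
  let ?b = "SetEntry X (Reg 9) (Reg 8) (RAdd (Entry X (Reg 9) (Reg 8)) e)"
  let ?z = "SetEntry X (Reg 9) (Reg 8) (Const 0)"
  let ?c = "Seq ?z (For 20 0 ?b)"
  let ?T = "1 + 4 + (K + 1) * (T0 + 7 + 9)"
  have "computes eig ec (dot_prog X y z e) s0 ((N + 1) * ((M + 1) * (?T + 9) + 9))
    (\<lambda>s'. arr s' X = (\<lambda>a b. if a < N \<and> b < M then \<Sum>l<K. g a b l else arr s0 X a b))"
    unfolding dot_prog_def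
  proof (rule computes_fill)
    fix a b s
    assume ab: "a < N" "b < M" and r: "reg s 9 = a" "reg s 8 = b"
      and "agree ({9, 8} \<union> reg_writes ?c) (arr_writes ?c) s0 s"
    then have ag: "agree {8, 9, 20} {X} s0 s"
      by (auto elim: agree_mono)
    let ?I = "\<lambda>l s'. arr s' X = (arr s X)(a := (arr s X a)(b := \<Sum>l<l. g a b l))"
    show "computes eig ec ?c s ?T (?I K)"
    proof (rule computes_step)
      fix s1 assume s1: "s1 = exec ?z s"
      have ag1: "agree {8, 9, 20} {X} s0 s1"
        using ag by (auto simp: s1 agree_def)
      show "computes eig ec (For 20 0 ?b) s1 ((K + 1) * (T0 + 7 + 9)) (?I K)"
      proof (rule computes_For[where I = ?I])
        show "reg s1 0 = K" using agree_regD[OF ag1, of 0] N by simp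
        show "?I 0 s1" by (simp add: s1 r)
        fix l s2
        assume l: "l < K" and I: "?I l s2" and r2: "reg s2 20 = l"
          and ag2: "agree (insert 20 (reg_writes ?b)) (arr_writes ?b) s1 s2"
        have r3: "reg s2 9 = a" "reg s2 8 = b"
          using agree_regD[OF ag2] by (auto simp: s1 r)
        have "agree {8, 9, 20} {X} s1 s2"
          by (rule agree_mono[OF ag2]) auto
        then have "agree {8, 9, 20} {X} s0 s2"
          by (rule agree_trans[OF ag1])
        then have "rval s2 e = g a b l"
          using e[OF ab l r3 r2] by simp
        then show "computes eig ec ?b s2 (T0 + 7) (?I (Suc l))"
          using T0 I r3 by (intro computes_loopfree) auto
      qed (use N yz in auto)
    qed auto
  qed (use N yz in auto)
  then show ?thesis
  proof (rule computes_mono)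
    have "1 \<le> (K + 1) * 1" by simp
    show "(N + 1) * ((M + 1) * (?T + 9) + 9) \<le> (N + 1) * ((M + 1) * ((K + 1) * (T0 + 40)))"
      by (rule mult_le_mono2) (simp add: algebra_simps)
  qed
qed

text \<open>The update can be done in place: besides the entry itself it reads only row and column
  \<open>k\<close>, which lie outside the block being overwritten.\<close>

lemma computes_schur:
  assumes "reg s 19 = k"
  shows "computes eig ec schur_prog s ((k + 1) * ((k + 1) * 36))
    (\<lambda>s'. arr s' 5 = schur k (arr s 5))"
proof -
  let ?c = "SetEntry 5 (Reg 9) (Reg 8)
     (RSub (Entry 5 (Reg 9) (Reg 8))
       (RDiv (RMul (Entry 5 (Reg 9) (Reg 19)) (Entry 5 (Reg 19) (Reg 8))) (Entry 5 (Reg 19) (Reg 19))))"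
  let ?f = "\<lambda>i j. arr s 5 i j - arr s 5 i k * arr s 5 k j / arr s 5 k k"
  have "computes eig ec schur_prog s ((k + 1) * ((k + 1) * (18 + 9) + 9))
    (\<lambda>s'. arr s' 5 = (\<lambda>i j. if i < k \<and> j < k then ?f i j else arr s 5 i j))"
    unfolding schur_prog_def
  proof (rule computes_fill)
    fix a b s'
    assume ab: "a < k" "b < k" and r: "reg s' 9 = a" "reg s' 8 = b"
      and ag: "agree ({9, 8} \<union> reg_writes ?c) (arr_writes ?c) s s'"
      and X: "arr s' 5 = (\<lambda>u v. if u < a \<and> v < k \<or> u = a \<and> v < b then ?f u v else arr s 5 u v)"
    have "reg s' 19 = k"
      using assms agree_regD[OF ag] by auto
    then show "computes eig ec ?c s' 18 (\<lambda>s''. arr s'' 5 = (arr s' 5)(a := (arr s' 5 a)(b := ?f a b)))"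
      using ab by (intro computes_loopfree) (auto simp: r X)
  qed (use assms in auto)
  then show ?thesis
    by (rule computes_mono) (simp_all add: algebra_simps schur_def)
qed

lemma computes_row_test:
  assumes "reg s 19 = k"
  shows "computes eig ec row_test_prog s ((k + 1) * 30)
    (\<lambda>s'. reg s' 13 = (if \<exists>j<k. arr s 5 k j \<noteq> 0 then 1 else reg s 13))"
proof -
  let ?c = "If (RZero (Entry 5 (Reg 19) (Reg 9))) Skip (SetReg 13 (Lit 1))"
  let ?I = "\<lambda>i s'. reg s' 13 = (if \<exists>j<i. arr s 5 k j \<noteq> 0 then 1 else reg s 13)"
  have "computes eig ec row_test_prog s ((k + 1) * (20 + 9)) (?I k)"
    unfolding row_test_prog_def
  proof (rule computes_For[where I = ?I])
    fix i s'
    assume I: "?I i s'" and i: "reg s' 9 = i"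
      and ag: "agree (insert 9 (reg_writes ?c)) (arr_writes ?c) s s'"
    have "reg s' 19 = k" "arr s' 5 = arr s 5"
      using assms agree_regD[OF ag] agree_arrD[OF ag] by auto
    then show "computes eig ec ?c s' 20 (?I (Suc i))"
      using I i by (intro computes_loopfree) (auto simp: less_Suc_eq split: if_splits)
  qed (use assms in auto)
  then show ?thesis
    by (rule computes_mono) simp_all
qed

text \<open>Register 13 is set once a negative value is known to exist, register 14 once a nonzero vector
  with nonpositive value is known to exist.\<close>

definition eliminated :: "nat \<Rightarrow> nat \<Rightarrow> (nat \<Rightarrow> nat \<Rightarrow> real) \<Rightarrow> nat \<Rightarrow> memory \<Rightarrow> bool" where
  "eliminated r n P k s \<longleftrightarrow>
     (if reg s 13 = 0 then symmetric k (arr s 5) \<and>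
        (takes_neg r n P \<longleftrightarrow> takes_neg r k (arr s 5)) \<and>
        (takes_nonpos r n P \<longleftrightarrow> reg s 14 \<noteq> 0 \<or> takes_nonpos r k (arr s 5))
      else takes_neg r n P)"

text \<open>With a zero diagonal entry register 14 is set before the row is inspected. This is right
  for a zero row; for a nonzero row register 13 is set as well and takes precedence.\<close>

lemma computes_pivot:
  assumes k: "reg s 19 = k" "r \<le> k" and I: "eliminated r n P (Suc k) s"
  shows "computes eig ec pivot_prog s ((k + 1) * ((k + 1) * 60)) (eliminated r n P k)"
proof -
  define H where "H = arr s 5"
  have pos: "takes_neg r n P" if "reg s 13 \<noteq> 0"
    using I that by (simp add: eliminated_def)
  have sym: "symmetric (Suc k) H" and neg: "takes_neg r n P \<longleftrightarrow> takes_neg r (Suc k) H"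
    and nonpos: "takes_nonpos r n P \<longleftrightarrow> reg s 14 \<noteq> 0 \<or> takes_nonpos r (Suc k) H" if "reg s 13 = 0"
    using I that by (auto simp: eliminated_def H_def)
  have "computes eig ec (If (RLess (Const 0) (Entry 5 (Reg 19) (Reg 19))) schur_prog
       (Seq (SetReg 14 (Lit 1)) row_test_prog)) s ((k + 1) * ((k + 1) * 36) + 14) (eliminated r n P k)"
    if nneg: "\<not> bval s (RLess (Entry 5 (Reg 19) (Reg 19)) (Const 0))"
  proof (rule computes_IfI)
    assume "bval s (RLess (Const 0) (Entry 5 (Reg 19) (Reg 19)))"
    then have d: "H k k > 0" using k by (simp add: H_def)
    show "computes eig ec schur_prog s ((k + 1) * ((k + 1) * 36) + 6) (eliminated r n P k)"
    proof (rule computes_mono[OF computes_schur[OF k(1)]])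
      fix s' assume "arr s' 5 = schur k (arr s 5)"
        and ag: "agree (reg_writes schur_prog) (arr_writes schur_prog) s s'"
      then have "arr s' 5 = schur k H" "reg s' 13 = reg s 13" "reg s' 14 = reg s 14"
        using agree_regD[OF ag] by (auto simp: H_def)
      then show "eliminated r n P k s'"
        using pos neg nonpos schur_symmetric[OF sym] takes_schur[OF sym k(2) d]
        by (auto simp: eliminated_def)
    qed simp
  next
    assume "\<not> bval s (RLess (Const 0) (Entry 5 (Reg 19) (Reg 19)))"
    then have d: "H k k = 0" using k nneg by (simp add: H_def)
    show "computes eig ec (Seq (SetReg 14 (Lit 1)) row_test_prog) s ((k + 1) * ((k + 1) * 36) + 6)
      (eliminated r n P k)"
    proof (rule computes_step)
      fix s1 assume s1: "s1 = exec (SetReg 14 (Lit 1)) s"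
      have k1: "reg s1 19 = k" using k s1 by simp
      show "computes eig ec row_test_prog s1 ((k + 1) * 30) (eliminated r n P k)"
      proof (rule computes_mono[OF computes_row_test[OF k1]])
        fix s' assume "reg s' 13 = (if \<exists>j<k. arr s1 5 k j \<noteq> 0 then 1 else reg s1 13)"
          and ag: "agree (reg_writes row_test_prog) (arr_writes row_test_prog) s1 s'"
        then have s': "arr s' 5 = H" "reg s' 13 = (if \<exists>j<k. H k j \<noteq> 0 then 1 else reg s 13)"
          "reg s' 14 = 1"
          using agree_regD[OF ag] agree_arrD[OF ag] by (auto simp: H_def s1)
        show "eliminated r n P k s'"
        proof (cases "reg s 13 = 0")
          case True
          show ?thesis
          proof (cases "\<exists>j<k. H k j \<noteq> 0")
            case False
            then have "takes_neg r (Suc k) H \<longleftrightarrow> takes_neg r k H" "takes_nonpos r (Suc k) H"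
              using zero_row[OF sym[OF True] k(2) d] by auto
            moreover have "symmetric k H"
              using sym[OF True] by (auto simp: symmetric_def)
            ultimately show ?thesis
              using False True neg nonpos by (auto simp: eliminated_def s')
          next
            case t: True
            then have "takes_neg r n P"
              using takes_neg_zero_diagonal[OF sym[OF True] k(2) d] neg[OF True] by blast
            then show ?thesis using t by (simp add: eliminated_def s')
          qed
        qed (use pos in \<open>auto simp: eliminated_def s'\<close>)
      qed simp
    qed (auto simp: algebra_simps)
  qed auto
  then show ?thesis
    unfolding pivot_prog_def
  proof (rule computes_IfI[where T = "(k + 1) * ((k + 1) * 36) + 14", rotated])
    assume "bval s (RLess (Entry 5 (Reg 19) (Reg 19)) (Const 0))"
    then have d: "H k k < 0" using k by (simp add: H_def)
    have "takes_neg r n P"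
      using pos neg takes_neg_negative_diagonal[OF sym k(2) d] by blast
    then show "computes eig ec (SetReg 13 (Lit 1)) s ((k + 1) * ((k + 1) * 36) + 14) (eliminated r n P k)"
      by (intro computes_loopfree) (auto simp: eliminated_def)
  qed (auto simp: algebra_simps)
qed

lemma computes_eliminate:
  assumes n: "reg s 10 = n" "reg s 12 = n - r" "r \<le> n" and flags: "reg s 13 = 0" "reg s 14 = 0"
    and sym: "symmetric n (arr s 5)"
  shows "computes eig ec eliminate_prog s ((n + 1) * ((n + 1) * ((n + 1) * 80)))
    (eliminated r n (arr s 5) r)"
proof -
  let ?k = "SetReg 19 (NSub (NSub (Reg 10) (Lit 1)) (Reg 11))"
  let ?I = "\<lambda>x. eliminated r n (arr s 5) (n - x)"
  have "computes eig ec eliminate_prog s ((n - r + 1) * (1 + 6 + (n + 1) * ((n + 1) * 60) + 9)) (?I (n - r))"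
    unfolding eliminate_prog_def
  proof (rule computes_For[where I = ?I])
    show "?I 0 s" using flags sym by (simp add: eliminated_def)
    show "?I x (set_reg 11 v s')" if "?I x s'" for x v s'
      using that by (simp add: eliminated_def)
    fix x s'
    assume x: "x < n - r" and I: "?I x s'" and rx: "reg s' 11 = x"
      and ag: "agree (insert 11 (reg_writes (Seq ?k pivot_prog))) (arr_writes (Seq ?k pivot_prog)) s s'"
    have r: "reg s' 10 = n" using n agree_regD[OF ag] by auto
    let ?m = "n - Suc x"
    show "computes eig ec (Seq ?k pivot_prog) s' (1 + 6 + (n + 1) * ((n + 1) * 60)) (?I (Suc x))"
    proof (rule computes_step)
      fix s1 assume s1: "s1 = exec ?k s'"
      have "computes eig ec pivot_prog s1 ((?m + 1) * ((?m + 1) * 60)) (eliminated r n (arr s 5) ?m)"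
      proof (rule computes_pivot)
        have "Suc ?m = n - x" using x by simp
        then show "eliminated r n (arr s 5) (Suc ?m) s1"
          using I by (simp add: s1 eliminated_def)
      qed (use s1 r rx x in auto)
      then show "computes eig ec pivot_prog s1 ((n + 1) * ((n + 1) * 60)) (eliminated r n (arr s 5) ?m)"
        by (rule computes_mono) (intro mult_le_mono; simp)
    qed auto
  qed (use n in auto)
  moreover have "(n - r + 1) * (1 + 6 + (n + 1) * ((n + 1) * 60) + 9) \<le> (n + 1) * ((n + 1) * ((n + 1) * 80))"
    by (rule mult_le_mono) (simp_all add: algebra_simps)
  ultimately show ?thesis
    using n(3) by (auto elim: computes_mono)
qed


section \<open>The program for the enumeration of faces\<close>

text \<open>For \<open>N < 2^r\<close> this is \<open>2^i * N\<close> modulo \<open>2^r\<close>,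
  that is, \<open>N\<close> with its \<open>i\<close> leading binary digits shifted out. It needs
  only doubling, comparison and subtraction, which the registers provide.\<close>

primrec residue :: "nat \<Rightarrow> nat \<Rightarrow> nat \<Rightarrow> nat" where
  "residue r N 0 = N"
| "residue r N (Suc i) =
     (if 2 * residue r N i < 2 ^ r then 2 * residue r N i else 2 * residue r N i - 2 ^ r)"

text \<open>Index \<open>i\<close> belongs to the set if the digit of weight
  \<open>2^(r - 1 - i)\<close> is 1, which shows as an overflow in the next doubling.\<close>

definition coded_set :: "nat \<Rightarrow> nat \<Rightarrow> nat set" where
  "coded_set r N = {i. i < r \<and> \<not> 2 * residue r N i < 2 ^ r}"

lemma coded_set_surj:
  assumes I: "I \<subseteq> {..<r}"
  shows "\<exists>N<2 ^ r. coded_set r N = I"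
proof -
  \<comment> \<open>\<open>S 0\<close> is the number whose digits describe \<open>I\<close>, leading
    digit first, and \<open>S i\<close> is what remains of it after \<open>i\<close>
    doublings.\<close>
  define S :: "nat \<Rightarrow> nat" where "S i = (\<Sum>j\<in>I \<inter> {i..<r}. 2 ^ (r - 1 - j + i))" for i
  have lt: "S i < 2 ^ r" for i
  proof -
    have "inj_on (\<lambda>j. r - 1 - j + i) (I \<inter> {i..<r})"
      by (auto simp: inj_on_def)
    from sum.reindex[OF this, of "(^) 2"]
    have "S i = sum ((^) 2) ((\<lambda>j. r - 1 - j + i) ` (I \<inter> {i..<r}))"
      unfolding S_def o_def by (rule sym)
    also have "\<dots> \<le> sum ((^) 2) {0..<r}"
      by (rule sum_mono2) auto
    also have "\<dots> < 2 ^ r"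
      by (simp add: sum_power2)
    finally show ?thesis .
  qed
  \<comment> \<open>Doubling moves the leading digit, which is 1 exactly if \<open>i\<close> is in
    \<open>I\<close>, to weight \<open>2^r\<close>.\<close>
  have rec: "2 * S i = (if i \<in> I then 2 ^ r else 0) + S (Suc i)" if i: "i < r" for i
  proof -
    have split: "I \<inter> {i..<r} = (I \<inter> {i}) \<union> (I \<inter> {Suc i..<r})"
      using i by auto
    have "2 * S i = (\<Sum>j\<in>I \<inter> {i..<r}. 2 ^ (r - 1 - j + Suc i))"
      by (simp add: S_def sum_distrib_left)
    also have "\<dots> = (\<Sum>j\<in>I \<inter> {i}. 2 ^ (r - 1 - j + Suc i)) + S (Suc i)"
      unfolding split S_def by (rule sum.union_disjoint) auto
    also have "(\<Sum>j\<in>I \<inter> {i}. 2 ^ (r - 1 - j + Suc i)) = (if i \<in> I then 2 ^ r else (0 :: nat))"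
      using i by auto
    finally show ?thesis .
  qed
  have res: "residue r (S 0) i = S i" if "i \<le> r" for i
    using that
  proof (induction i)
    case (Suc i)
    then show ?case
      using rec[of i] lt[of "Suc i"] by auto
  qed simp
  have "i \<in> coded_set r (S 0) \<longleftrightarrow> i \<in> I" if "i < r" for i
    using that res[of i] rec[of i] lt[of "Suc i"] by (auto simp: coded_set_def)
  moreover have "coded_set r (S 0) \<subseteq> {..<r}"
    by (auto simp: coded_set_def)
  ultimately have "coded_set r (S 0) = I"
    using I by (meson lessThan_iff subset_antisym subset_iff)
  then show ?thesis using lt by blast
qed

section \<open>The candidate of a single face\<close>

definition decode_prog :: com where
  "decode_prog = Seq (SetReg 17 (Reg 16)) (For 9 2
     (Seq (SetReg 17 (NAdd (Reg 17) (Reg 17)))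
       (If (NLess (Reg 17) (Reg 15)) (SetEntry 6 (Lit 0) (Reg 9) (Const 0))
         (Seq (SetEntry 6 (Lit 0) (Reg 9) (Const 1)) (SetReg 17 (NSub (Reg 17) (Reg 15)))))))"

text \<open>The indicator of the face, stored in array 6, also supplies the border of the KKT
  matrix. An identity block is put below, as for the constraints.\<close>

definition kkt_prog :: com where
  "kkt_prog = For 9 4 (For 8 5 (If (NLess (Reg 9) (Reg 3))
     (If (Conj (NLess (Reg 9) (Reg 2)) (NLess (Reg 8) (Reg 2)))
       (If (Conj (RLess (Const 0) (Entry 6 (Lit 0) (Reg 9))) (RLess (Const 0) (Entry 6 (Lit 0) (Reg 8))))
         (SetEntry 3 (Reg 9) (Reg 8) (Entry 5 (Reg 9) (Reg 8)))
         (If (NEq (Reg 9) (Reg 8)) (SetEntry 3 (Reg 9) (Reg 8) (Const 1))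
           (SetEntry 3 (Reg 9) (Reg 8) (Const 0))))
       (If (NLess (Reg 9) (Reg 2)) (SetEntry 3 (Reg 9) (Reg 8) (Entry 6 (Lit 0) (Reg 9)))
         (If (NLess (Reg 8) (Reg 2)) (SetEntry 3 (Reg 9) (Reg 8) (Entry 6 (Lit 0) (Reg 8)))
           (SetEntry 3 (Reg 9) (Reg 8) (Const 0)))))
     (If (NEq (Reg 9) (NAdd (Reg 3) (Reg 8))) (SetEntry 3 (Reg 9) (Reg 8) (Const 1))
       (SetEntry 3 (Reg 9) (Reg 8) (Const 0)))))"

text \<open>Column \<open>r\<close> of the lower block. For a nonsingular matrix it solves the KKT
  system whose right-hand side is the unit vector at the sum condition.\<close>

abbreviation candidate_entry :: "nat \<Rightarrow> rexp" where
  "candidate_entry x \<equiv> Entry 3 (NAdd (Reg 3) (Reg x)) (Reg 2)"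

definition value_prog :: com where
  "value_prog = For 9 2
    (Seq (If (RLess (candidate_entry 9) (Const 0)) (SetReg 18 (Lit 0)) Skip)
    (Seq (SetEntry 7 (Lit 0) (Lit 2) (RAdd (Entry 7 (Lit 0) (Lit 2)) (candidate_entry 9)))
      (For 8 2 (SetEntry 7 (Lit 0) (Lit 1) (RAdd (Entry 7 (Lit 0) (Lit 1))
        (RMul (RMul (candidate_entry 9) (Entry 5 (Reg 9) (Reg 8))) (candidate_entry 8)))))))"

definition check_prog :: com where
  "check_prog = Seq (SetReg 18 (Lit 1)) (Seq (SetEntry 7 (Lit 0) (Lit 1) (Const 0))
    (Seq (SetEntry 7 (Lit 0) (Lit 2) (Const 0)) (Seq value_prog
      (If (Conj (NLess (Lit 0) (Reg 18)) (Conj (RLess (Const 0) (Entry 7 (Lit 0) (Lit 2)))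
          (Neg (RLess (Const 0) (Entry 7 (Lit 0) (Lit 1))))))
        (Seq (SetReg 14 (Lit 1))
          (If (RLess (Entry 7 (Lit 0) (Lit 1)) (Const 0)) (SetReg 13 (Lit 1)) Skip))
        Skip))))"

definition face_prog :: com where
  "face_prog = Seq decode_prog (Seq kkt_prog (Seq reduce_prog check_prog))"

text \<open>Register 15 becomes \<open>2^r\<close> by repeated doubling. Registers 3, 4 and 5 are
  reset to the shape of the stacked KKT system, so that \<open>reduce_prog\<close> can be reused
  unchanged.\<close>

definition enumerate_prog :: com where
  "enumerate_prog = Seq (SetReg 15 (Lit 1)) (Seq (For 16 2 (SetReg 15 (NAdd (Reg 15) (Reg 15))))
    (Seq (Seq (SetReg 3 (NAdd (Reg 2) (Lit 1))) (Seq (SetReg 4 (NAdd (Reg 3) (Reg 3)))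
      (SetReg 5 (Reg 3)))) (For 16 15 face_prog)))"

lemma writes_enumerate [simp]:
  "reg_writes decode_prog = {9, 17}" "arr_writes decode_prog = {6}"
  "reg_writes kkt_prog = {8, 9}" "arr_writes kkt_prog = {3}"
  "reg_writes value_prog = {8, 9, 18}" "arr_writes value_prog = {7}"
  "reg_writes check_prog = {8, 9, 13, 14, 18}" "arr_writes check_prog = {7}"
  "reg_writes face_prog = {6, 7, 8, 9, 13, 14, 17, 18}" "arr_writes face_prog = {3, 6, 7}"
  by (auto simp: decode_prog_def kkt_prog_def value_prog_def check_prog_def face_prog_def)

lemma computes_decode:
  assumes "reg s 2 = r" "reg s 15 = 2 ^ r" "reg s 16 = N"
  shows "computes eig ec decode_prog s ((r + 1) * 50)
    (\<lambda>s'. \<forall>i<r. arr s' 6 0 i = (if i \<in> coded_set r N then 1 else 0))"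
proof -
  let ?c = "Seq (SetReg 17 (NAdd (Reg 17) (Reg 17)))
       (If (NLess (Reg 17) (Reg 15)) (SetEntry 6 (Lit 0) (Reg 9) (Const 0))
         (Seq (SetEntry 6 (Lit 0) (Reg 9) (Const 1)) (SetReg 17 (NSub (Reg 17) (Reg 15)))))"
  let ?I = "\<lambda>i s'. reg s' 17 = residue r N i \<and>
    (\<forall>j<i. arr s' 6 0 j = (if j \<in> coded_set r N then 1 else 0))"
  have "computes eig ec decode_prog s (1 + 2 + (r + 1) * (30 + 9)) (?I r)"
    unfolding decode_prog_def
  proof (rule computes_step)
    fix s1 assume s1: "s1 = exec (SetReg 17 (Reg 16)) s"
    show "computes eig ec (For 9 2 ?c) s1 ((r + 1) * (30 + 9)) (?I r)"
    proof (rule computes_For[where I = ?I])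
      fix i s'
      assume i: "i < r" and I: "?I i s'" and ri: "reg s' 9 = i"
        and ag: "agree (insert 9 (reg_writes ?c)) (arr_writes ?c) s1 s'"
      have "reg s' 15 = 2 ^ r"
        using assms agree_regD[OF ag] by (auto simp: s1)
      then show "computes eig ec ?c s' 30 (?I (Suc i))"
        using i I ri by (intro computes_loopfree)
          (auto simp: less_Suc_eq coded_set_def mult_2[symmetric])
    qed (use assms in \<open>auto simp: s1\<close>)
  qed auto
  then show ?thesis
    by (rule computes_mono) simp_all
qed

lemma computes_kkt:
  assumes r: "reg s 2 = r" "reg s 3 = Suc r" "reg s 4 = 2 * Suc r" "reg s 5 = Suc r"
    and bits: "\<And>i. i < r \<Longrightarrow> arr s 6 0 i = (if i \<in> I then 1 else 0)"
  shows "computes eig ec kkt_prog s ((2 * r + 3) * ((r + 2) * 170)) (\<lambda>s'.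
    \<forall>i<Suc r. \<forall>j<Suc r. arr s' 3 i j = kkt r (arr s 5) I i j \<and>
      arr s' 3 (Suc r + i) j = (if i = j then 1 else 0))"
proof -
  let ?f = "\<lambda>i j. if i < Suc r then kkt r (arr s 5) I i j else if i = Suc r + j then 1 else 0"
  have "computes eig ec kkt_prog s ((2 * Suc r + 1) * ((Suc r + 1) * (150 + 9) + 9))
    (\<lambda>s'. arr s' 3 = (\<lambda>i j. if i < 2 * Suc r \<and> j < Suc r then ?f i j else arr s 3 i j))"
    unfolding kkt_prog_def
  proof (rule computes_fill)
    fix a b s'
    let ?c = "If (NLess (Reg 9) (Reg 3))
     (If (Conj (NLess (Reg 9) (Reg 2)) (NLess (Reg 8) (Reg 2)))
       (If (Conj (RLess (Const 0) (Entry 6 (Lit 0) (Reg 9))) (RLess (Const 0) (Entry 6 (Lit 0) (Reg 8))))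
         (SetEntry 3 (Reg 9) (Reg 8) (Entry 5 (Reg 9) (Reg 8)))
         (If (NEq (Reg 9) (Reg 8)) (SetEntry 3 (Reg 9) (Reg 8) (Const 1))
           (SetEntry 3 (Reg 9) (Reg 8) (Const 0))))
       (If (NLess (Reg 9) (Reg 2)) (SetEntry 3 (Reg 9) (Reg 8) (Entry 6 (Lit 0) (Reg 9)))
         (If (NLess (Reg 8) (Reg 2)) (SetEntry 3 (Reg 9) (Reg 8) (Entry 6 (Lit 0) (Reg 8)))
           (SetEntry 3 (Reg 9) (Reg 8) (Const 0)))))
     (If (NEq (Reg 9) (NAdd (Reg 3) (Reg 8))) (SetEntry 3 (Reg 9) (Reg 8) (Const 1))
       (SetEntry 3 (Reg 9) (Reg 8) (Const 0)))"
    assume r': "reg s' 9 = a" "reg s' 8 = b"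
      and ag: "agree ({9, 8} \<union> reg_writes ?c) (arr_writes ?c) s s'"
    have s': "reg s' 2 = r" "reg s' 3 = Suc r" "arr s' 5 = arr s 5" "arr s' 6 = arr s 6"
      using r agree_regD[OF ag] agree_arrD[OF ag] by auto
    have "exec ?c s' = set_entry 3 a b (?f a b) s'"
      by (simp add: r' s' bits kkt_def)
    then show "computes eig ec ?c s' 150 (\<lambda>s''. arr s'' 3 = (arr s' 3)(a := (arr s' 3 a)(b := ?f a b)))"
      by (intro computes_loopfree) auto
  qed (use r in auto)
  then show ?thesis
    by (rule computes_mono) (simp_all add: algebra_simps)
qed

lemma computes_value:
  fixes r :: nat
  assumes r: "reg s 2 = r" "reg s 3 = n" and 0: "reg s 18 = 1" "arr s 7 0 1 = 0" "arr s 7 0 2 = 0"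
  defines "y \<equiv> \<lambda>i. arr s 3 (n + i) r"
  shows "computes eig ec value_prog s ((r + 1) * ((r + 1) * 80)) (\<lambda>s'.
    (reg s' 18 \<noteq> 0 \<longleftrightarrow> (\<forall>i<r. 0 \<le> y i)) \<and> arr s' 7 0 1 = qform r (arr s 5) y \<and>
    arr s' 7 0 2 = sum y {..<r})"
proof -
  let ?t = "If (RLess (candidate_entry 9) (Const 0)) (SetReg 18 (Lit 0)) Skip"
  let ?u = "SetEntry 7 (Lit 0) (Lit 2) (RAdd (Entry 7 (Lit 0) (Lit 2)) (candidate_entry 9))"
  let ?v = "SetEntry 7 (Lit 0) (Lit 1) (RAdd (Entry 7 (Lit 0) (Lit 1))
        (RMul (RMul (candidate_entry 9) (Entry 5 (Reg 9) (Reg 8))) (candidate_entry 8)))"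
  let ?c = "Seq ?t (Seq ?u (For 8 2 ?v))"
  let ?I = "\<lambda>i s'. (reg s' 18 \<noteq> 0 \<longleftrightarrow> (\<forall>j<i. 0 \<le> y j)) \<and>
    arr s' 7 0 1 = (\<Sum>a<i. \<Sum>b<r. y a * arr s 5 a b * y b) \<and> arr s' 7 0 2 = sum y {..<i}"
  have "computes eig ec (For 9 2 ?c) s ((r + 1) * (1 + 12 + (1 + 13 + (r + 1) * (25 + 9)) + 9)) (?I r)"
  proof (rule computes_For[where I = ?I])
    show "?I 0 s" using 0 by simp
    fix i s'
    assume i: "i < r" and I: "?I i s'" and ri: "reg s' 9 = i"
      and ag: "agree (insert 9 (reg_writes ?c)) (arr_writes ?c) s s'"
    have s': "reg s' 2 = r" "reg s' 3 = n" "arr s' 3 = arr s 3" "arr s' 5 = arr s 5"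
      using r agree_regD[OF ag] agree_arrD[OF ag] by auto
    show "computes eig ec ?c s' (1 + 12 + (1 + 13 + (r + 1) * (25 + 9))) (?I (Suc i))"
    proof (rule computes_step)
      fix s1 assume s1: "s1 = exec ?t s'"
      show "computes eig ec (Seq ?u (For 8 2 ?v)) s1 (1 + 13 + (r + 1) * (25 + 9)) (?I (Suc i))"
      proof (rule computes_step)
        fix s2 assume s2: "s2 = exec ?u s1"
        have r2: "reg s2 2 = r" "reg s2 3 = n" "reg s2 9 = i" "arr s2 3 = arr s 3" "arr s2 5 = arr s 5"
          and I2: "reg s2 18 \<noteq> 0 \<longleftrightarrow> (\<forall>j<Suc i. 0 \<le> y j)" "arr s2 7 0 2 = sum y {..<Suc i}"
            "arr s2 7 0 1 = (\<Sum>a<i. \<Sum>b<r. y a * arr s 5 a b * y b)"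
          using I s' ri by (auto simp: s2 s1 y_def less_Suc_eq)
        let ?J = "\<lambda>j s'. (reg s' 18 \<noteq> 0 \<longleftrightarrow> (\<forall>j<Suc i. 0 \<le> y j)) \<and>
            arr s' 7 0 1 = (\<Sum>a<i. \<Sum>b<r. y a * arr s 5 a b * y b) + (\<Sum>b<j. y i * arr s 5 i b * y b) \<and>
            arr s' 7 0 2 = sum y {..<Suc i}"
        have "computes eig ec (For 8 2 ?v) s2 ((r + 1) * (25 + 9)) (?J r)"
        proof (rule computes_For[where I = ?J])
          show "?J 0 s2" using I2 by simp
          fix j s3
          assume J: "?J j s3" and j: "reg s3 8 = j"
            and ag3: "agree (insert 8 (reg_writes ?v)) (arr_writes ?v) s2 s3"
          have "reg s3 2 = r" "reg s3 3 = n" "reg s3 9 = i" "arr s3 3 = arr s 3" "arr s3 5 = arr s 5"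
            using r2 agree_regD[OF ag3] agree_arrD[OF ag3] by auto
          then show "computes eig ec ?v s3 25 (?J (Suc j))"
            using J j by (intro computes_loopfree) (auto simp: y_def)
        qed (use r2 in auto)
        then show "computes eig ec (For 8 2 ?v) s2 ((r + 1) * (25 + 9)) (?I (Suc i))"
          by (rule computes_mono) simp_all
      qed auto
    qed auto
  qed (use r in auto)
  then show ?thesis
    unfolding value_prog_def by (rule computes_mono) (simp_all add: qform_def algebra_simps)
qed

text \<open>A positive sum is demanded instead of sum 1: a nonzero nonnegative vector is all that a
  certificate requires, wherever it comes from.\<close>

lemma computes_check:
  fixes r :: nat
  assumes r: "reg s 2 = r" "reg s 3 = n"
  defines "y \<equiv> \<lambda>i. arr s 3 (n + i) r"
  defines "accept \<equiv> (\<forall>i<r. 0 \<le> y i) \<and> 0 < sum y {..<r} \<and> qform r (arr s 5) y \<le> 0"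
  shows "computes eig ec check_prog s ((r + 1) * ((r + 1) * 160)) (\<lambda>s'.
    reg s' 14 = (if accept then 1 else reg s 14) \<and>
    reg s' 13 = (if accept \<and> qform r (arr s 5) y < 0 then 1 else reg s 13))"
    (is "computes _ _ _ _ _ ?post")
proof -
  let ?i = "SetReg 18 (Lit 1)" and ?j = "SetEntry 7 (Lit 0) (Lit 1) (Const 0)"
    and ?k = "SetEntry 7 (Lit 0) (Lit 2) (Const 0)"
  let ?f = "If (Conj (NLess (Lit 0) (Reg 18)) (Conj (RLess (Const 0) (Entry 7 (Lit 0) (Lit 2)))
          (Neg (RLess (Const 0) (Entry 7 (Lit 0) (Lit 1))))))
        (Seq (SetReg 14 (Lit 1))
          (If (RLess (Entry 7 (Lit 0) (Lit 1)) (Const 0)) (SetReg 13 (Lit 1)) Skip))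
        Skip"
  let ?V = "(r + 1) * ((r + 1) * 80)"
  have "computes eig ec check_prog s (1 + 2 + (1 + 4 + (1 + 4 + (1 + ?V + 40)))) ?post"
    unfolding check_prog_def
  proof (rule computes_step)
    fix s1 assume s1: "s1 = exec ?i s"
    show "computes eig ec (Seq ?j (Seq ?k (Seq value_prog ?f))) s1
      (1 + 4 + (1 + 4 + (1 + ?V + 40))) ?post"
    proof (rule computes_step)
      fix s2 assume s2: "s2 = exec ?j s1"
      show "computes eig ec (Seq ?k (Seq value_prog ?f)) s2 (1 + 4 + (1 + ?V + 40)) ?post"
      proof (rule computes_step)
        fix s3 assume s3: "s3 = exec ?k s2"
        have y3: "(\<lambda>i. arr s3 3 (n + i) r) = y" "arr s3 5 = arr s 5"
          by (auto simp: s1 s2 s3 y_def)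
        have "computes eig ec value_prog s3 ?V (\<lambda>s'.
          (reg s' 18 \<noteq> 0 \<longleftrightarrow> (\<forall>i<r. 0 \<le> y i)) \<and> arr s' 7 0 1 = qform r (arr s 5) y \<and>
          arr s' 7 0 2 = sum y {..<r})"
          using computes_value[of s3 r n eig ec, unfolded y3] r by (simp add: s1 s2 s3 y_def)
        then show "computes eig ec (Seq value_prog ?f) s3 (1 + ?V + 40) ?post"
        proof (rule computes_SeqI)
          fix s4 assume v: "(reg s4 18 \<noteq> 0 \<longleftrightarrow> (\<forall>i<r. 0 \<le> y i)) \<and>
              arr s4 7 0 1 = qform r (arr s 5) y \<and> arr s4 7 0 2 = sum y {..<r}"
            and ag: "agree (reg_writes value_prog) (arr_writes value_prog) s3 s4"
          have "reg s4 13 = reg s 13" "reg s4 14 = reg s 14"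
            using agree_regD[OF ag] by (auto simp: s1 s2 s3)
          then show "computes eig ec ?f s4 40 ?post"
            using v by (intro computes_loopfree) (auto simp: accept_def not_less)
        qed simp
      qed auto
    qed auto
  qed auto
  then show ?thesis
    by (rule computes_mono) (simp_all add: algebra_simps)
qed

definition solves_kkt :: "nat \<Rightarrow> (nat \<Rightarrow> nat \<Rightarrow> real) \<Rightarrow> nat set \<Rightarrow> (nat \<Rightarrow> real) \<Rightarrow> bool" where
  "solves_kkt r P I w \<longleftrightarrow> nonsingular (Suc r) (kkt r P I) \<and>
     (\<forall>i<Suc r. lin (Suc r) (kkt r P I i) w = (if i = r then 1 else 0))"

text \<open>The first two conjuncts are soundness and hold even if the elimination produced
  nonsense. The last one is completeness and speaks only of faces with a nonsingular KKT
  matrix.\<close>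

lemma computes_face:
  assumes r: "reg s 2 = r" "reg s 3 = Suc r" "reg s 4 = 2 * Suc r" "reg s 5 = Suc r"
    and N: "reg s 15 = 2 ^ r" "reg s 16 = N"
  defines "P \<equiv> arr s 5"
  shows "computes eig ec face_prog s ((r + 1) ^ 3 * 4000) (\<lambda>s'.
    (reg s' 14 = reg s 14 \<or> reg s' 14 = 1 \<and> takes_nonpos r r P) \<and>
    (reg s' 13 = reg s 13 \<or> reg s' 13 = 1 \<and> takes_neg r r P) \<and>
    (\<forall>w. symmetric r P \<and> solves_kkt r P (coded_set r N) w \<and> w \<in> simplex r \<and> qform r P w \<le> 0 \<longrightarrow>
      reg s' 14 = 1 \<and> (qform r P w < 0 \<longrightarrow> reg s' 13 = 1)))"
    (is "computes _ _ _ _ _ ?post")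
proof -
  let ?I = "coded_set r N"
  let ?n = "Suc r"
  let ?K = "(2 * r + 3) * ((r + 2) * 170)" and ?V = "(r + 1) * ((r + 1) * 160)"
    and ?E = "(?n + 1) * ((?n + 1) * (2 * ?n + 1) * 130)"
  have "computes eig ec face_prog s (1 + (r + 1) * 50 + (1 + ?K + (1 + ?E + ?V))) ?post"
    unfolding face_prog_def
  proof (rule computes_SeqI[OF computes_decode[OF r(1) N]])
    fix s1 assume bits: "\<forall>i<r. arr s1 6 0 i = (if i \<in> coded_set r N then 1 else 0)"
      and ag1: "agree (reg_writes decode_prog) (arr_writes decode_prog) s s1"
    have s1: "reg s1 2 = r" "reg s1 3 = Suc r" "reg s1 4 = 2 * Suc r" "reg s1 5 = Suc r"
      "arr s1 5 = P" "reg s1 13 = reg s 13" "reg s1 14 = reg s 14"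
      using r agree_regD[OF ag1] agree_arrD[OF ag1] by (auto simp: P_def)
    show "computes eig ec (Seq kkt_prog (Seq reduce_prog check_prog)) s1
      (1 + ?K + (1 + ?E + ?V)) ?post"
    proof (rule computes_SeqI[OF computes_kkt[OF s1(1-4)]])
      show "arr s1 6 0 i = (if i \<in> ?I then 1 else 0)" if "i < r" for i
        using bits that by blast
      fix s2 assume kkt: "\<forall>i<?n. \<forall>j<?n. arr s2 3 i j = kkt r (arr s1 5) ?I i j \<and>
          arr s2 3 (?n + i) j = (if i = j then 1 else 0)"
        and ag2: "agree (reg_writes kkt_prog) (arr_writes kkt_prog) s1 s2"
      have s2: "reg s2 2 = r" "reg s2 3 = ?n" "reg s2 4 = 2 * ?n" "reg s2 5 = ?n"
        "arr s2 5 = P" "reg s2 13 = reg s 13" "reg s2 14 = reg s 14"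
        using s1 agree_regD[OF ag2] agree_arrD[OF ag2] by auto
      define G where "G = arr s2 3"
      have G: "G i j = kkt r P ?I i j" "G (?n + i) j = (if i = j then 1 else 0)"
        if "i < ?n" "j < ?n" for i j
        using kkt that by (auto simp: G_def s1)
      have linG: "lin ?n (G i) w = lin ?n (kkt r P ?I i) w" if "i < ?n" for i w
        by (rule lin_cong) (use G that in auto)
      show "computes eig ec (Seq reduce_prog check_prog) s2 (1 + ?E + ?V) ?post"
      proof (rule computes_SeqI[OF computes_reduce[OF s2(2-4)]])
        fix s3 assume red: "independent_rows ?n ?n (arr s2 3) \<longrightarrow>
            column_equiv (2 * ?n) ?n (arr s2 3) (arr s3 3) \<and>
            (\<forall>i<?n. \<forall>j<?n. arr s3 3 i j = (if i = j then 1 else 0))"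
          and ag3: "agree (reg_writes reduce_prog) (arr_writes reduce_prog) s2 s3"
        have s3: "reg s3 2 = r" "reg s3 3 = ?n" "arr s3 5 = P" "reg s3 13 = reg s 13" "reg s3 14 = reg s 14"
          using s2 agree_regD[OF ag3] agree_arrD[OF ag3] by auto
        define y where "y = (\<lambda>i. arr s3 3 (?n + i) r)"
        \<comment> \<open>Nonsingularity does two things: it makes the rows independent, so that the
          computed column is a solution, and it makes the solution unique, so that this column is
          \<open>w\<close>.\<close>
        have unique: "y i = w i" if sym: "symmetric r P" and w: "solves_kkt r P ?I w" and i: "i < ?n" for w i
        proof -
          have ns: "nonsingular ?n (kkt r P ?I)"
            and sol: "lin ?n (kkt r P ?I i) w = (if i = r then 1 else 0)" if "i < ?n" for i
            using w that by (auto simp: solves_kkt_def)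
          have "nonsingular ?n G"
            using ns linG by (auto simp: nonsingular_def)
          then have "independent_rows ?n ?n G"
          proof (rule nonsingular_independent)
            show "G i j = G j i" if "i < ?n" "j < ?n" for i j
              using G(1) that kkt_sym[OF sym] by metis
          qed
          then have "column_equiv (?n + ?n) ?n G (arr s3 3)"
            and unit: "\<And>i j. i < ?n \<Longrightarrow> j < ?n \<Longrightarrow> arr s3 3 i j = (if i = j then 1 else 0)"
            using red by (auto simp: G_def mult_2)
          from column_equiv_inverse[OF this(1) G(2) this(2), of r]
          have "lin ?n (G i) y = (if i = r then 1 else 0)" if "i < ?n" for i
            using that unfolding y_def by simp
          then have "lin ?n (kkt r P ?I i) y = lin ?n (kkt r P ?I i) w" if "i < ?n" for i
            using that sol linG by simp
          then show "y i = w i"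
            using nonsingular_unique[OF ns _ i, where x = y and w = w] by blast
        qed
        let ?acc = "(\<forall>i<r. 0 \<le> y i) \<and> 0 < sum y {..<r} \<and> qform r P y \<le> 0"
        have "computes eig ec check_prog s3 ?V (\<lambda>s'.
          reg s' 14 = (if ?acc then 1 else reg s 14) \<and>
          reg s' 13 = (if ?acc \<and> qform r P y < 0 then 1 else reg s 13))"
          using computes_check[OF s3(1,2), of eig ec] unfolding s3 y_def .
        then show "computes eig ec check_prog s3 ?V ?post"
        proof (rule computes_mono)
          fix s' :: memory assume s': "reg s' 14 = (if ?acc then 1 else reg s 14) \<and>
            reg s' 13 = (if ?acc \<and> qform r P y < 0 then 1 else reg s 13)"
          have np: "takes_nonpos r r P" if ?acc
          proof -
            have "\<exists>i<r. y i \<noteq> 0"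
            proof (rule ccontr)
              assume "\<not> ?thesis"
              then have "sum y {..<r} = 0" by simp
              then show False using that by simp
            qed
            then show ?thesis using that unfolding takes_nonpos_def by blast
          qed
          have ng: "takes_neg r r P" if "?acc \<and> qform r P y < 0"
            using that unfolding takes_neg_def by blast
          have cand: "?acc \<and> qform r P y = qform r P w"
            if "symmetric r P" "solves_kkt r P ?I w" "w \<in> simplex r" "qform r P w \<le> 0" for w
          proof -
            have yw: "y i = w i" if "i < r" for i
              using unique \<open>symmetric r P\<close> \<open>solves_kkt r P ?I w\<close> that by simp
            have "sum y {..<r} = sum w {..<r}"
              by (rule sum.cong) (auto simp: yw)
            moreover have "qform r P y = qform r P w"
              by (rule qform_cong) (auto simp: yw)
            ultimately show ?thesis
              using that(3,4) yw by (auto simp: simplex_def)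
          qed
          show "?post s'"
          proof (intro conjI allI impI)
            show "reg s' 14 = reg s 14 \<or> reg s' 14 = 1 \<and> takes_nonpos r r P"
              using s' np by (cases ?acc) simp_all
            show "reg s' 13 = reg s 13 \<or> reg s' 13 = 1 \<and> takes_neg r r P"
              using s' ng by (cases "?acc \<and> qform r P y < 0") simp_all
          next
            fix w
            assume "symmetric r P \<and> solves_kkt r P ?I w \<and> w \<in> simplex r \<and> qform r P w \<le> 0"
            then have c: "?acc \<and> qform r P y = qform r P w" using cand by blast
            then show "reg s' 14 = 1" using s' by simp
            show "reg s' 13 = 1" if "qform r P w < 0" using s' c that by simp
          qed
        qed simp
      qed simp_all
    qed simp
  qed simp
  moreover have "1 + (r + 1) * 50 + (1 + ?K + (1 + ?E + ?V)) \<le> (r + 1) ^ 3 * 4000"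
    by (simp add: power3_eq_cube algebra_simps)
  ultimately show ?thesis
    by (rule computes_mono)
qed

text \<open>Flags may be set on entry and are never cleared. Symmetry is a premise of completeness
  only, because nothing is known about the array if the elimination has already found a negative
  value.\<close>

lemma computes_enumerate:
  assumes r: "reg s 2 = r"
  defines "P \<equiv> arr s 5"
  shows "computes eig ec enumerate_prog s ((2 ^ r + 1) * ((r + 1) ^ 3 * 4100)) (\<lambda>s'.
    (reg s 13 \<noteq> 0 \<longrightarrow> reg s' 13 \<noteq> 0) \<and> (reg s 14 \<noteq> 0 \<longrightarrow> reg s' 14 \<noteq> 0) \<and>
    (reg s' 13 \<noteq> 0 \<longrightarrow> reg s 13 \<noteq> 0 \<or> takes_neg r r P) \<and>
    (reg s' 14 \<noteq> 0 \<longrightarrow> reg s 14 \<noteq> 0 \<or> takes_nonpos r r P) \<and>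
    (symmetric r P \<longrightarrow> (takes_neg r r P \<longrightarrow> reg s' 13 \<noteq> 0) \<and> (takes_nonpos r r P \<longrightarrow> reg s' 14 \<noteq> 0)))"
    (is "computes _ _ _ _ _ ?post")
proof -
  let ?d = "SetReg 15 (NAdd (Reg 15) (Reg 15))"
  let ?m = "Seq (SetReg 3 (NAdd (Reg 2) (Lit 1))) (Seq (SetReg 4 (NAdd (Reg 3) (Reg 3))) (SetReg 5 (Reg 3)))"
  let ?l = "For 16 15 face_prog"
  let ?L = "(2 ^ r + 1) * ((r + 1) ^ 3 * 4000 + 9)"
  have "computes eig ec enumerate_prog s (1 + 2 + (1 + (r + 1) * (4 + 9) + (1 + 20 + ?L))) ?post"
    unfolding enumerate_prog_def
  proof (rule computes_step)
    fix s1 assume s1: "s1 = exec (SetReg 15 (Lit 1)) s"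
    have "computes eig ec (For 16 2 ?d) s1 ((r + 1) * (4 + 9)) (\<lambda>s'. reg s' 15 = 2 ^ r)"
    proof (rule computes_For[where I = "\<lambda>i s'. reg s' 15 = 2 ^ i"])
      fix i and s' :: memory assume "reg s' 15 = 2 ^ i"
      then show "computes eig ec ?d s' 4 (\<lambda>s'. reg s' 15 = 2 ^ Suc i)"
        by (intro computes_loopfree) auto
    qed (use r s1 in auto)
    then show "computes eig ec (Seq (For 16 2 ?d) (Seq ?m ?l)) s1
      (1 + (r + 1) * (4 + 9) + (1 + 20 + ?L)) ?post"
    proof (rule computes_SeqI)
      fix s2 assume s2: "reg s2 15 = 2 ^ r"
        and ag2: "agree (reg_writes (For 16 2 ?d)) (arr_writes (For 16 2 ?d)) s1 s2"
      have r2: "reg s2 2 = r" "reg s2 13 = reg s 13" "reg s2 14 = reg s 14" "arr s2 5 = P"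
        using r s1 agree_regD[OF ag2] agree_arrD[OF ag2] by (auto simp: P_def)
      show "computes eig ec (Seq ?m ?l) s2 (1 + 20 + ?L) ?post"
      proof (rule computes_step)
        fix s3 assume s3: "s3 = exec ?m s2"
        have r3: "reg s3 2 = r" "reg s3 13 = reg s 13" "reg s3 14 = reg s 14" "arr s3 5 = P"
          "reg s3 3 = Suc r" "reg s3 4 = 2 * Suc r" "reg s3 5 = Suc r" "reg s3 15 = 2 ^ r"
          using r2 s2 by (auto simp: s3)
        let ?J = "\<lambda>N s'.
          (reg s 13 \<noteq> 0 \<longrightarrow> reg s' 13 \<noteq> 0) \<and> (reg s 14 \<noteq> 0 \<longrightarrow> reg s' 14 \<noteq> 0) \<and>
          (reg s' 13 \<noteq> 0 \<longrightarrow> reg s 13 \<noteq> 0 \<or> takes_neg r r P) \<and>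
          (reg s' 14 \<noteq> 0 \<longrightarrow> reg s 14 \<noteq> 0 \<or> takes_nonpos r r P) \<and>
          (\<forall>M<N. \<forall>w. symmetric r P \<and> solves_kkt r P (coded_set r M) w \<and> w \<in> simplex r \<and>
            qform r P w \<le> 0 \<longrightarrow> reg s' 14 \<noteq> 0 \<and> (qform r P w < 0 \<longrightarrow> reg s' 13 \<noteq> 0))"
        have "computes eig ec ?l s3 ?L (?J (2 ^ r))"
        proof (rule computes_For[where I = ?J])
          fix N s4
          assume J: "?J N s4" and N: "reg s4 16 = N"
            and ag4: "agree (insert 16 (reg_writes face_prog)) (arr_writes face_prog) s3 s4"
          have r4: "reg s4 2 = r" "reg s4 3 = Suc r" "reg s4 4 = 2 * Suc r" "reg s4 5 = Suc r"
            "reg s4 15 = 2 ^ r" "arr s4 5 = P"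
            using r3 agree_regD[OF ag4] agree_arrD[OF ag4] by auto
          show "computes eig ec face_prog s4 ((r + 1) ^ 3 * 4000) (?J (Suc N))"
          proof (rule computes_mono[OF computes_face[OF r4(1-5) N, of eig ec, unfolded r4(6)] order_refl])
            fix s5
            assume *: "(reg s5 14 = reg s4 14 \<or> reg s5 14 = 1 \<and> takes_nonpos r r P) \<and>
              (reg s5 13 = reg s4 13 \<or> reg s5 13 = 1 \<and> takes_neg r r P) \<and>
              (\<forall>w. symmetric r P \<and> solves_kkt r P (coded_set r N) w \<and> w \<in> simplex r \<and>
                qform r P w \<le> 0 \<longrightarrow> reg s5 14 = 1 \<and> (qform r P w < 0 \<longrightarrow> reg s5 13 = 1))"
            then have keep: "reg s4 13 \<noteq> 0 \<Longrightarrow> reg s5 13 \<noteq> 0" "reg s4 14 \<noteq> 0 \<Longrightarrow> reg s5 14 \<noteq> 0"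
              by auto
            have "reg s5 14 \<noteq> 0 \<and> (qform r P w < 0 \<longrightarrow> reg s5 13 \<noteq> 0)"
              if "M < Suc N" and w: "symmetric r P" "solves_kkt r P (coded_set r M) w" "w \<in> simplex r"
                "qform r P w \<le> 0" for M w
            proof (cases "M = N")
              case True
              then show ?thesis using * w by fastforce
            next
              case False
              then have "M < N" using that by simp
              then show ?thesis using J w keep by blast
            qed
            then have "\<forall>M<Suc N. \<forall>w. symmetric r P \<and> solves_kkt r P (coded_set r M) w \<and>
                w \<in> simplex r \<and> qform r P w \<le> 0 \<longrightarrow>
                reg s5 14 \<noteq> 0 \<and> (qform r P w < 0 \<longrightarrow> reg s5 13 \<noteq> 0)"
              by blast
            moreover have "reg s 13 \<noteq> 0 \<longrightarrow> reg s5 13 \<noteq> 0" "reg s 14 \<noteq> 0 \<longrightarrow> reg s5 14 \<noteq> 0"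
              using J keep by simp_all
            moreover have "reg s5 13 \<noteq> 0 \<longrightarrow> reg s 13 \<noteq> 0 \<or> takes_neg r r P"
              using conjunct1[OF conjunct2[OF *]] conjunct1[OF conjunct2[OF conjunct2[OF J]]] by auto
            moreover have "reg s5 14 \<noteq> 0 \<longrightarrow> reg s 14 \<noteq> 0 \<or> takes_nonpos r r P"
              using conjunct1[OF *] conjunct1[OF conjunct2[OF conjunct2[OF conjunct2[OF J]]]] by auto
            ultimately show "?J (Suc N) s5"
              by (intro conjI)
          qed
        qed (use r3 in auto)
        then show "computes eig ec ?l s3 ?L ?post"
        proof (rule computes_mono)
          fix s' :: memory assume J: "?J (2 ^ r) s'"
          \<comment> \<open>The face of the minimiser with smallest support has a code below
            \<open>2^r\<close>, so some round examined it.\<close>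
          have "reg s' 14 \<noteq> 0 \<and> (takes_neg r r P \<longrightarrow> reg s' 13 \<noteq> 0)"
            if sym: "symmetric r P" and np: "takes_nonpos r r P"
          proof -
            obtain I w where w: "I \<subseteq> {..<r}" "solves_kkt r P I w" "w \<in> simplex r"
              "qform r P w \<le> 0" "takes_neg r r P \<longrightarrow> qform r P w < 0"
              using kkt_candidate_exists[OF sym np] unfolding solves_kkt_def by blast
            obtain N where "N < 2 ^ r" "coded_set r N = I"
              using coded_set_surj[OF w(1)] by blast
            then show ?thesis using J w sym by blast
          qed
          then show "?post s'"
            using J takes_neg_imp_nonpos by blast
        qed simp
      qed auto
    qed simp
  qed auto
  moreover have "1 + 2 + (1 + (r + 1) * (4 + 9) + (1 + 20 + ?L)) \<le> (2 ^ r + 1) * ((r + 1) ^ 3 * 4100)"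
  proof -
    have "25 + (r + 1) * 13 \<le> (r + 1) ^ 3 * 40"
      by (simp add: power3_eq_cube algebra_simps)
    also have "\<dots> \<le> (2 ^ r + 1) * ((r + 1) ^ 3 * 40)" by simp
    finally have *: "25 + (r + 1) * 13 \<le> (2 ^ r + 1) * ((r + 1) ^ 3 * 40)" .
    have L: "?L \<le> (2 ^ r + 1) * ((r + 1) ^ 3 * 4010)"
    proof (rule mult_le_mono2)
      have "1 \<le> (r + 1) ^ 3" by simp
      then show "(r + 1) ^ 3 * 4000 + 9 \<le> (r + 1) ^ 3 * 4010" by linarith
    qed
    have "1 + 2 + (1 + (r + 1) * (4 + 9) + (1 + 20 + ?L)) = (25 + (r + 1) * 13) + ?L"
      by simp
    also have "\<dots> \<le> (2 ^ r + 1) * ((r + 1) ^ 3 * 40) + (2 ^ r + 1) * ((r + 1) ^ 3 * 4010)"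
      by (rule add_mono[OF * L])
    also have "\<dots> \<le> (2 ^ r + 1) * ((r + 1) ^ 3 * 4100)"
      unfolding distrib_left[symmetric] by (rule mult_le_mono2) simp
    finally show ?thesis .
  qed
  ultimately show ?thesis
    by (rule computes_mono)
qed


section \<open>The complete program\<close>

definition setup_prog :: com where
  "setup_prog = Seq (SetReg 3 (NAdd (Reg 1) (Reg 2))) (Seq (SetReg 4 (NAdd (Reg 3) (Reg 0)))
    (Seq (SetReg 5 (Reg 0)) (Seq (SetReg 10 (NSub (Reg 0) (Reg 1)))
      (SetReg 12 (NSub (Reg 0) (Reg 3))))))"

definition output_prog :: com where
  "output_prog = If (NLess (Lit 0) (Reg 13)) (SetReg 0 (Lit 3))
     (If (NLess (Lit 0) (Reg 14)) (SetReg 0 (Lit 2)) (SetReg 0 (Lit 1)))"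

text \<open>The congruence is computed as two successive matrix products, which keeps it cubic; a
  double sum for each entry would be quartic.\<close>

definition half_product :: rexp where
  "half_product = RMul (Entry 0 (Reg 9) (Reg 20)) (Entry 3 (NAdd (Reg 3) (Reg 20)) (Reg 8))"

definition full_product :: rexp where
  "full_product = RMul (Entry 3 (NAdd (Reg 3) (Reg 20)) (NAdd (Reg 1) (Reg 9)))
     (Entry 4 (Reg 20) (NAdd (Reg 1) (Reg 8)))"

definition main_prog :: com where
  "main_prog = Seq setup_prog (Seq stack_prog (Seq reduce_prog
    (Seq (dot_prog 4 0 0 half_product) (Seq (dot_prog 5 10 10 full_product)
      (Seq eliminate_prog (Seq enumerate_prog output_prog))))))"

lemma writes_enumerate_prog [simp]:
  "reg_writes enumerate_prog = {3, 4, 5, 6, 7, 8, 9, 13, 14, 15, 16, 17, 18}"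
  "arr_writes enumerate_prog = {3, 6, 7}"
  by (auto simp: enumerate_prog_def)

lemma independent_rows_cong:
  assumes "independent_rows m n G" "m \<le> k" "\<And>i j. i < m \<Longrightarrow> j < n \<Longrightarrow> H i j = G i j"
  shows "independent_rows m n H"
proof -
  have "lin n (H i) w = lin n (G i) w" if "i < m" for i w
    by (rule lin_cong) (use assms that in auto)
  moreover from this have "(\<Sum>i<k. a i * lin n (H i) w) = (\<Sum>i<k. a i * lin n (G i) w)"
    if "k < m" for k a w
    using that by (intro sum.cong) auto
  ultimately show ?thesis
    using assms(1) unfolding independent_rows_def by metis
qed

lemma congruence_symmetric:
  assumes "symmetric p Q"
  shows "symmetric n (\<lambda>i j. \<Sum>a<p. T a i * (\<Sum>b<p. Q a b * T b j))"
  unfolding symmetric_def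
proof (intro allI impI)
  fix i j
  have "(\<Sum>a<p. T a i * (\<Sum>b<p. Q a b * T b j)) = (\<Sum>a<p. \<Sum>b<p. T a i * Q a b * T b j)"
    by (simp add: sum_distrib_left mult.assoc)
  also have "\<dots> = (\<Sum>b<p. \<Sum>a<p. T a i * Q a b * T b j)"
    by (rule sum.swap)
  also have "\<dots> = (\<Sum>b<p. \<Sum>a<p. T b j * (Q b a * T a i))"
  proof (intro sum.cong refl)
    fix a b assume "b \<in> {..<p}" "a \<in> {..<p}"
    then show "T a i * Q a b * T b j = T b j * (Q b a * T a i)"
      using symmetricD[OF assms, of a b] by simp
  qed
  finally show "(\<Sum>a<p. T a i * (\<Sum>b<p. Q a b * T b j)) = (\<Sum>a<p. T a j * (\<Sum>b<p. Q a b * T b i))"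
    by (simp add: sum_distrib_left)
qed

lemma computes_main:
  assumes dims: "reg s 0 = p" "reg s 1 = q" "reg s 2 = r" "q + r \<le> p"
    and flags: "reg s 13 = 0" "reg s 14 = 0" and sym: "symmetric p (arr s 0)"
    and ind: "independent_rows (q + r) p (\<lambda>i. if i < q then arr s 1 i else arr s 2 (i - q))"
  defines "S \<equiv> {\<eta>. (\<forall>i<q. lin p (arr s 1 i) \<eta> = 0) \<and> (\<forall>i<r. 0 \<le> lin p (arr s 2 i) \<eta>)}"
  shows "computes eig ec main_prog s ((p + 1) ^ 3 * 1000 + (2 ^ r + 1) * ((r + 1) ^ 3 * 4100)) (\<lambda>s'.
    reg s' 0 = (if \<exists>\<eta>\<in>S. qform p (arr s 0) \<eta> < 0 then 3
      else if \<exists>\<eta>\<in>S. (\<exists>i<p. \<eta> i \<noteq> 0) \<and> qform p (arr s 0) \<eta> \<le> 0 then 2 else 1))"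
    (is "computes _ _ _ _ _ ?post")
proof -
  define Q where "Q = arr s 0"
  define m where "m = q + r"
  define n where "n = p - q"
  let ?t1 = "(m + p + 1) * ((p + 1) * 80)"
  let ?t2 = "(m + 1) * ((p + 1) * (m + p + 1) * 130)"
  let ?t3 = "(p + 1) * ((p + 1) * ((p + 1) * (20 + 40)))"
  let ?t4 = "(n + 1) * ((n + 1) * ((p + 1) * (20 + 40)))"
  let ?t5 = "(n + 1) * ((n + 1) * ((n + 1) * 80))"
  let ?t6 = "(2 ^ r + 1) * ((r + 1) ^ 3 * 4100)"
  let ?u5 = "1 + ?t5 + (1 + ?t6 + 40)"
  let ?u4 = "1 + ?t4 + ?u5"
  let ?u3 = "1 + ?t3 + ?u4"
  let ?u2 = "1 + ?t2 + ?u3"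
  let ?u1 = "1 + ?t1 + ?u2"
  have "computes eig ec main_prog s (1 + 30 + ?u1) ?post"
    unfolding main_prog_def
  proof (rule computes_step)
    fix s1 assume s1: "s1 = exec setup_prog s"
    have r1: "reg s1 0 = p" "reg s1 1 = q" "reg s1 2 = r" "reg s1 3 = m" "reg s1 4 = m + p"
      "reg s1 5 = p" "reg s1 10 = n" "reg s1 12 = n - r" "reg s1 13 = 0" "reg s1 14 = 0" "arr s1 = arr s"
      using dims flags by (auto simp: s1 setup_prog_def m_def n_def)
    show "computes eig ec (Seq stack_prog (Seq reduce_prog
      (Seq (dot_prog 4 0 0 half_product) (Seq (dot_prog 5 10 10 full_product)
        (Seq eliminate_prog (Seq enumerate_prog output_prog)))))) s1 ?u1 ?post"
    proof (rule computes_SeqI[OF computes_stack[OF r1(2,4,5,6)]])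
      fix s2 assume s2: "arr s2 3 = (\<lambda>i j. if i < m + p \<and> j < p
          then if i < q then arr s1 1 i j else if i < m then arr s1 2 (i - q) j
            else if i = m + j then 1 else 0
          else arr s1 3 i j)"
        and ag2: "agree (reg_writes stack_prog) (arr_writes stack_prog) s1 s2"
      define G where "G = arr s2 3"
      have G: "i < q \<Longrightarrow> j < p \<Longrightarrow> G i j = arr s 1 i j"
        "i < r \<Longrightarrow> j < p \<Longrightarrow> G (q + i) j = arr s 2 i j"
        "i < p \<Longrightarrow> j < p \<Longrightarrow> G (m + i) j = (if i = j then 1 else 0)" for i j
        using dims by (auto simp: G_def s2 r1 m_def)
      have indG: "independent_rows m p G"
        using ind unfolding m_def
        by (rule independent_rows_cong[OF _ order_refl]) (auto simp: G_def s2 r1 m_def)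
      have r2: "reg s2 0 = p" "reg s2 1 = q" "reg s2 2 = r" "reg s2 3 = m" "reg s2 4 = m + p"
        "reg s2 5 = p" "reg s2 10 = n" "reg s2 12 = n - r" "reg s2 13 = 0" "reg s2 14 = 0" "arr s2 0 = Q"
        using r1 agree_regD[OF ag2] agree_arrD[OF ag2] by (auto simp: Q_def)
      show "computes eig ec (Seq reduce_prog
        (Seq (dot_prog 4 0 0 half_product) (Seq (dot_prog 5 10 10 full_product)
          (Seq eliminate_prog (Seq enumerate_prog output_prog))))) s2 ?u2 ?post"
      proof (rule computes_SeqI[OF computes_reduce[OF r2(4,5,6) le_add1]])
        fix s3 assume red: "independent_rows m p (arr s2 3) \<longrightarrow> column_equiv (m + p) p (arr s2 3) (arr s3 3) \<and>
            (\<forall>i<m. \<forall>j<p. arr s3 3 i j = (if i = j then 1 else 0))"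
          and ag3: "agree (reg_writes reduce_prog) (arr_writes reduce_prog) s2 s3"
        define H where "H = arr s3 3"
        have H: "column_equiv (m + p) p G H"
          "\<And>i j. i < m \<Longrightarrow> j < p \<Longrightarrow> H i j = (if i = j then 1 else 0)"
          using red indG by (auto simp: G_def H_def)
        have r3: "reg s3 0 = p" "reg s3 1 = q" "reg s3 2 = r" "reg s3 3 = m"
          "reg s3 10 = n" "reg s3 12 = n - r" "reg s3 13 = 0" "reg s3 14 = 0" "arr s3 0 = Q"
          using r2 agree_regD[OF ag3] agree_arrD[OF ag3] by auto
        define W where "W = (\<lambda>a b. \<Sum>l<p. Q a l * H (m + l) b)"
        have "computes eig ec (dot_prog 4 0 0 half_product) s3 ?t3
          (\<lambda>s'. arr s' 4 = (\<lambda>a b. if a < p \<and> b < p then \<Sum>l<p. Q a l * H (m + l) b else arr s3 4 a b))"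
        proof (rule computes_dot)
          fix a b l s'
          assume "reg s' 9 = a" "reg s' 8 = b" "reg s' 20 = l" and ag: "agree {8, 9, 20} {4} s3 s'"
          moreover have "arr s' 0 = Q" "arr s' 3 = H" "reg s' 3 = m"
            using r3 agree_regD[OF ag] agree_arrD[OF ag] by (auto simp: H_def)
          ultimately show "rval s' half_product = Q a l * H (m + l) b"
            by (simp add: half_product_def)
        qed (use r3 in \<open>auto simp: half_product_def\<close>)
        then show "computes eig ec (Seq (dot_prog 4 0 0 half_product) (Seq (dot_prog 5 10 10 full_product)
          (Seq eliminate_prog (Seq enumerate_prog output_prog)))) s3 ?u3 ?post"
        proof (rule computes_SeqI)
          fix s4 assume s4: "arr s4 4 = (\<lambda>a b. if a < p \<and> b < p then \<Sum>l<p. Q a l * H (m + l) b else arr s3 4 a b)"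
            and ag4: "agree (reg_writes (dot_prog 4 0 0 half_product))
              (arr_writes (dot_prog 4 0 0 half_product)) s3 s4"
          have W: "arr s4 4 a b = W a b" if "a < p" "b < p" for a b
            using that by (simp add: s4 W_def)
          have r4: "reg s4 0 = p" "reg s4 1 = q" "reg s4 2 = r" "reg s4 3 = m"
            "reg s4 10 = n" "reg s4 12 = n - r" "reg s4 13 = 0" "reg s4 14 = 0" "arr s4 3 = H"
            using r3 agree_regD[OF ag4] agree_arrD[OF ag4] by (auto simp: H_def)
          define P where "P = (\<lambda>i j. \<Sum>l<p. H (m + l) (q + i) * W l (q + j))"
          have "computes eig ec (dot_prog 5 10 10 full_product) s4 ?t4
            (\<lambda>s'. arr s' 5 = (\<lambda>i j. if i < n \<and> j < n then \<Sum>l<p. H (m + l) (q + i) * W l (q + j)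
              else arr s4 5 i j))"
          proof (rule computes_dot)
            fix a b l s'
            assume "a < n" "b < n" "l < p" "reg s' 9 = a" "reg s' 8 = b" "reg s' 20 = l"
              and ag: "agree {8, 9, 20} {5} s4 s'"
            moreover have "arr s' 3 = H" "arr s' 4 = arr s4 4" "reg s' 3 = m" "reg s' 1 = q"
              using r4 agree_regD[OF ag] agree_arrD[OF ag] by auto
            ultimately show "rval s' full_product = H (m + l) (q + a) * W l (q + b)"
              by (simp add: full_product_def W n_def)
          qed (use r4 in \<open>auto simp: full_product_def\<close>)
          then show "computes eig ec (Seq (dot_prog 5 10 10 full_product)
            (Seq eliminate_prog (Seq enumerate_prog output_prog))) s4 ?u4 ?post"
          proof (rule computes_SeqI)
            fix s5 assume s5: "arr s5 5 = (\<lambda>i j. if i < n \<and> j < n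
                then \<Sum>l<p. H (m + l) (q + i) * W l (q + j) else arr s4 5 i j)"
              and ag5: "agree (reg_writes (dot_prog 5 10 10 full_product))
                (arr_writes (dot_prog 5 10 10 full_product)) s4 s5"
            have P: "arr s5 5 i j = P i j" if "i < n" "j < n" for i j
              using that by (simp add: s5 P_def)
            have r5: "reg s5 2 = r" "reg s5 10 = n" "reg s5 12 = n - r" "reg s5 13 = 0" "reg s5 14 = 0"
              using r4 agree_regD[OF ag5] by auto
            have rn: "r \<le> n" using dims by (simp add: n_def)
            have "symmetric n P"
              unfolding P_def W_def by (rule congruence_symmetric) (use sym in \<open>simp add: Q_def\<close>)
            then have symP: "symmetric n (arr s5 5)"
              using P by (simp add: symmetric_def)
            have linG: "lin p (G i) \<eta> = lin p (arr s 1 i) \<eta>" if "i < q" for i \<eta>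
              by (rule lin_cong) (use G that in auto)
            have linG': "lin p (G (q + i)) \<eta> = lin p (arr s 2 i) \<eta>" if "i < r" for i \<eta>
              by (rule lin_cong) (use G that in auto)
            have S: "S = {\<eta>. (\<forall>i<q. lin p (G i) \<eta> = 0) \<and> (\<forall>i<r. 0 \<le> lin p (G (q + i)) \<eta>)}"
              unfolding S_def by (simp add: linG linG')
            have Pf: "arr s5 5 i j = (\<Sum>a<p. H (m + a) (q + i) * (\<Sum>b<p. Q a b * H (m + b) (q + j)))"
              if "i < p - q" "j < p - q" for i j
              using P that by (simp add: P_def W_def n_def)
            have "m \<le> p" using dims by (simp add: m_def)
            note red = qform_column_reduction[OF H(1) m_def this G(3) H(2) Pf, folded S n_def]
            show "computes eig ec (Seq eliminate_prog (Seq enumerate_prog output_prog)) s5 ?u5 ?post"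
            proof (rule computes_SeqI[OF computes_eliminate[OF r5(2,3) rn r5(4,5) symP]])
              fix s6 assume el: "eliminated r n (arr s5 5) r s6"
                and ag6: "agree (reg_writes eliminate_prog) (arr_writes eliminate_prog) s5 s6"
              have r6: "reg s6 2 = r"
                using r5 agree_regD[OF ag6] by auto
              show "computes eig ec (Seq enumerate_prog output_prog) s6 (1 + ?t6 + 40) ?post"
              proof (rule computes_SeqI[OF computes_enumerate[OF r6]])
                let ?R = "arr s6 5"
                fix s7 :: memory assume en: "(reg s6 13 \<noteq> 0 \<longrightarrow> reg s7 13 \<noteq> 0) \<and> (reg s6 14 \<noteq> 0 \<longrightarrow> reg s7 14 \<noteq> 0) \<and>
                  (reg s7 13 \<noteq> 0 \<longrightarrow> reg s6 13 \<noteq> 0 \<or> takes_neg r r ?R) \<and>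
                  (reg s7 14 \<noteq> 0 \<longrightarrow> reg s6 14 \<noteq> 0 \<or> takes_nonpos r r ?R) \<and>
                  (symmetric r ?R \<longrightarrow> (takes_neg r r ?R \<longrightarrow> reg s7 13 \<noteq> 0) \<and>
                    (takes_nonpos r r ?R \<longrightarrow> reg s7 14 \<noteq> 0))"
                \<comment> \<open>If the elimination set the flag, the claim is already settled;
                  otherwise the reduced form takes negative values exactly if the original one does,
                  and the enumeration decides this.\<close>
                have neg: "reg s7 13 \<noteq> 0 \<longleftrightarrow> takes_neg r n (arr s5 5)"
                proof (cases "reg s6 13 = 0")
                  case True
                  then have "symmetric r ?R" "takes_neg r n (arr s5 5) \<longleftrightarrow> takes_neg r r ?R"
                    using el by (simp_all add: eliminated_def)
                  then show ?thesis using en True by blast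
                qed (use el en in \<open>simp add: eliminated_def\<close>)
                have nonpos: "reg s7 14 \<noteq> 0 \<longleftrightarrow> takes_nonpos r n (arr s5 5)" if "reg s7 13 = 0"
                proof -
                  \<comment> \<open>Flags are never cleared, so a zero at the end means that the
                    elimination ran through regularly.\<close>
                  have "reg s6 13 = 0" using that en by blast
                  then have "symmetric r ?R"
                    "takes_nonpos r n (arr s5 5) \<longleftrightarrow> reg s6 14 \<noteq> 0 \<or> takes_nonpos r r ?R"
                    using el by (simp_all add: eliminated_def)
                  then show ?thesis using en by blast
                qed
                show "computes eig ec output_prog s7 40 ?post"
                  unfolding output_prog_def
                  by (rule computes_loopfree; cases "reg s7 13 = 0")
                    (use neg nonpos red in \<open>simp_all add: Q_def[symmetric]\<close>)
              qed simp
            qed simp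
          qed simp
        qed simp
      qed simp
    qed simp
  qed (auto simp: setup_prog_def)
  moreover have "1 + 30 + ?u1 \<le> (p + 1) ^ 3 * 1000 + ?t6"
  proof -
    let ?z = "(p + 1) * (p + 1) * (p + 1)"
    \<comment> \<open>With \<open>m\<close> and \<open>n\<close> at most \<open>p\<close>, every
      stage before the enumeration is cubic in \<open>p\<close>. The remaining 77 is 30 for the
      setup, 40 for the output and 7 for sequencing.\<close>
    have m: "m + 1 \<le> p + 1" "m + p + 1 \<le> 2 * (p + 1)" "n + 1 \<le> p + 1"
      using dims by (auto simp: m_def n_def)
    have "?t1 \<le> 2 * (p + 1) * ((p + 1) * 80)"
      by (rule mult_le_mono1[OF m(2)])
    also have "\<dots> \<le> 2 * (p + 1) * ((p + 1) * 80) * (p + 1)" by simp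
    finally have 1: "?t1 \<le> 160 * ?z" by (simp add: algebra_simps)
    have "?t2 \<le> (p + 1) * ((p + 1) * (2 * (p + 1)) * 130)"
      by (intro mult_le_mono m order_refl)
    then have 2: "?t2 \<le> 260 * ?z" by (simp add: algebra_simps)
    have 3: "?t3 \<le> 60 * ?z" by (simp add: algebra_simps)
    have "?t4 \<le> (p + 1) * ((p + 1) * ((p + 1) * (20 + 40)))"
      by (intro mult_le_mono m order_refl)
    then have 4: "?t4 \<le> 60 * ?z" by (simp add: algebra_simps)
    have "?t5 \<le> (p + 1) * ((p + 1) * ((p + 1) * 80))"
      by (intro mult_le_mono m order_refl)
    then have 5: "?t5 \<le> 80 * ?z" by (simp add: algebra_simps)
    have 6: "1 \<le> ?z" by simp
    have "1 + 30 + ?u1 = 77 + ?t1 + ?t2 + ?t3 + ?t4 + ?t5 + ?t6" by simp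
    also have "\<dots> \<le> 77 * ?z + 160 * ?z + 260 * ?z + 60 * ?z + 60 * ?z + 80 * ?z + ?t6"
      using 6 by (intro add_mono 1 2 3 4 5) simp_all
    also have "\<dots> = 697 * ?z + ?t6"
      by simp
    also have "\<dots> \<le> (p + 1) ^ 3 * 1000 + ?t6"
      by (simp add: power3_eq_cube)
    finally show ?thesis .
  qed
  ultimately show ?thesis
    by (rule computes_mono)
qed


section \<open>From matrices to arrays\<close>

text \<open>A maximal independent set of columns has \<open>nc\<close> elements, so it contains all
  columns and they are distinct. Distinctness matters because a set of columns would not reveal a
  repeated one.\<close>

lemma (in vec_space) full_rank_injective:
  assumes A: "A \<in> carrier_mat n nc" and rank: "rank A = nc"
  shows "nc \<le> n" and "v \<in> carrier_vec nc \<Longrightarrow> A *\<^sub>v v = 0\<^sub>v n \<Longrightarrow> v = 0\<^sub>v nc"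
proof -
  obtain S where S: "maximal S (\<lambda>T. T \<subseteq> set (cols A) \<and> lin_indpt T)"
    using maximal_exists[of "(\<lambda>T. T \<subseteq> set (cols A) \<and> lin_indpt T)" "card (set (cols A))" "{}"]
    by (meson List.finite_set card_mono empty_iff empty_subsetI finite_lin_indpt2 rev_finite_subset)
  have card: "card S = nc"
    using rank_card_indpt[OF A S] rank by simp
  have sub: "S \<subseteq> set (cols A)" and ind: "lin_indpt S"
    using S by (auto simp: maximal_def)
  have len: "length (cols A) = nc"
    using A by simp
  have "card S \<le> card (set (cols A))"
    by (rule card_mono[OF _ sub]) simp
  then have c: "card (set (cols A)) = nc"
    using card_length[of "cols A"] len card by linarith
  then have S_eq: "S = set (cols A)"
    using card_subset_eq[OF _ sub] card by simp
  have dist: "distinct (cols A)"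
    using c len by (simp add: card_distinct)
  have "set (cols A) \<subseteq> carrier_vec n"
    using A cols_dim by blast
  then show "nc \<le> n"
    using li_le_dim(2)[OF fin_dim _ ind] S_eq card by (simp add: dim_is_n)
  show "v = 0\<^sub>v nc" if "v \<in> carrier_vec nc" "A *\<^sub>v v = 0\<^sub>v n"
    using lin_depI[OF A that(1) _ that(2) dist] ind S_eq by blast
qed

text \<open>The coefficients of a relation between rows of \<open>M\<close> form a nonzero vector
  killed by the transpose.\<close>

lemma full_rank_independent_rows:
  assumes M: "M \<in> carrier_mat m p" and rank: "vec_space.rank p (transpose_mat M) = m"
    and G: "\<And>i j. i < m \<Longrightarrow> j < p \<Longrightarrow> G i j = M $$ (i, j)"
  shows "m \<le> p" and "independent_rows m p G"
proof -
  interpret vec_space "TYPE(real)" p .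
  have MT: "transpose_mat M \<in> carrier_mat p m" using M by simp
  show "m \<le> p" by (rule full_rank_injective(1)[OF MT rank])
  show "independent_rows m p G"
    unfolding independent_rows_def
  proof (intro allI impI, rule ccontr)
    fix k a
    assume k: "k < m" and "\<nexists>w. lin p (G k) w \<noteq> (\<Sum>i<k. a i * lin p (G i) w)"
    then have eq: "lin p (G k) w = (\<Sum>i<k. a i * lin p (G i) w)" for w
      by blast
    define u where "u i = (if i < k then - a i else if i = k then 1 else 0)" for i
    have "transpose_mat M *\<^sub>v vec m u = 0\<^sub>v p"
    proof
      fix j assume "j < dim_vec (0\<^sub>v p :: real vec)"
      then have j: "j < p" by simp
      have split: "{..<m} = {..<k} \<union> {k} \<union> {Suc k..<m}"
        using k by auto
      have "(transpose_mat M *\<^sub>v vec m u) $ j = (\<Sum>i<m. G i j * u i)"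
        using j M by (auto simp: scalar_prod_def G lessThan_atLeast0 intro!: sum.cong)
      also have "\<dots> = (\<Sum>i<k. G i j * - a i) + G k j"
        unfolding split by (subst sum.union_disjoint, simp, simp, force)+ (simp add: u_def)
      also have "\<dots> = - (\<Sum>i<k. a i * G i j) + G k j"
        by (simp add: sum_negf mult.commute)
      also have "(\<Sum>i<k. a i * G i j) = G k j"
        using eq[of "\<lambda>i. if i = j then 1 else 0"] by (simp add: lin_unit_right[OF j])
      finally show "(transpose_mat M *\<^sub>v vec m u) $ j = 0\<^sub>v p $ j"
        using j by simp
    qed (use M in simp)
    then have "vec m u = 0\<^sub>v m"
      by (rule full_rank_injective(2)[OF MT rank, rotated]) simp
    then have "vec m u $ k = 0\<^sub>v m $ k" by simp
    then show False using k by (simp add: u_def)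
  qed
qed

section \<open>Matrix expressions as sums over functions\<close>

lemma mult_mat_vec_eq_lin:
  assumes "A \<in> carrier_mat q p" "i < q"
  shows "(A *\<^sub>v vec p f) $ i = lin p (\<lambda>j. A $$ (i, j)) f"
  using assms by (auto simp: scalar_prod_def lin_def lessThan_atLeast0 intro!: sum.cong)

lemma quadratic_value_eq_qform:
  assumes Q: "Q \<in> carrier_mat p p"
  shows "vec p f \<bullet> (Q *\<^sub>v vec p f) = qform p (\<lambda>i j. Q $$ (i, j)) f"
proof -
  have "vec p f \<bullet> (Q *\<^sub>v vec p f) = (\<Sum>i<p. f i * (Q *\<^sub>v vec p f) $ i)"
    using Q by (auto simp: scalar_prod_def lessThan_atLeast0 intro!: sum.cong)
  also have "\<dots> = (\<Sum>i<p. f i * lin p (\<lambda>j. Q $$ (i, j)) f)"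
    using mult_mat_vec_eq_lin[OF Q] by (intro sum.cong) auto
  finally show ?thesis
    by (simp add: qform_def lin_def sum_distrib_left mult.assoc)
qed

lemma vec_in_feasible_set_iff:
  assumes A: "A \<in> carrier_mat q p" and B: "B \<in> carrier_mat r p"
  shows "vec p f \<in> feasible_set A B \<longleftrightarrow> (\<forall>i<q. lin p (\<lambda>j. A $$ (i, j)) f = 0) \<and>
    (\<forall>i<r. 0 \<le> lin p (\<lambda>j. B $$ (i, j)) f)"
proof -
  have "A *\<^sub>v vec p f = 0\<^sub>v q \<longleftrightarrow> (\<forall>i<q. lin p (\<lambda>j. A $$ (i, j)) f = 0)"
    using A mult_mat_vec_eq_lin[OF A, of _ f] by (auto simp: vec_eq_iff simp del: index_mult_mat_vec)
  moreover have "B *\<^sub>v vec p f \<ge> 0\<^sub>v r \<longleftrightarrow> (\<forall>i<r. 0 \<le> lin p (\<lambda>j. B $$ (i, j)) f)"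
    using B mult_mat_vec_eq_lin[OF B, of _ f] by (auto simp: less_eq_vec_def simp del: index_mult_mat_vec)
  ultimately show ?thesis
    using A B by (simp add: feasible_set_def)
qed

lemma bex_feasible_set:
  assumes A: "A \<in> carrier_mat q p"
  shows "(\<exists>\<eta>\<in>feasible_set A B. X \<eta>) \<longleftrightarrow> (\<exists>f. vec p f \<in> feasible_set A B \<and> X (vec p f))"
proof
  assume "\<exists>\<eta>\<in>feasible_set A B. X \<eta>"
  then obtain \<eta> where \<eta>: "\<eta> \<in> feasible_set A B" "X \<eta>" by blast
  then have "vec p (($) \<eta>) = \<eta>"
    using A by (auto simp: feasible_set_def)
  then show "\<exists>f. vec p f \<in> feasible_set A B \<and> X (vec p f)"
    using \<eta> by metis
qed blast

theorem lemma4: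
  shows "\<exists>prog :: com.
    \<forall>ec :: nat \<Rightarrow> nat. (\<lambda>n. real (ec n)) \<in> O(\<lambda>n. real n ^ 3) \<longrightarrow>
    (\<exists>C :: real. \<forall>eig p q r. \<forall>Q \<in> carrier_mat p p. \<forall>A \<in> carrier_mat q p. \<forall>B \<in> carrier_mat r p.
       eigensolver eig \<longrightarrow> p > 0 \<longrightarrow>
       transpose_mat Q = Q \<longrightarrow>
       vec_space.rank q A = q \<longrightarrow> vec_space.rank r B = r \<longrightarrow>
       vec_space.rank p (transpose_mat (A @\<^sub>r B)) = q + r \<longrightarrow>
       (\<exists>t s. run eig ec prog (initial Q A B) t s \<and>
          real t \<le> C * (real p ^ 3 + real r ^ 3 * 2 ^ r) \<and>
          reg s 0 \<in> {1, 2, 3} \<and>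
          (reg s 0 = 1 \<longleftrightarrow> T1 Q (feasible_set A B)) \<and>
          (reg s 0 = 2 \<longleftrightarrow> T2 Q (feasible_set A B)) \<and>
          (reg s 0 = 3 \<longleftrightarrow> T3 Q (feasible_set A B))))"
proof (rule exI[of _ main_prog], intro allI impI exI[of _ "70000 :: real"] ballI)
  fix ec :: "nat \<Rightarrow> nat" and eig p q r and Q A B :: "real mat"
  assume Q: "Q \<in> carrier_mat p p" and A: "A \<in> carrier_mat q p" and B: "B \<in> carrier_mat r p"
    and p: "p > 0" and sym: "transpose_mat Q = Q"
    and rank: "vec_space.rank p (transpose_mat (A @\<^sub>r B)) = q + r"
  let ?s = "initial Q A B"
  have mem: "reg ?s 0 = p" "reg ?s 1 = q" "reg ?s 2 = r" "reg ?s 13 = 0" "reg ?s 14 = 0"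
    "\<And>i j. i < p \<Longrightarrow> j < p \<Longrightarrow> arr ?s 0 i j = Q $$ (i, j)"
    "\<And>i j. i < q \<Longrightarrow> j < p \<Longrightarrow> arr ?s 1 i j = A $$ (i, j)"
    "\<And>i j. i < r \<Longrightarrow> j < p \<Longrightarrow> arr ?s 2 i j = B $$ (i, j)"
    using Q A B by (auto simp: initial_def store_mat_def)
  have AB: "A @\<^sub>r B \<in> carrier_mat (q + r) p"
    using A B by simp
  have entries: "(if i < q then arr ?s 1 i else arr ?s 2 (i - q)) j = (A @\<^sub>r B) $$ (i, j)"
    if "i < q + r" "j < p" for i j
    using that A B mem by (auto simp: append_rows_def)
  have ind: "q + r \<le> p" "independent_rows (q + r) p (\<lambda>i. if i < q then arr ?s 1 i else arr ?s 2 (i - q))"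
    using full_rank_independent_rows[OF AB rank, of "\<lambda>i. if i < q then arr ?s 1 i else arr ?s 2 (i - q)"]
      entries by blast+
  have "arr ?s 0 i j = arr ?s 0 j i" if "i < p" "j < p" for i j
  proof -
    have "Q $$ (i, j) = transpose_mat Q $$ (j, i)" using Q that by simp
    then show ?thesis using mem that sym by simp
  qed
  then have symQ: "symmetric p (arr ?s 0)"
    by (simp add: symmetric_def)
  let ?S = "{\<eta>. (\<forall>i<q. lin p (arr ?s 1 i) \<eta> = 0) \<and> (\<forall>i<r. 0 \<le> lin p (arr ?s 2 i) \<eta>)}"
  let ?neg = "\<exists>\<eta>\<in>?S. qform p (arr ?s 0) \<eta> < 0"
  let ?nonpos = "\<exists>\<eta>\<in>?S. (\<exists>i<p. \<eta> i \<noteq> 0) \<and> qform p (arr ?s 0) \<eta> \<le> 0"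
  obtain t s where run: "run eig ec main_prog ?s t s"
    and t: "t \<le> (p + 1) ^ 3 * 1000 + (2 ^ r + 1) * ((r + 1) ^ 3 * 4100)"
    and out: "reg s 0 = (if ?neg then 3 else if ?nonpos then 2 else 1)"
    using computes_main[OF mem(1-3) ind(1) mem(4,5) symQ ind(2), of eig ec]
    unfolding computes_def by blast
  have linA: "lin p (arr ?s 1 i) f = lin p (\<lambda>j. A $$ (i, j)) f" if "i < q" for i f
    by (rule lin_cong) (use mem that in auto)
  have linB: "lin p (arr ?s 2 i) f = lin p (\<lambda>j. B $$ (i, j)) f" if "i < r" for i f
    by (rule lin_cong) (use mem that in auto)
  have S: "f \<in> ?S \<longleftrightarrow> vec p f \<in> feasible_set A B" for f
    unfolding vec_in_feasible_set_iff[OF A B] by (simp add: linA linB del: One_nat_def)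
  have val: "qform p (arr ?s 0) f = vec p f \<bullet> (Q *\<^sub>v vec p f)" for f
    unfolding quadratic_value_eq_qform[OF Q] by (rule qform_cong) (use mem in auto)
  have nz: "(\<exists>i<p. f i \<noteq> 0) \<longleftrightarrow> vec p f \<noteq> 0\<^sub>v p" for f :: "nat \<Rightarrow> real"
    by (auto simp: vec_eq_iff)
  have dimQ: "dim_row Q = p" using Q by simp
  have exS: "(\<exists>f\<in>?S. X f) \<longleftrightarrow> (\<exists>f. vec p f \<in> feasible_set A B \<and> X f)" for X
    unfolding Bex_def S ..
  have T3: "T3 Q (feasible_set A B) \<longleftrightarrow> ?neg"
    unfolding T3_def bex_feasible_set[OF A] exS val ..
  have nonpos: "?nonpos \<longleftrightarrow> (\<exists>\<eta>\<in>feasible_set A B. \<eta> \<noteq> 0\<^sub>v p \<and> \<eta> \<bullet> (Q *\<^sub>v \<eta>) \<le> 0)"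
    unfolding bex_feasible_set[OF A] exS val nz ..
  then have T1: "T1 Q (feasible_set A B) \<longleftrightarrow> \<not> ?nonpos"
    unfolding T1_def dimQ by (auto simp: not_less)
  have zero: "\<eta> \<bullet> (Q *\<^sub>v \<eta>) = 0" if "\<eta> = 0\<^sub>v p" for \<eta>
    using that Q by simp
  \<comment> \<open>A nonzero feasible vector with nonpositive value has value exactly 0 once
    negative values are excluded.\<close>
  have T2: "T2 Q (feasible_set A B) \<longleftrightarrow> \<not> T3 Q (feasible_set A B) \<and> \<not> T1 Q (feasible_set A B)"
    unfolding T1_def T2_def T3_def dimQ by (auto simp: not_less intro: antisym)
  have T31: "T3 Q (feasible_set A B) \<Longrightarrow> \<not> T1 Q (feasible_set A B)"
    unfolding T1_def T3_def dimQ using zero by (metis less_asym less_irrefl)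
  \<comment> \<open>Replacing \<open>p + 1\<close> by \<open>2 * p\<close>, \<open>r + 1\<close> by
    \<open>2 * r\<close> and \<open>2^r + 1\<close> by \<open>2 * 2^r\<close> turns 1000 into 8000
    and 4100 into 65600; 70000 exceeds both \<open>8000 + 8200\<close> and 65600. The cost
    \<open>ec\<close> does not enter, as the program never calls the eigensolver.\<close>
  have "t \<le> 70000 * (p ^ 3 + r ^ 3 * 2 ^ r)"
  proof -
    have "(p + 1) ^ 3 \<le> (2 * p) ^ 3"
      by (rule power_mono) (use p in auto)
    then have 1: "(p + 1) ^ 3 * 1000 \<le> 8000 * p ^ 3"
      by (simp add: power_mult_distrib)
    have p3: "1 \<le> p ^ 3" using p by simp
    have 2: "(2 ^ r + 1) * ((r + 1) ^ 3 * 4100) \<le> 8200 * p ^ 3 + 65600 * (r ^ 3 * 2 ^ r)"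
    \<comment> \<open>For \<open>r = 0\<close> the term \<open>r ^ 3 * 2 ^ r\<close> vanishes,
      although the empty face is still processed; its cost 8200 is charged to \<open>p ^ 3\<close>,
      which is at least 1.\<close>
    proof (cases "r = 0")
      case True
      then show ?thesis using p3 by simp
    next
      case False
      have "(r + 1) ^ 3 \<le> (2 * r) ^ 3"
        by (rule power_mono) (use False in auto)
      then have "(2 ^ r + 1) * ((r + 1) ^ 3 * 4100) \<le> (2 * 2 ^ r) * ((2 * r) ^ 3 * 4100)"
        by (intro mult_le_mono) auto
      also have "\<dots> = 65600 * (r ^ 3 * 2 ^ r)"
        by (simp add: power_mult_distrib)
      finally show ?thesis by (rule trans_le_add2)
    qed
    note t
    also have "(p + 1) ^ 3 * 1000 + (2 ^ r + 1) * ((r + 1) ^ 3 * 4100)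
        \<le> 8000 * p ^ 3 + (8200 * p ^ 3 + 65600 * (r ^ 3 * 2 ^ r))"
      by (rule add_mono[OF 1 2])
    also have "\<dots> \<le> 70000 * (p ^ 3 + r ^ 3 * 2 ^ r)"
      by (simp add: algebra_simps)
    finally show ?thesis .
  qed
  then have "real t \<le> real (70000 * (p ^ 3 + r ^ 3 * 2 ^ r))"
    by (rule of_nat_mono)
  then have time: "real t \<le> 70000 * (real p ^ 3 + real r ^ 3 * 2 ^ r)"
    by simp
  show "\<exists>t s. run eig ec main_prog (initial Q A B) t s \<and>
          real t \<le> 70000 * (real p ^ 3 + real r ^ 3 * 2 ^ r) \<and>
          reg s 0 \<in> {1, 2, 3} \<and>
          (reg s 0 = 1 \<longleftrightarrow> T1 Q (feasible_set A B)) \<and>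
          (reg s 0 = 2 \<longleftrightarrow> T2 Q (feasible_set A B)) \<and>
          (reg s 0 = 3 \<longleftrightarrow> T3 Q (feasible_set A B))"
    using run time out T1 T2 T3 T31 by (intro exI[of _ t] exI[of _ s]) auto
qed

end
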